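(* Let $\Omega$ be a non-empty set, let $K$ be a CNP kernel on $\Omega$ that is normalized at $\mathsf{w}\in\Omega$, and let $\mathcal{E}$ be a Hilbert space and $u:\Omega\to\mathcal{B}_1(\mathcal{E},\mathbb{C})$ a function such that $u(\mathsf{w})=0$ and $K=K_u$, i.e. $K(x,y)=\frac{1}{1-u(x)u(y)^*}$ for all $x,y\in\Omega$. Let $\varphi:\Omega\to\mathbb{D}$ be a non-constant function in $\mathcal{M}_1(\mathcal{H}(K_u))$ such that $\varphi(\mathsf{w})=0$. Then the de Branges-Rovnyak space $\mathcal{H}(K_u^\varphi)$ is a CNP space if and only if there exists $\Psi\in H^\infty_1(\mathbb{D},\mathcal{B}(\mathbb{C},\mathcal{E}))$ such that $$\varphi(x)=u(x)\,\Psi(\varphi(x))\qquad(x\in\Omega).$$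
   Context: All Hilbert spaces are complex. $\mathbb{D}$ is the open unit disc in $\mathbb{C}$. $\mathcal{B}(\mathcal{F},\mathcal{G})$ denotes the bounded linear operators from $\mathcal{F}$ to $\mathcal{G}$, and $\mathcal{B}_1(\mathcal{F},\mathcal{G})$ its open unit ball; $\mathcal{B}(\mathbb{C})$ is identified with $\mathbb{C}$. A kernel on $\Omega$ is a function $K:\Omega\times\Omega\to\mathbb{C}$ such that for every finite set $\{x_1,\dots,x_n\}\subset\Omega$ the matrix $[K(x_i,x_j)]_{i,j=1}^n$ is positive semi-definite; $\mathcal{H}(K)$ is the associated reproducing kernel Hilbert space. $K$ is normalized at $\mathsf{w}$ if $K(x,\mathsf{w})=1$ for all $x\in\Omega$. A multiplier of $\mathcal{H}(K)$ is a function $\varphi:\Omega\to\mathbb{C}$ with $\varphi f\in\mathcal{H}(K)$ for all $f\in\mathcal{H}(K)$; it is contractive if the multiplication operator $M_\varphi f=\varphi f$ satisfies $\|M_\varphi\|\le1$, equivalently if $(1-\varphi(x)\overline{\varphi(y)})K(x,y)$ is a kernel. $\mathcal{M}_1(\mathcal{H}(K))$ is the set of contractive multipliers. For $\varphi\in\mathcal{M}_1(\mathcal{H}(K))$, $K^\varphi(x,y)=(1-\varphi(x)\overline{\varphi(y)})K(x,y)$, and $\mathcal{H}(K^\varphi)$ is the de Branges-Rovnyak space associated to $\varphi$. A kernel $K$ on $\Omega$ is a complete Nevanlinna-Pick (CNP) kernel, and $\mathcal{H}(K)$ a CNP space, if for all $m,n\in\mathbb{N}$, every finite set of distinct points $x_1,\dots,x_k\in\Omega$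 and all complex $m\times n$ matrices $W_1,\dots,W_k$ for which the block matrix $[(I-W_iW_j^* )K(x_i,x_j)]_{i,j=1}^k$ is positive semi-definite, there is a function $\Phi$ from $\Omega$ to the $m\times n$ matrices, multiplying $\mathcal{H}(K)\otimes\mathbb{C}^n$ into $\mathcal{H}(K)\otimes\mathbb{C}^m$, with $\Phi(x_i)=W_i$ for all $i$ and $\|M_\Phi\|\le1$. $H^\infty_1(\mathbb{D},\mathcal{B}(\mathcal{F},\mathcal{G}))$ is the set of holomorphic functions $\Psi:\mathbb{D}\to\mathcal{B}(\mathcal{F},\mathcal{G})$ with $\sup_{z\in\mathbb{D}}\|\Psi(z)\|\le1$. *)

theory Defs
  imports "HOL-Analysis.Analysis"
begin

section \<open>Complex normed and Hilbert spaces\<close>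

class complex_normed_vector = real_normed_vector +
  fixes scaleC :: "complex \<Rightarrow> 'a \<Rightarrow> 'a"  (infixr \<open>*\<^sub>C\<close> 75)
  assumes scaleC_add_right: "a *\<^sub>C (x + y) = a *\<^sub>C x + a *\<^sub>C y"
    and scaleC_add_left: "(a + b) *\<^sub>C x = a *\<^sub>C x + b *\<^sub>C x"
    and scaleC_scaleC: "a *\<^sub>C b *\<^sub>C x = (a * b) *\<^sub>C x"
    and scaleC_of_real: "complex_of_real r *\<^sub>C x = r *\<^sub>R x"
    and norm_scaleC: "norm (a *\<^sub>C x) = cmod a * norm x"

text \<open>Inner products are linear in the first argument. Positive definiteness of \<open>cinner\<close>
  is contained in \<open>cinner_self\<close>.\<close>

class complex_hilbert_space = complex_normed_vector + complete_space +
  fixes cinner :: "'a \<Rightarrow> 'a \<Rightarrow> complex"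
  assumes cinner_commute: "cinner x y = cnj (cinner y x)"
    and cinner_add_left: "cinner (x + y) z = cinner x z + cinner y z"
    and cinner_scaleC_left: "cinner (a *\<^sub>C x) y = a * cinner x y"
    and cinner_self: "cinner x x = complex_of_real ((norm x)\<^sup>2)"

instantiation complex :: complex_hilbert_space
begin

definition scaleC_complex :: "complex \<Rightarrow> complex \<Rightarrow> complex"
  where "scaleC_complex a z = a * z"

definition cinner_complex :: "complex \<Rightarrow> complex \<Rightarrow> complex"
  where "cinner_complex z w = z * cnj w"

instance
  by standard
    (auto simp: scaleC_complex_def cinner_complex_def algebra_simps norm_mult scaleR_conv_of_real
       complex_norm_square simp flip: of_real_power)

end

instantiation blinfun :: (real_normed_vector, complex_normed_vector) complex_normed_vector
begin

lift_definition scaleC_blinfun :: "complex \<Rightarrow> 'a \<Rightarrow>\<^sub>L 'b \<Rightarrow> 'a \<Rightarrow>\<^sub>L 'b"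
  is "\<lambda>c f x. c *\<^sub>C f x"
proof -
  fix c :: complex and f :: "'a \<Rightarrow> 'b"
  assume "bounded_linear f"
  have "bounded_linear (\<lambda>y::'b. c *\<^sub>C y)"
  proof (rule bounded_linear_intro[where K = "cmod c"])
    show "c *\<^sub>C (r *\<^sub>R y) = r *\<^sub>R (c *\<^sub>C y)" for r and y :: 'b
      by (simp add: scaleC_scaleC mult.commute flip: scaleC_of_real)
  qed (simp_all add: scaleC_add_right norm_scaleC mult.commute)
  then show "bounded_linear (\<lambda>x. c *\<^sub>C f x)"
    using \<open>bounded_linear f\<close> by (rule bounded_linear_compose)
qed

instance
proof
  fix a b :: complex and r :: real and f g :: "'a \<Rightarrow>\<^sub>L 'b"
  show "a *\<^sub>C (f + g) = a *\<^sub>C f + a *\<^sub>C g"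
    by transfer (simp add: scaleC_add_right)
  show "(a + b) *\<^sub>C f = a *\<^sub>C f + b *\<^sub>C f"
    by transfer (simp add: scaleC_add_left)
  show "a *\<^sub>C b *\<^sub>C f = (a * b) *\<^sub>C f"
    by transfer (simp add: scaleC_scaleC)
  show "complex_of_real r *\<^sub>C f = r *\<^sub>R f"
    by transfer (simp add: scaleC_of_real)
  have le: "norm (c *\<^sub>C h) \<le> cmod c * norm h" for c and h :: "'a \<Rightarrow>\<^sub>L 'b"
  proof (rule norm_blinfun_bound)
    fix x
    have "norm (blinfun_apply (c *\<^sub>C h) x) = cmod c * norm (blinfun_apply h x)"
      by (simp add: scaleC_blinfun.rep_eq norm_scaleC)
    also have "\<dots> \<le> cmod c * (norm h * norm x)"
      by (intro mult_left_mono norm_blinfun) simp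
    finally show "norm (blinfun_apply (c *\<^sub>C h) x) \<le> cmod c * norm h * norm x"
      by (simp add: mult.assoc)
  qed simp
  show "norm (a *\<^sub>C f) = cmod a * norm f"
  proof (cases "a = 0")
    case True
    then show ?thesis using le[of 0 f] by simp
  next
    case False
    have "inverse a *\<^sub>C a *\<^sub>C f = f"
      using False by transfer (simp add: scaleC_scaleC scaleC_of_real[of 1, simplified])
    then have "norm f \<le> cmod (inverse a) * norm (a *\<^sub>C f)"
      using le[of "inverse a" "a *\<^sub>C f"] by simp
    then have "cmod a * norm f \<le> norm (a *\<^sub>C f)"
      using False by (simp add: norm_divide field_simps)
    with le[of a f] show ?thesis by simp
  qed
qed

end

section \<open>Bounded complex-linear operators\<close>

text \<open>The type \<open>'f \<Rightarrow>\<^sub>L 'g\<close> consists of the bounded real-linear maps, with the operator norm;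
  the complex-linear ones are singled out by the set \<open>bounded_ops\<close>.\<close>

definition bounded_ops :: "('f::complex_normed_vector \<Rightarrow>\<^sub>L 'g::complex_normed_vector) set"
  where "bounded_ops = {T. \<forall>c x. blinfun_apply T (c *\<^sub>C x) = c *\<^sub>C blinfun_apply T x}"

definition open_unit_ball_ops :: "('f::complex_normed_vector \<Rightarrow>\<^sub>L 'g::complex_normed_vector) set"
  where "open_unit_ball_ops = {T \<in> bounded_ops. norm T < 1}"

text \<open>Meaningful for \<open>T \<in> bounded_ops\<close>, where it exists and is unique by the Riesz
  representation theorem.\<close>

definition hilbert_adjoint ::
    "('f::complex_hilbert_space \<Rightarrow>\<^sub>L 'g::complex_hilbert_space) \<Rightarrow> ('g \<Rightarrow>\<^sub>L 'f)"
  where "hilbert_adjoint T =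
    (THE S. \<forall>x y. cinner (blinfun_apply T x) y = cinner x (blinfun_apply S y))"

text \<open>The identification of an operator on \<open>\<complex>\<close> with a complex number.\<close>

definition op_complex :: "(complex \<Rightarrow>\<^sub>L complex) \<Rightarrow> complex"
  where "op_complex T = blinfun_apply T 1"

definition vholomorphic_on :: "(complex \<Rightarrow> 'a::complex_normed_vector) \<Rightarrow> complex set \<Rightarrow> bool"
  where "vholomorphic_on f S \<longleftrightarrow>
    (\<forall>z\<in>S. \<exists>D. (f has_derivative (\<lambda>h. h *\<^sub>C D)) (at z within S))"

definition Hinf1 :: "(complex \<Rightarrow> 'f::complex_normed_vector \<Rightarrow>\<^sub>L 'g::complex_normed_vector) set"
  where "Hinf1 = {\<Psi>. (\<forall>z\<in>ball 0 1. \<Psi> z \<in> bounded_ops) \<and> vholomorphic_on \<Psi> (ball 0 1) \<and>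
    (\<forall>z\<in>ball 0 1. norm (\<Psi> z) \<le> 1)}"

section \<open>Kernels and reproducing kernel Hilbert spaces\<close>

text \<open>The set \<open>\<Omega>\<close> is the type \<open>'x\<close>. A matrix is a function of two indices, of which only the
  entries with indices in the finite set \<open>I\<close> matter.\<close>

definition psd_on :: "'i set \<Rightarrow> ('i \<Rightarrow> 'i \<Rightarrow> complex) \<Rightarrow> bool"
  where "psd_on I A \<longleftrightarrow>
    (\<forall>c. let q = (\<Sum>i\<in>I. \<Sum>j\<in>I. cnj (c i) * A i j * c j) in q \<in> \<real> \<and> 0 \<le> Re q)"

definition kernel :: "('x \<Rightarrow> 'x \<Rightarrow> complex) \<Rightarrow> bool"
  where "kernel K \<longleftrightarrow> (\<forall>X. finite X \<longrightarrow> psd_on X K)"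

definition normalized_at :: "('x \<Rightarrow> 'x \<Rightarrow> complex) \<Rightarrow> 'x \<Rightarrow> bool"
  where "normalized_at K w \<longleftrightarrow> (\<forall>x. K x w = 1)"

text \<open>The inner product \<open>ip\<close> is only constrained on \<open>H\<close>.\<close>

definition fun_ip_space :: "('x \<Rightarrow> complex) set \<Rightarrow>
    (('x \<Rightarrow> complex) \<Rightarrow> ('x \<Rightarrow> complex) \<Rightarrow> complex) \<Rightarrow> bool"
  where "fun_ip_space H ip \<longleftrightarrow>
    (\<lambda>x. 0) \<in> H \<and>
    (\<forall>f\<in>H. \<forall>g\<in>H. (\<lambda>x. f x + g x) \<in> H) \<and>
    (\<forall>c. \<forall>f\<in>H. (\<lambda>x. c * f x) \<in> H) \<and>
    (\<forall>f\<in>H. \<forall>g\<in>H. \<forall>h\<in>H. ip (\<lambda>x. f x + g x) h = ip f h + ip g h) \<and>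
    (\<forall>c. \<forall>f\<in>H. \<forall>g\<in>H. ip (\<lambda>x. c * f x) g = c * ip f g) \<and>
    (\<forall>f\<in>H. \<forall>g\<in>H. ip f g = cnj (ip g f)) \<and>
    (\<forall>f\<in>H. 0 \<le> Re (ip f f)) \<and>
    (\<forall>f\<in>H. ip f f = 0 \<longrightarrow> f = (\<lambda>x. 0))"

definition ip_norm :: "(('x \<Rightarrow> complex) \<Rightarrow> ('x \<Rightarrow> complex) \<Rightarrow> complex) \<Rightarrow> ('x \<Rightarrow> complex) \<Rightarrow> real"
  where "ip_norm ip f = sqrt (Re (ip f f))"

definition fun_hilbert_space :: "('x \<Rightarrow> complex) set \<Rightarrow>
    (('x \<Rightarrow> complex) \<Rightarrow> ('x \<Rightarrow> complex) \<Rightarrow> complex) \<Rightarrow> bool"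
  where "fun_hilbert_space H ip \<longleftrightarrow> fun_ip_space H ip \<and>
    (\<forall>s. (\<forall>n. s n \<in> H) \<and>
         (\<forall>e>0. \<exists>N. \<forall>m\<ge>N. \<forall>n\<ge>N. ip_norm ip (\<lambda>x. s m x - s n x) < e) \<longrightarrow>
         (\<exists>f\<in>H. (\<lambda>n. ip_norm ip (\<lambda>x. s n x - f x)) \<longlonglongrightarrow> 0))"

definition is_rkhs :: "('x \<Rightarrow> 'x \<Rightarrow> complex) \<Rightarrow> ('x \<Rightarrow> complex) set \<Rightarrow>
    (('x \<Rightarrow> complex) \<Rightarrow> ('x \<Rightarrow> complex) \<Rightarrow> complex) \<Rightarrow> bool"
  where "is_rkhs K H ip \<longleftrightarrow> fun_hilbert_space H ip \<and>
    (\<forall>y. (\<lambda>x. K x y) \<in> H) \<and>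
    (\<forall>f\<in>H. \<forall>y. ip f (\<lambda>x. K x y) = f y)"

text \<open>By the Moore--Aronszajn theorem every kernel has a reproducing kernel Hilbert space; its
  underlying set and the restriction of \<open>ip\<close> to it are unique. The choice below hence only
  concerns the irrelevant values of \<open>ip\<close> outside \<open>H\<close>.\<close>

definition rkhs :: "('x \<Rightarrow> 'x \<Rightarrow> complex) \<Rightarrow>
    ('x \<Rightarrow> complex) set \<times> (('x \<Rightarrow> complex) \<Rightarrow> ('x \<Rightarrow> complex) \<Rightarrow> complex)"
  where "rkhs K = (SOME (H, ip). is_rkhs K H ip)"

definition rkhs_set :: "('x \<Rightarrow> 'x \<Rightarrow> complex) \<Rightarrow> ('x \<Rightarrow> complex) set"
  where "rkhs_set K = fst (rkhs K)"

definition rkhs_norm :: "('x \<Rightarrow> 'x \<Rightarrow> complex) \<Rightarrow> ('x \<Rightarrow> complex) \<Rightarrow> real"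
  where "rkhs_norm K = ip_norm (snd (rkhs K))"

section \<open>Multipliers and complete Nevanlinna--Pick kernels\<close>

definition contractive_multipliers :: "('x \<Rightarrow> 'x \<Rightarrow> complex) \<Rightarrow> ('x \<Rightarrow> complex) set"
  where "contractive_multipliers K = {\<phi>. \<forall>f\<in>rkhs_set K.
    (\<lambda>x. \<phi> x * f x) \<in> rkhs_set K \<and> rkhs_norm K (\<lambda>x. \<phi> x * f x) \<le> rkhs_norm K f}"

definition dbr_kernel :: "('x \<Rightarrow> 'x \<Rightarrow> complex) \<Rightarrow> ('x \<Rightarrow> complex) \<Rightarrow> ('x \<Rightarrow> 'x \<Rightarrow> complex)"
  where "dbr_kernel K \<phi> x y = (1 - \<phi> x * cnj (\<phi> y)) * K x y"

text \<open>\<open>\<H>(K) \<otimes> \<complex>\<^sup>n\<close> is the space of \<open>n\<close>-tuples \<open>F 0, \<dots>, F (n - 1)\<close> in \<open>\<H>(K)\<close>; the values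
  \<open>F j\<close> for \<open>j \<ge> n\<close> are ignored. Likewise an \<open>m \<times> n\<close> matrix \<open>W\<close> has the entries
  \<open>W a j\<close> with \<open>a < m\<close> and \<open>j < n\<close>.\<close>

definition tuple_set :: "('x \<Rightarrow> 'x \<Rightarrow> complex) \<Rightarrow> nat \<Rightarrow> (nat \<Rightarrow> 'x \<Rightarrow> complex) set"
  where "tuple_set K n = {F. \<forall>j<n. F j \<in> rkhs_set K}"

definition tuple_norm :: "('x \<Rightarrow> 'x \<Rightarrow> complex) \<Rightarrow> nat \<Rightarrow> (nat \<Rightarrow> 'x \<Rightarrow> complex) \<Rightarrow> real"
  where "tuple_norm K n F = sqrt (\<Sum>j<n. (rkhs_norm K (F j))\<^sup>2)"

definition matrix_mult_op :: "nat \<Rightarrow> ('x \<Rightarrow> nat \<Rightarrow> nat \<Rightarrow> complex) \<Rightarrow>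
    (nat \<Rightarrow> 'x \<Rightarrow> complex) \<Rightarrow> (nat \<Rightarrow> 'x \<Rightarrow> complex)"
  where "matrix_mult_op n \<Phi> F = (\<lambda>a x. \<Sum>j<n. \<Phi> x a j * F j x)"

definition contractive_matrix_multiplier :: "('x \<Rightarrow> 'x \<Rightarrow> complex) \<Rightarrow> nat \<Rightarrow> nat \<Rightarrow>
    ('x \<Rightarrow> nat \<Rightarrow> nat \<Rightarrow> complex) \<Rightarrow> bool"
  where "contractive_matrix_multiplier K m n \<Phi> \<longleftrightarrow>
    (\<forall>F\<in>tuple_set K n. matrix_mult_op n \<Phi> F \<in> tuple_set K m \<and>
       tuple_norm K m (matrix_mult_op n \<Phi> F) \<le> tuple_norm K n F)"

text \<open>The entry of the block matrix \<open>[(I - W x (W y)\<^sup>*) K x y]\<close> in row \<open>(x, a)\<close> and column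
  \<open>(y, b)\<close>, with \<open>a, b < m\<close>.\<close>

definition pick_matrix :: "('x \<Rightarrow> 'x \<Rightarrow> complex) \<Rightarrow> nat \<Rightarrow> ('x \<Rightarrow> nat \<Rightarrow> nat \<Rightarrow> complex) \<Rightarrow>
    'x \<times> nat \<Rightarrow> 'x \<times> nat \<Rightarrow> complex"
  where "pick_matrix K n W = (\<lambda>(x, a) (y, b).
    ((if a = b then 1 else 0) - (\<Sum>j<n. W x a j * cnj (W y b j))) * K x y)"

definition cnp_kernel :: "('x \<Rightarrow> 'x \<Rightarrow> complex) \<Rightarrow> bool"
  where "cnp_kernel K \<longleftrightarrow> kernel K \<and>
    (\<forall>m\<ge>1. \<forall>n\<ge>1. \<forall>X W. finite X \<and> psd_on (X \<times> {..<m}) (pick_matrix K n W) \<longrightarrow>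
      (\<exists>\<Phi>. contractive_matrix_multiplier K m n \<Phi> \<and>
        (\<forall>x\<in>X. \<forall>a<m. \<forall>j<n. \<Phi> x a j = W x a j)))"

definition kernel_of :: "('x \<Rightarrow> ('e::complex_hilbert_space \<Rightarrow>\<^sub>L complex)) \<Rightarrow> 'x \<Rightarrow> 'x \<Rightarrow> complex"
  where "kernel_of u x y = 1 / (1 - op_complex (u x o\<^sub>L hilbert_adjoint (u y)))"

end

theory Submission
  imports Defs "HOL-Complex_Analysis.Complex_Analysis"
begin

text \<open>With \<open>e\<^sub>x\<close> the Riesz vector of \<open>u x\<close>, the de Branges--Rovnyak kernel is \<open>1 / (1 - L)\<close> for
  \<open>L x y = (\<langle>e\<^sub>y, e\<^sub>x\<rangle> - \<phi> x * cnj (\<phi> y)) / (1 - \<phi> x * cnj (\<phi> y))\<close>, and both sides of the equivalence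
  amount to the positivity of \<open>L\<close>.

  For a nowhere vanishing kernel normalized at a point, the complete Pick property forces
  \<open>L = 1 - 1/K\<close> to be positive by solving Pick problems whose Pick matrix is constant \<open>1\<close>; conversely,
  a Pick problem for \<open>1 / (1 - L)\<close> is solved by a lurking isometry.

  If \<open>\<phi> x = u x (\<Psi> (\<phi> x))\<close>, then \<open>L\<close> is positive because multiplication by \<open>\<Psi>\<close> is a contraction
  on the Hardy space. If \<open>L = \<langle>l\<^sub>y, l\<^sub>x\<rangle>\<close> is positive, then
  \<open>(e\<^sub>y, cnj (\<phi> y) l\<^sub>y) \<mapsto> (cnj (\<phi> y), l\<^sub>y)\<close> is isometric, and the adjoint \<open>S\<close> of a contractive
  extension gives \<open>\<Psi>\<close> as the solution of \<open>S (1, z h) = (\<Psi> z, h)\<close>.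

  All auxiliary Hilbert spaces are \<open>\<ell>\<^sup>2\<close> spaces over explicit index types, into which arbitrary
  kernels are factored.\<close>

section \<open>Inner products\<close>

text \<open>For the de Branges--Rovnyak kernel \<open>k\<close>, the function \<open>L\<close> is
  \<open>1 - 1/k\<close>; \<open>k\<close> is normalized at \<open>w\<close> because
  \<open>e w\<close> and \<open>\<phi> w\<close> vanish. Clearing the denominator gives
  \<open>\<langle>e\<^sub>y, e\<^sub>x\<rangle> + \<phi> x * cnj (\<phi> y) * L x y = \<phi> x * cnj
  (\<phi> y) + L x y\<close>, an equality of two Gram matrices, from which the isometry is read off.
  Its vectors involve conjugates of \<open>\<phi> y\<close>, so its own transfer function would
  depend on the conjugate of \<open>z\<close>; the adjoint restores holomorphy. An equality of Gram
  matrices defines a map only on a span. Extensions are obtained through adjoints: each value of the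
  adjoint is a vector with prescribed inner products against the family, chosen in the closed span
  of the family, where it is unique and hence depends linearly on the data. The same moment problem
  supplies the new vector in the factorization of a kernel, the elements of a reproducing kernel
  space and the projections onto closed spans. A Hilbert space is a type here and cannot depend on a
  kernel, so the auxiliary spaces must have types fixed by the index type alone.\<close>

lemma scaleC_one [simp]: "1 *\<^sub>C x = (x::'a::complex_normed_vector)"
  using scaleC_of_real[of 1 x] by simp

lemma scaleC_zero_left [simp]: "0 *\<^sub>C x = (0::'a::complex_normed_vector)"
  using scaleC_of_real[of 0 x] by simp

lemma scaleC_zero_right [simp]: "a *\<^sub>C 0 = (0::'a::complex_normed_vector)"
  using norm_scaleC[of a "0::'a"] by simp

lemma scaleC_minus_right [simp]: "a *\<^sub>C (- x) = - (a *\<^sub>C (x::'a::complex_normed_vector))"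
  using scaleC_add_right[of a x "- x"] by (simp add: eq_neg_iff_add_eq_0 add.commute)

lemma scaleC_minus_left [simp]: "(- a) *\<^sub>C x = - (a *\<^sub>C (x::'a::complex_normed_vector))"
  using scaleC_add_left[of a "- a" x] by (simp add: eq_neg_iff_add_eq_0 add.commute)

lemma scaleC_diff_right: "a *\<^sub>C (x - y) = a *\<^sub>C x - a *\<^sub>C (y::'a::complex_normed_vector)"
  using scaleC_add_right[of a x "- y"] by simp

lemma scaleC_diff_left: "(a - b) *\<^sub>C x = a *\<^sub>C x - b *\<^sub>C (x::'a::complex_normed_vector)"
  using scaleC_add_left[of a "- b" x] by simp

lemma scaleC_scaleR: "a *\<^sub>C (r *\<^sub>R x) = r *\<^sub>R (a *\<^sub>C (x::'a::complex_normed_vector))"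
  by (simp add: scaleC_scaleC mult.commute flip: scaleC_of_real)

lemma bounded_bilinear_scaleC:
  "bounded_bilinear (\<lambda>a (x::'a::complex_normed_vector). a *\<^sub>C x)"
proof
  show "(r *\<^sub>R a) *\<^sub>C b = r *\<^sub>R a *\<^sub>C b" for r a and b :: 'a
    by (simp add: scaleC_scaleC scaleR_conv_of_real flip: scaleC_of_real)
  show "\<exists>K. \<forall>a (b::'a). norm (a *\<^sub>C b) \<le> norm a * norm b * K"
    by (intro exI[of _ 1]) (simp add: norm_scaleC)
qed (simp_all add: scaleC_add_left scaleC_add_right scaleC_scaleR)

interpretation scaleC: bounded_bilinear "\<lambda>a (x::'a::complex_normed_vector). a *\<^sub>C x"
  by (rule bounded_bilinear_scaleC)

lemma cinner_add_right: "cinner x (y + z) = cinner x y + cinner x (z::'a::complex_hilbert_space)"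
  by (metis cinner_commute cinner_add_left complex_cnj_add)

lemma cinner_scaleC_right: "cinner x (a *\<^sub>C y) = cnj a * cinner x (y::'a::complex_hilbert_space)"
  by (metis cinner_commute cinner_scaleC_left complex_cnj_mult)

lemma cinner_scaleR_left: "cinner (r *\<^sub>R x) y = r *\<^sub>R cinner x (y::'a::complex_hilbert_space)"
  by (simp add: cinner_scaleC_left scaleR_conv_of_real flip: scaleC_of_real)

lemma cinner_scaleR_right: "cinner x (r *\<^sub>R y) = r *\<^sub>R cinner x (y::'a::complex_hilbert_space)"
  by (simp add: cinner_scaleC_right scaleR_conv_of_real flip: scaleC_of_real)

lemma cinner_zero_left [simp]: "cinner 0 (y::'a::complex_hilbert_space) = 0"
  using cinner_scaleC_left[of 0 0 y] by simp

lemma cinner_zero_right [simp]: "cinner (y::'a::complex_hilbert_space) 0 = 0"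
  using cinner_scaleC_right[of y 0 0] by simp

lemma cinner_diff_left: "cinner (x - y) z = cinner x z - cinner y (z::'a::complex_hilbert_space)"
  by (metis add_diff_cancel_right' cinner_add_left diff_add_cancel)

lemma cinner_diff_right: "cinner z (x - y) = cinner z x - cinner z (y::'a::complex_hilbert_space)"
  by (metis add_diff_cancel_right' cinner_add_right diff_add_cancel)

lemma norm_sq_eq_cinner: "(norm x)\<^sup>2 = Re (cinner x (x::'a::complex_hilbert_space))"
  by (simp add: cinner_self)

lemma Re_cinner_commute: "Re (cinner x y) = Re (cinner y (x::'a::complex_hilbert_space))"
  by (subst cinner_commute) simp

lemma norm_add_sq:
  "(norm (x + y))\<^sup>2 = (norm x)\<^sup>2 + 2 * Re (cinner x y) + (norm (y::'a::complex_hilbert_space))\<^sup>2"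
  by (simp add: norm_sq_eq_cinner cinner_add_left cinner_add_right Re_cinner_commute[of y x])

lemma norm_diff_sq:
  "(norm (x - y))\<^sup>2 = (norm x)\<^sup>2 - 2 * Re (cinner x y) + (norm (y::'a::complex_hilbert_space))\<^sup>2"
  by (simp add: norm_sq_eq_cinner cinner_diff_left cinner_diff_right Re_cinner_commute[of y x])

lemma Re_cinner_le: "Re (cinner x y) \<le> norm x * norm (y::'a::complex_hilbert_space)"
proof (cases "x = 0 \<or> y = 0")
  case False
  have "0 \<le> (norm (norm y *\<^sub>R x - norm x *\<^sub>R y))\<^sup>2" by simp
  also have "\<dots> = 2 * (norm x * norm y) * (norm x * norm y - Re (cinner x y))"
    by (simp add: norm_diff_sq cinner_scaleR_left cinner_scaleR_right power_mult_distrib)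
       (simp add: power2_eq_square algebra_simps)
  finally show ?thesis
    using False by (smt (verit) mult_nonneg_nonpos2 mult_pos_pos norm_eq_zero norm_ge_zero zero_le_mult_iff)
qed auto

lemma cnj_sgn_mult_self: "cnj (sgn z) * z = of_real (cmod z)"
proof (cases "z = 0")
  case False
  have "cnj (sgn z) * z = (z * cnj z) / of_real (cmod z)"
    by (simp add: sgn_eq)
  also have "\<dots> = of_real (cmod z)"
    using False by (simp add: complex_norm_square[symmetric] power2_eq_square)
  finally show ?thesis .
qed simp

lemma norm_cinner_le: "norm (cinner x y) \<le> norm x * norm (y::'a::complex_hilbert_space)"
proof -
  \<comment> \<open>\<open>a\<close> turns the inner product onto the nonnegative reals. It is 0
    when the inner product vanishes, hence only \<open>norm a \<le> 1\<close> below.\<close>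
  define a where "a = cnj (sgn (cinner x y))"
  have "norm (cinner x y) = Re (cinner (a *\<^sub>C x) y)"
    by (simp add: a_def cinner_scaleC_left cnj_sgn_mult_self)
  also have "\<dots> \<le> norm (a *\<^sub>C x) * norm y" by (rule Re_cinner_le)
  also have "\<dots> \<le> norm x * norm y"
    by (auto simp: norm_scaleC a_def norm_sgn mult_le_cancel_right1 intro!: mult_right_mono)
  finally show ?thesis .
qed

lemma bounded_bilinear_cinner: "bounded_bilinear (cinner :: 'a::complex_hilbert_space \<Rightarrow> _)"
proof
  show "\<exists>K. \<forall>(a::'a) b. norm (cinner a b) \<le> norm a * norm b * K"
    by (intro exI[of _ 1]) (simp add: norm_cinner_le)
qed (simp_all add: cinner_add_left cinner_add_right cinner_scaleR_left cinner_scaleR_right)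

interpretation cinner: bounded_bilinear "cinner :: 'a::complex_hilbert_space \<Rightarrow> _"
  by (rule bounded_bilinear_cinner)

lemma cinner_combination:
  fixes v :: "'i \<Rightarrow> 'h::complex_hilbert_space"
  shows "cinner (\<Sum>i\<in>X. c i *\<^sub>C v i) (\<Sum>j\<in>Y. d j *\<^sub>C w j)
    = (\<Sum>i\<in>X. \<Sum>j\<in>Y. c i * cnj (d j) * cinner (v i) (w j))"
  by (simp only: cinner.sum_left, simp only: cinner.sum_right)
     (simp add: cinner_scaleC_left cinner_scaleC_right mult_ac)

lemma cinner_ext: "(\<And>y. cinner y x = cinner y z) \<Longrightarrow> x = (z::'a::complex_hilbert_space)"
  using cinner_self[of "x - z"] by (simp add: cinner_diff_right)

section \<open>Moment problems\<close>

text \<open>The minimiser of \<open>\<parallel>x\<parallel>\<^sup>2 - 2 Re b\<close> over the graph \<open>P\<close> of a bounded functional represents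
  the functional.\<close>

lemma graph_functional_representation:
  fixes P :: "('h::complex_hilbert_space \<times> complex) set"
  assumes zero: "(0, 0) \<in> P"
    and add: "\<And>x a y b. (x, a) \<in> P \<Longrightarrow> (y, b) \<in> P \<Longrightarrow> (x + y, a + b) \<in> P"
    and scale: "\<And>x a c. (x, a) \<in> P \<Longrightarrow> (c *\<^sub>C x, c * a) \<in> P"
    and bound: "\<And>x a. (x, a) \<in> P \<Longrightarrow> norm a \<le> C * norm x"
  obtains p where "p \<in> closure (fst ` P)" "\<And>x a. (x, a) \<in> P \<Longrightarrow> cinner x p = a"
proof -
  define J where "J = (\<lambda>(x::'h, a). (norm x)\<^sup>2 - 2 * Re a)"
  define m where "m = Inf (J ` P)"
  \<comment> \<open>Completing the square in \<open>norm x\<close> gives the constant.\<close>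
  have below: "- C\<^sup>2 \<le> J q" if "q \<in> P" for q
  proof -
    obtain x a where q: "q = (x, a)" by force
    have "Re a \<le> C * norm x"
      using bound[of x a] that q complex_Re_le_cmod[of a] by simp
    moreover have "0 \<le> (norm x - C)\<^sup>2" by simp
    ultimately show ?thesis by (simp add: q J_def power2_eq_square algebra_simps)
  qed
  then have bdd: "bdd_below (J ` P)" by (intro bdd_belowI[of _ "- C\<^sup>2"]) auto
  have m_le: "m \<le> J q" if "q \<in> P" for q
    unfolding m_def using that bdd by (auto intro: cInf_lower)
  have "\<exists>q\<in>P. J q < m + 1 / real (Suc n)" for n
  proof -
    have "Inf (J ` P) < m + 1 / real (Suc n)" by (simp add: m_def)
    then show ?thesis using zero bdd by (subst (asm) cInf_less_iff) auto
  qed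
  then obtain q where qP: "\<And>n. q n \<in> P" and qJ: "\<And>n. J (q n) < m + 1 / real (Suc n)"
    by metis
  define s where "s n = fst (q n)" for n
  define b where "b n = snd (q n)" for n
  have sb: "(s n, b n) \<in> P" for n using qP by (simp add: s_def b_def)
  have Jsb: "J (s n, b n) < m + 1 / real (Suc n)" for n using qJ by (simp add: s_def b_def)
  \<comment> \<open>Parallelogram law: \<open>P\<close> contains midpoints, where \<open>J\<close>
    is at least \<open>m\<close>, so almost-minimisers lie close to each other.\<close>
  have close: "(norm (s k - s n))\<^sup>2 \<le> 2 / real (Suc k) + 2 / real (Suc n)" for k n
  proof -
    have "((1/2) *\<^sub>C (s k + s n), (1/2) * (b k + b n)) \<in> P"
      using scale add sb by blast
    then have "m \<le> J ((1/2) *\<^sub>C (s k + s n), (1/2) * (b k + b n))" by (rule m_le)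
    moreover have "(norm ((1/2) *\<^sub>C (s k + s n)))\<^sup>2 = (1/4) * (norm (s k + s n))\<^sup>2"
      by (simp add: norm_scaleC power_divide)
    ultimately have "4 * m + 4 * Re (b k + b n) \<le> (norm (s k + s n))\<^sup>2"
      by (simp add: J_def field_simps)
    moreover have "(norm (s k + s n))\<^sup>2 + (norm (s k - s n))\<^sup>2 = 2 * (norm (s k))\<^sup>2 + 2 * (norm (s n))\<^sup>2"
      by (simp add: norm_add_sq norm_diff_sq)
    ultimately show ?thesis using Jsb[of k] Jsb[of n] by (simp add: J_def)
  qed
  have "Cauchy s"
  proof (rule metric_CauchyI)
    fix e :: real assume e: "0 < e"
    obtain N where N: "4 / e\<^sup>2 < real N" using reals_Archimedean2 by blast
    have "dist (s k) (s n) < e" if "k \<ge> N" "n \<ge> N" for k n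
    proof -
      have Npos: "0 < real (Suc N)" by simp
      have "2 / real (Suc k) + 2 / real (Suc n) \<le> 2 / real (Suc N) + 2 / real (Suc N)"
        using that by (intro add_mono divide_left_mono) auto
      also have "\<dots> < e\<^sup>2"
      proof -
        have "4 < e\<^sup>2 * real N" using N e by (simp add: field_simps)
        then have "4 < e\<^sup>2 * real (Suc N)" using e by (simp add: algebra_simps add_strict_increasing2)
        then have "4 / real (Suc N) < e\<^sup>2" using Npos by (simp add: divide_less_eq mult.commute del: of_nat_Suc)
        then show ?thesis by (simp flip: add_divide_distrib)
      qed
      finally have "(norm (s k - s n))\<^sup>2 < e\<^sup>2" using close[of k n] by linarith
      then show ?thesis using e by (simp add: dist_norm power2_less_imp_less)
    qed
    then show "\<exists>M. \<forall>k\<ge>M. \<forall>n\<ge>M. dist (s k) (s n) < e" by blast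
  qed
  then obtain p where p: "s \<longlonglongrightarrow> p" using Cauchy_convergent convergent_def by blast
  have real_part: "Re (cinner y p) = Re c" if yc: "(y, c) \<in> P" for y c
  proof -
    \<comment> \<open>First variation: shifting an almost-minimiser by \<open>t\<close> times
      \<open>(y, c)\<close> stays in \<open>P\<close> and cannot bring \<open>J\<close> below
      \<open>m\<close>.\<close>
    have quad: "0 \<le> 2 * t * (Re (cinner p y) - Re c) + t\<^sup>2 * (norm y)\<^sup>2" for t :: real
    proof (rule LIMSEQ_le)
      show "(\<lambda>n. - (1 / real (Suc n))) \<longlonglongrightarrow> 0"
        using tendsto_minus[OF LIMSEQ_inverse_real_of_nat] by (simp add: inverse_eq_divide)
      show "(\<lambda>n. 2 * t * (Re (cinner (s n) y) - Re c) + t\<^sup>2 * (norm y)\<^sup>2)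
        \<longlonglongrightarrow> 2 * t * (Re (cinner p y) - Re c) + t\<^sup>2 * (norm y)\<^sup>2"
        by (intro tendsto_intros cinner.tendsto p)
      have "- (1 / real (Suc n)) \<le> 2 * t * (Re (cinner (s n) y) - Re c) + t\<^sup>2 * (norm y)\<^sup>2" for n
      proof -
        have "m \<le> J (s n + of_real t *\<^sub>C y, b n + of_real t * c)"
          by (intro m_le add sb scale yc)
        also have "\<dots> = J (s n, b n) + (2 * t * (Re (cinner (s n) y) - Re c) + t\<^sup>2 * (norm y)\<^sup>2)"
          by (simp add: J_def norm_add_sq norm_scaleC cinner_scaleC_right algebra_simps power_mult_distrib)
        finally show ?thesis using Jsb[of n] by linarith
      qed
      then show "\<exists>N. \<forall>n\<ge>N. - (1 / real (Suc n))
          \<le> 2 * t * (Re (cinner (s n) y) - Re c) + t\<^sup>2 * (norm y)\<^sup>2" by blast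
    qed
    define d where "d = Re (cinner p y) - Re c"
    have "d = 0"
    proof (rule ccontr)
      assume d: "d \<noteq> 0"
      \<comment> \<open>This \<open>t\<close> nearly minimises the quadratic; the added 1 keeps the
        denominator positive when \<open>y = 0\<close>.\<close>
      have "0 \<le> 2 * (- d / ((norm y)\<^sup>2 + 1)) * d + (- d / ((norm y)\<^sup>2 + 1))\<^sup>2 * (norm y)\<^sup>2"
        using quad[of "- d / ((norm y)\<^sup>2 + 1)"] by (simp add: d_def)
      also have "\<dots> = - (d\<^sup>2 / ((norm y)\<^sup>2 + 1)\<^sup>2) * ((norm y)\<^sup>2 + 2)"
        by (simp add: field_simps power2_eq_square add_nonneg_eq_0_iff)
      also have "\<dots> < 0"
        using d by (intro mult_neg_pos) (auto simp: add_nonneg_eq_0_iff zero_less_divide_iff add_nonneg_pos)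
      finally show False by simp
    qed
    then show ?thesis by (simp add: d_def Re_cinner_commute[of y p])
  qed
  show ?thesis
  proof
    show "p \<in> closure (fst ` P)"
      unfolding closure_sequential using p sb by force
    fix x a assume xa: "(x, a) \<in> P"
    have "Re (cinner x p) = Re a" by (rule real_part[OF xa])
    moreover have "Im (cinner x p) = Im a"
      using real_part[OF scale[OF xa, of "\<i>"]] by (simp add: cinner_scaleC_left)
    ultimately show "cinner x p = a" by (simp add: complex_eq_iff)
  qed
qed

section \<open>Finite combinations of a family and prescribed moments\<close>

definition combinations :: "('i \<Rightarrow> 'h::complex_normed_vector) \<Rightarrow> 'h set"
  where "combinations v = {(\<Sum>i\<in>X. c i *\<^sub>C v i) |X c. finite X}"

lemma combination_common_support:
  assumes "finite X" "finite Y"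
  shows "(\<Sum>i\<in>X. c i *\<^sub>C (v i::'h::complex_normed_vector)) = (\<Sum>i\<in>X \<union> Y. (if i \<in> X then c i else 0) *\<^sub>C v i)"
    and "(\<Sum>i\<in>X. c i * a i) = (\<Sum>i\<in>X \<union> Y. (if i \<in> X then c i else 0) * a i)"
  using assms by (intro sum.mono_neutral_cong_left; auto)+

lemma combinationsI: "finite X \<Longrightarrow> (\<Sum>i\<in>X. c i *\<^sub>C v i) \<in> combinations v"
  unfolding combinations_def by blast

text \<open>The bound makes the functional taking \<open>\<Sum>i\<in>X. c i *\<^sub>C v i\<close> to
  \<open>\<Sum>i\<in>X. c i * a i\<close> well defined, and Riesz representation applies. Placing
  \<open>p\<close> in the closed span makes it unique, which later yields linear dependence on the
  data.\<close>

theorem moment_problem: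
  fixes v :: "'i \<Rightarrow> 'h::complex_hilbert_space" and a :: "'i \<Rightarrow> complex"
  assumes bound: "\<And>X c. finite X \<Longrightarrow> norm (\<Sum>i\<in>X. c i * a i) \<le> C * norm (\<Sum>i\<in>X. c i *\<^sub>C v i)"
    and C: "0 \<le> C"
  obtains p where "p \<in> closure (combinations v)" "\<And>i. cinner (v i) p = a i" "norm p \<le> C"
proof -
  define P where "P = {((\<Sum>i\<in>X. c i *\<^sub>C v i), (\<Sum>i\<in>X. c i * a i)) |X c. finite X}"
  have PI: "((\<Sum>i\<in>X. c i *\<^sub>C v i), (\<Sum>i\<in>X. c i * a i)) \<in> P" if "finite X" for X c
    using that unfolding P_def by blast
  have boundP: "norm b \<le> C * norm x" if "(x, b) \<in> P" for x b
    using that bound unfolding P_def by auto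
  obtain p where p: "p \<in> closure (fst ` P)" and rep: "\<And>x b. (x, b) \<in> P \<Longrightarrow> cinner x p = b"
  proof (rule graph_functional_representation[of P C])
    show "(0, 0) \<in> P" using PI[of "{}"] by simp
    fix x b y d assume "(x, b) \<in> P" "(y, d) \<in> P"
    then obtain X c Y e where *: "finite X" "finite Y"
      "x = (\<Sum>i\<in>X. c i *\<^sub>C v i)" "b = (\<Sum>i\<in>X. c i * a i)"
      "y = (\<Sum>i\<in>Y. e i *\<^sub>C v i)" "d = (\<Sum>i\<in>Y. e i * a i)" unfolding P_def by auto
    have "x + y = (\<Sum>i\<in>X \<union> Y. ((if i \<in> X then c i else 0) + (if i \<in> Y then e i else 0)) *\<^sub>C v i)"
      using combination_common_support(1)[of X Y c v] combination_common_support(1)[of Y X e v] *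
      by (simp add: scaleC_add_left sum.distrib Un_commute)
    moreover have "b + d = (\<Sum>i\<in>X \<union> Y. ((if i \<in> X then c i else 0) + (if i \<in> Y then e i else 0)) * a i)"
      using combination_common_support(2)[of X Y c a] combination_common_support(2)[of Y X e a] *
      by (simp add: distrib_right sum.distrib Un_commute)
    ultimately show "(x + y, b + d) \<in> P" using PI[of "X \<union> Y"] * by simp
  next
    fix x b d assume "(x, b) \<in> P"
    then obtain X c where *: "finite X" "x = (\<Sum>i\<in>X. c i *\<^sub>C v i)" "b = (\<Sum>i\<in>X. c i * a i)"
      unfolding P_def by auto
    show "(d *\<^sub>C x, d * b) \<in> P"
      using PI[of X "\<lambda>i. d * c i"] * by (simp add: scaleC.sum_right scaleC_scaleC sum_distrib_left mult.assoc)
  qed (use boundP in auto)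
  show ?thesis
  proof
    show "p \<in> closure (combinations v)"
    proof -
      have "fst ` P \<subseteq> combinations v" by (auto simp: P_def intro: combinationsI)
      then show ?thesis using p closure_mono by blast
    qed
    show "cinner (v i) p = a i" for i
      using rep PI[of "{i}" "\<lambda>_. 1"] by simp
    \<comment> \<open>The bound holds on combinations; since \<open>p\<close> is a limit of such, it
      may be tested against itself.\<close>
    obtain s where s: "\<And>n. s n \<in> fst ` P" "s \<longlonglongrightarrow> p" using p unfolding closure_sequential by blast
    have "norm (cinner (s n) p) \<le> C * norm (s n)" for n
      using s(1)[of n] rep boundP by force
    then have "norm (cinner p p) \<le> C * norm p"
      by (intro LIMSEQ_le[where X="\<lambda>n. norm (cinner (s n) p)" and Y="\<lambda>n. C * norm (s n)"]
          tendsto_intros cinner.tendsto s(2)) auto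
    then show "norm p \<le> C"
      using C by (cases "p = 0") (auto simp: cinner_self power2_eq_square norm_mult)
  qed
qed

section \<open>Closed spans: orthogonality, linearity and uniqueness\<close>

lemma orthogonal_to_closed_span:
  fixes v :: "'i \<Rightarrow> 'h::complex_hilbert_space"
  assumes p: "p \<in> closure (combinations v)" and q: "\<And>i. cinner (v i) q = 0"
  shows "cinner p q = 0"
proof -
  obtain s where s: "\<And>n. s n \<in> combinations v" "s \<longlonglongrightarrow> p" using p unfolding closure_sequential by blast
  have "cinner (s n) q = 0" for n
    using s(1)[of n] q by (auto simp: combinations_def cinner.sum_left cinner_scaleC_left)
  moreover have "(\<lambda>n. cinner (s n) q) \<longlonglongrightarrow> cinner p q"
    by (intro cinner.tendsto s(2) tendsto_const)
  ultimately show ?thesis by (simp add: LIMSEQ_const_iff)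
qed

lemma combinations_add:
  assumes "x \<in> combinations v" "y \<in> combinations v"
  shows "x + y \<in> combinations (v :: 'i \<Rightarrow> 'h::complex_normed_vector)"
proof -
  obtain X c Y e where *: "finite X" "finite Y"
    "x = (\<Sum>i\<in>X. c i *\<^sub>C v i)" "y = (\<Sum>i\<in>Y. e i *\<^sub>C v i)"
    using assms unfolding combinations_def by auto
  have "x + y = (\<Sum>i\<in>X \<union> Y. ((if i \<in> X then c i else 0) + (if i \<in> Y then e i else 0)) *\<^sub>C v i)"
    using combination_common_support(1)[of X Y c v] combination_common_support(1)[of Y X e v] *
    by (simp add: scaleC_add_left sum.distrib Un_commute)
  then show ?thesis using * by (simp add: combinationsI)
qed

lemma combinations_scaleC:
  assumes "x \<in> combinations v"
  shows "d *\<^sub>C x \<in> combinations (v :: 'i \<Rightarrow> 'h::complex_normed_vector)"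
proof -
  obtain X c where *: "finite X" "x = (\<Sum>i\<in>X. c i *\<^sub>C v i)"
    using assms unfolding combinations_def by auto
  have "d *\<^sub>C x = (\<Sum>i\<in>X. (d * c i) *\<^sub>C v i)"
    by (simp add: * scaleC.sum_right scaleC_scaleC)
  then show ?thesis using * by (simp add: combinationsI)
qed

lemma closed_span_add:
  fixes v :: "'i \<Rightarrow> 'h::complex_hilbert_space"
  assumes "p \<in> closure (combinations v)" "q \<in> closure (combinations v)"
  shows "p + q \<in> closure (combinations v)"
proof -
  obtain s t where "\<And>n. s n \<in> combinations v" "s \<longlonglongrightarrow> p" "\<And>n. t n \<in> combinations v" "t \<longlonglongrightarrow> q"
    using assms unfolding closure_sequential by blast
  then show ?thesis unfolding closure_sequential
    by (intro exI[of _ "\<lambda>n. s n + t n"]) (auto intro: combinations_add tendsto_add)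
qed

lemma closed_span_scaleC:
  fixes v :: "'i \<Rightarrow> 'h::complex_hilbert_space"
  assumes "p \<in> closure (combinations v)"
  shows "d *\<^sub>C p \<in> closure (combinations v)"
proof -
  obtain s where "\<And>n. s n \<in> combinations v" "s \<longlonglongrightarrow> p"
    using assms unfolding closure_sequential by blast
  then show ?thesis unfolding closure_sequential
    by (intro exI[of _ "\<lambda>n. d *\<^sub>C s n"]) (auto intro: combinations_scaleC scaleC.tendsto)
qed

text \<open>The difference lies in the closed span and is orthogonal to it, hence to itself.\<close>

lemma closed_span_eqI:
  fixes v :: "'i \<Rightarrow> 'h::complex_hilbert_space"
  assumes "p \<in> closure (combinations v)" "q \<in> closure (combinations v)"
    and "\<And>i. cinner (v i) p = cinner (v i) q"
  shows "p = q"
proof -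
  have pq: "p + (- 1) *\<^sub>C q \<in> closure (combinations v)"
    by (intro closed_span_add closed_span_scaleC assms)
  have "cinner (p + (- 1) *\<^sub>C q) (p + (- 1) *\<^sub>C q) = 0"
    by (rule orthogonal_to_closed_span[OF pq]) (simp add: cinner_diff_right assms(3))
  then show ?thesis by (simp add: cinner_self)
qed

section \<open>Operators on Hilbert spaces\<close>

lemma bounded_ops_scaleC: "T \<in> bounded_ops \<Longrightarrow> blinfun_apply T (c *\<^sub>C x) = c *\<^sub>C blinfun_apply T x"
  by (simp add: bounded_ops_def)

lemma bounded_opsE:
  fixes f :: "'f::complex_normed_vector \<Rightarrow> 'g::complex_normed_vector"
  assumes add: "\<And>x y. f (x + y) = f x + f y" and scale: "\<And>c x. f (c *\<^sub>C x) = c *\<^sub>C f x"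
    and bound: "\<And>x. norm (f x) \<le> C * norm x" and C: "0 \<le> C"
  obtains T where "T \<in> bounded_ops" "\<And>x. blinfun_apply T x = f x" "norm T \<le> C"
proof -
  have bl: "bounded_linear f"
  proof (rule bounded_linear_intro[where K = C])
    show "f (r *\<^sub>R x) = r *\<^sub>R f x" for r x
      using scale[of "of_real r" x] by (simp add: scaleC_of_real)
  qed (simp_all add: add bound mult.commute)
  show ?thesis
  proof
    show "Blinfun f \<in> bounded_ops" by (simp add: bounded_ops_def bounded_linear_Blinfun_apply[OF bl] scale)
    show "norm (Blinfun f) \<le> C"
      by (rule norm_blinfun_bound) (simp_all add: bounded_linear_Blinfun_apply[OF bl] bound C)
  qed (simp add: bounded_linear_Blinfun_apply[OF bl])
qed

text \<open>\<open>S\<close> is the adjoint of the operator that maps \<open>v i\<close> to \<open>w i\<close> and vanishes on the orthogonal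
  complement of the span of \<open>v\<close>.\<close>

lemma adjoint_of_family:
  fixes v :: "'i \<Rightarrow> 'h::complex_hilbert_space" and w :: "'i \<Rightarrow> 'k::complex_hilbert_space"
  assumes bound: "\<And>X c. finite X \<Longrightarrow>
      norm (\<Sum>i\<in>X. c i *\<^sub>C w i) \<le> C * norm (\<Sum>i\<in>X. c i *\<^sub>C v i)"
    and C: "0 \<le> C"
  obtains S :: "'k \<Rightarrow>\<^sub>L 'h" where "S \<in> bounded_ops" "norm S \<le> C"
    "\<And>i y. cinner (v i) (blinfun_apply S y) = cinner (w i) y"
proof -
  have "\<exists>p. p \<in> closure (combinations v) \<and> (\<forall>i. cinner (v i) p = cinner (w i) y) \<and> norm p \<le> C * norm y" for y
  proof (rule moment_problem[of "\<lambda>i. cinner (w i) y" "C * norm y" v])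
    fix X :: "'i set" and c :: "'i \<Rightarrow> complex" assume "finite X"
    have "(\<Sum>i\<in>X. c i * cinner (w i) y) = cinner (\<Sum>i\<in>X. c i *\<^sub>C w i) y"
      by (simp add: cinner.sum_left cinner_scaleC_left)
    then have "norm (\<Sum>i\<in>X. c i * cinner (w i) y) \<le> norm (\<Sum>i\<in>X. c i *\<^sub>C w i) * norm y"
      by (simp add: norm_cinner_le)
    also have "\<dots> \<le> (C * norm (\<Sum>i\<in>X. c i *\<^sub>C v i)) * norm y"
      by (intro mult_right_mono bound \<open>finite X\<close>) simp
    finally show "norm (\<Sum>i\<in>X. c i * cinner (w i) y) \<le> C * norm y * norm (\<Sum>i\<in>X. c i *\<^sub>C v i)"
      by (simp add: mult_ac)
  qed (use C in auto)
  then obtain f where f: "\<And>y. f y \<in> closure (combinations v)"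
    "\<And>i y. cinner (v i) (f y) = cinner (w i) y" "\<And>y. norm (f y) \<le> C * norm y" by metis
  \<comment> \<open>The moments of \<open>f\<close> are additive, and a vector of the closed span is
    determined by its moments.\<close>
  have "f (x + y) = f x + f y" for x y
    by (intro closed_span_eqI[of _ v] closed_span_add f(1)) (simp add: f(2) cinner_add_right)
  moreover have "f (c *\<^sub>C x) = c *\<^sub>C f x" for c x
    by (intro closed_span_eqI[of _ v] closed_span_scaleC f(1)) (simp add: f(2) cinner_scaleC_right)
  ultimately obtain S where "S \<in> bounded_ops" "\<And>x. blinfun_apply S x = f x" "norm S \<le> C"
    using bounded_opsE[of f C] f(3) C by blast
  then show ?thesis using that f(2) by simp
qed

text \<open>With the family of all vectors, \<open>adjoint_of_family\<close> prescribes the inner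
  product with every \<open>x\<close>; this also gives the uniqueness needed by the definite
  description.\<close>

lemma hilbert_adjoint_props:
  fixes T :: "'f::complex_hilbert_space \<Rightarrow>\<^sub>L 'g::complex_hilbert_space"
  assumes T: "T \<in> bounded_ops"
  shows "cinner (blinfun_apply T x) y = cinner x (blinfun_apply (hilbert_adjoint T) y)"
    and "hilbert_adjoint T \<in> bounded_ops" and "norm (hilbert_adjoint T) \<le> norm T"
proof -
  have comb: "blinfun_apply T (\<Sum>i\<in>X. c i *\<^sub>C i) = (\<Sum>i\<in>X. c i *\<^sub>C blinfun_apply T i)"
    for X and c :: "'f \<Rightarrow> complex"
    by (simp add: blinfun.sum_right bounded_ops_scaleC[OF T])
  obtain S where S: "S \<in> bounded_ops" "norm S \<le> norm T"
    "\<And>x y. cinner x (blinfun_apply S y) = cinner (blinfun_apply T x) y"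
    by (rule adjoint_of_family[of "\<lambda>x. blinfun_apply T x" "norm T" "\<lambda>x. x"])
       (use norm_blinfun[of T] comb in \<open>auto simp flip: comb\<close>)
  have "hilbert_adjoint T = S"
    unfolding hilbert_adjoint_def
  proof (rule the_equality)
    fix R :: "'g \<Rightarrow>\<^sub>L 'f"
    assume R: "\<forall>x y. cinner (blinfun_apply T x) y = cinner x (blinfun_apply R y)"
    have "blinfun_apply R y = blinfun_apply S y" for y
      by (rule cinner_ext) (simp add: S(3) flip: R[rule_format])
    then show "R = S" by (rule blinfun_eqI)
  qed (simp add: S(3))
  with S show "cinner (blinfun_apply T x) y = cinner x (blinfun_apply (hilbert_adjoint T) y)"
    "hilbert_adjoint T \<in> bounded_ops" "norm (hilbert_adjoint T) \<le> norm T" by simp_all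
qed

text \<open>The adjoint of the map from \<open>adjoint_of_family\<close> is defined everywhere, so
  no decomposition along the span of \<open>v\<close> is required.\<close>

lemma operator_of_family:
  fixes v :: "'i \<Rightarrow> 'h::complex_hilbert_space" and w :: "'i \<Rightarrow> 'k::complex_hilbert_space"
  assumes bound: "\<And>X c. finite X \<Longrightarrow>
      norm (\<Sum>i\<in>X. c i *\<^sub>C w i) \<le> C * norm (\<Sum>i\<in>X. c i *\<^sub>C v i)"
    and C: "0 \<le> C"
  obtains V :: "'h \<Rightarrow>\<^sub>L 'k" where "V \<in> bounded_ops" "norm V \<le> C" "\<And>i. blinfun_apply V (v i) = w i"
proof -
  obtain S :: "'k \<Rightarrow>\<^sub>L 'h" where S: "S \<in> bounded_ops" "norm S \<le> C"
    "\<And>i y. cinner (v i) (blinfun_apply S y) = cinner (w i) y"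
    using adjoint_of_family[OF bound C] by blast
  let ?V = "hilbert_adjoint S"
  have "cinner y (blinfun_apply ?V (v i)) = cinner y (w i)" for i y
    using hilbert_adjoint_props(1)[OF S(1), of y "v i"] S(3)[of i y] cinner_commute by metis
  then have "blinfun_apply ?V (v i) = w i" for i by (rule cinner_ext)
  then show ?thesis using that[of ?V] hilbert_adjoint_props(2,3)[OF S(1)] S(2) by auto
qed

section \<open>Direct sums of two Hilbert spaces\<close>

instantiation prod :: (complex_hilbert_space, complex_hilbert_space) complex_hilbert_space
begin

definition scaleC_prod :: "complex \<Rightarrow> 'a \<times> 'b \<Rightarrow> 'a \<times> 'b"
  where "scaleC_prod c p = (c *\<^sub>C fst p, c *\<^sub>C snd p)"

definition cinner_prod :: "'a \<times> 'b \<Rightarrow> 'a \<times> 'b \<Rightarrow> complex"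
  where "cinner_prod p q = cinner (fst p) (fst q) + cinner (snd p) (snd q)"

instance
proof
  fix x y z :: "'a \<times> 'b" and a b :: complex and r :: real
  show "norm (a *\<^sub>C x) = cmod a * norm x"
    by (simp add: scaleC_prod_def norm_prod_def norm_scaleC power_mult_distrib real_sqrt_mult
        flip: distrib_left)
  show "cinner x y = cnj (cinner y x)"
    by (simp add: cinner_prod_def flip: cinner_commute)
  show "cinner x x = complex_of_real ((norm x)\<^sup>2)"
    by (simp add: cinner_prod_def norm_prod_def cinner_self)
qed (simp_all add: scaleC_prod_def cinner_prod_def scaleC_add_left scaleC_add_right scaleC_scaleC
      scaleC_of_real cinner_add_left cinner_scaleC_left algebra_simps prod_eq_iff)

end

lemma scaleC_Pair [simp]: "c *\<^sub>C (x, y) = (c *\<^sub>C x, c *\<^sub>C y)"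
  by (simp add: scaleC_prod_def)

lemma cinner_Pair [simp]: "cinner (x, y) (x', y') = cinner x x' + cinner y y'"
  by (simp add: cinner_prod_def)

lemma norm_Pair_sq: "(norm (x, y))\<^sup>2 = (norm x)\<^sup>2 + (norm y)\<^sup>2"
  by (simp add: norm_prod_def)

section \<open>The Hilbert space of square-summable functions\<close>

text \<open>Unordered summation, since the index type may be uncountable.\<close>

typedef 'a ell2 = "{f :: 'a \<Rightarrow> complex. (\<lambda>x. (cmod (f x))\<^sup>2) summable_on UNIV}"
  morphisms coord Abs_ell2
  by (rule exI[of _ "\<lambda>_. 0"]) simp

setup_lifting type_definition_ell2

text \<open>Membership and norm are tested on finite sets, where Minkowski's inequality is that of
  \<open>L2_set\<close>.\<close>

lemma square_summable_if_bounded: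
  assumes "\<And>F. finite F \<Longrightarrow> L2_set (\<lambda>x. cmod (f x)) F \<le> C"
  shows "(\<lambda>x. (cmod (f x))\<^sup>2) summable_on UNIV"
    and "sqrt (\<Sum>\<^sub>\<infinity>x. (cmod (f x))\<^sup>2) \<le> C"
proof -
  have C: "0 \<le> C" using assms[of "{}"] by simp
  have le: "(\<Sum>x\<in>F. (cmod (f x))\<^sup>2) \<le> C\<^sup>2" if "finite F" for F
    using assms[OF that] C by (simp add: L2_set_def real_sqrt_le_iff real_le_lsqrt sqrt_le_D)
  then show s: "(\<lambda>x. (cmod (f x))\<^sup>2) summable_on UNIV"
    by (intro nonneg_bdd_above_summable_on bdd_aboveI[of _ "C\<^sup>2"]) auto
  have "(\<Sum>\<^sub>\<infinity>x. (cmod (f x))\<^sup>2) \<le> C\<^sup>2"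
    by (rule infsum_le_finite_sums[OF s]) (use le in auto)
  then show "sqrt (\<Sum>\<^sub>\<infinity>x. (cmod (f x))\<^sup>2) \<le> C" using C by (simp add: real_le_lsqrt)
qed

lemma L2_set_le_infsum:
  assumes "(\<lambda>x. (cmod (f x))\<^sup>2) summable_on UNIV" "finite F"
  shows "L2_set (\<lambda>x. cmod (f x)) F \<le> sqrt (\<Sum>\<^sub>\<infinity>x. (cmod (f x))\<^sup>2)"
  unfolding L2_set_def using assms by (intro real_sqrt_le_mono finite_sum_le_infsum) auto

lemma L2_set_cmod_add_le:
  "L2_set (\<lambda>x. cmod (f x + g x)) F \<le> L2_set (\<lambda>x. cmod (f x)) F + L2_set (\<lambda>x. cmod (g x)) F"
  by (intro order.trans[OF L2_set_mono L2_set_triangle_ineq]) (auto simp: norm_triangle_ineq)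

lemma square_summable_add:
  assumes "(\<lambda>x. (cmod (f x))\<^sup>2) summable_on UNIV" "(\<lambda>x. (cmod (g x))\<^sup>2) summable_on UNIV"
  shows "(\<lambda>x. (cmod (f x + g x))\<^sup>2) summable_on UNIV"
    and "sqrt (\<Sum>\<^sub>\<infinity>x. (cmod (f x + g x))\<^sup>2)
      \<le> sqrt (\<Sum>\<^sub>\<infinity>x. (cmod (f x))\<^sup>2) + sqrt (\<Sum>\<^sub>\<infinity>x. (cmod (g x))\<^sup>2)"
proof -
  have "L2_set (\<lambda>x. cmod (f x + g x)) F
      \<le> sqrt (\<Sum>\<^sub>\<infinity>x. (cmod (f x))\<^sup>2) + sqrt (\<Sum>\<^sub>\<infinity>x. (cmod (g x))\<^sup>2)" if "finite F" for F
    by (intro order.trans[OF L2_set_cmod_add_le] add_mono L2_set_le_infsum assms that)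
  from square_summable_if_bounded[of "\<lambda>x. f x + g x", OF this]
  show "(\<lambda>x. (cmod (f x + g x))\<^sup>2) summable_on UNIV"
    "sqrt (\<Sum>\<^sub>\<infinity>x. (cmod (f x + g x))\<^sup>2)
      \<le> sqrt (\<Sum>\<^sub>\<infinity>x. (cmod (f x))\<^sup>2) + sqrt (\<Sum>\<^sub>\<infinity>x. (cmod (g x))\<^sup>2)" by auto
qed

lemma square_summable_cmult:
  "(\<lambda>x. (cmod (f x))\<^sup>2) summable_on UNIV \<Longrightarrow> (\<lambda>x. (cmod (c * f x))\<^sup>2) summable_on UNIV"
  by (simp add: norm_mult power_mult_distrib summable_on_cmult_right)

lemma square_summable_prod:
  assumes "(\<lambda>x. (cmod (f x))\<^sup>2) summable_on UNIV" "(\<lambda>x. (cmod (g x))\<^sup>2) summable_on UNIV"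
  shows "(\<lambda>x. f x * cnj (g x)) summable_on UNIV"
proof (rule Infinite_Sum.abs_summable_summable, rule Infinite_Sum.abs_summable_on_comparison_test')
  show "(\<lambda>x. (cmod (f x))\<^sup>2 + (cmod (g x))\<^sup>2) summable_on UNIV"
    by (intro summable_on_add assms)
  show "norm (f x * cnj (g x)) \<le> (cmod (f x))\<^sup>2 + (cmod (g x))\<^sup>2" for x
  proof -
    have "0 \<le> cmod (f x) * cmod (g x)" by simp
    then show ?thesis
      using sum_squares_bound[of "cmod (f x)" "cmod (g x)"] unfolding norm_mult complex_mod_cnj by linarith
  qed
qed

instantiation ell2 :: (type) real_normed_vector
begin

lift_definition zero_ell2 :: "'a ell2" is "\<lambda>_. 0" by simp
lift_definition plus_ell2 :: "'a ell2 \<Rightarrow> 'a ell2 \<Rightarrow> 'a ell2" is "\<lambda>f g x. f x + g x"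
  by (rule square_summable_add)
lift_definition uminus_ell2 :: "'a ell2 \<Rightarrow> 'a ell2" is "\<lambda>f x. - f x" by simp
lift_definition minus_ell2 :: "'a ell2 \<Rightarrow> 'a ell2 \<Rightarrow> 'a ell2" is "\<lambda>f g x. f x - g x"
  subgoal for f g using square_summable_add(1)[of f "\<lambda>x. - g x"] by simp done
lift_definition scaleR_ell2 :: "real \<Rightarrow> 'a ell2 \<Rightarrow> 'a ell2" is "\<lambda>r f x. of_real r * f x"
  by (rule square_summable_cmult)
lift_definition norm_ell2 :: "'a ell2 \<Rightarrow> real" is "\<lambda>f. sqrt (\<Sum>\<^sub>\<infinity>x. (cmod (f x))\<^sup>2)" .

definition dist_ell2 :: "'a ell2 \<Rightarrow> 'a ell2 \<Rightarrow> real" where "dist_ell2 x y = norm (x - y)"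
definition sgn_ell2 :: "'a ell2 \<Rightarrow> 'a ell2" where "sgn_ell2 x = inverse (norm x) *\<^sub>R x"
definition uniformity_ell2 :: "('a ell2 \<times> 'a ell2) filter"
  where "uniformity_ell2 = (INF e\<in>{0<..}. principal {(x, y). dist x y < e})"
definition open_ell2 :: "'a ell2 set \<Rightarrow> bool"
  where "open_ell2 U = (\<forall>x\<in>U. \<forall>\<^sub>F (x', y) in uniformity. x' = x \<longrightarrow> y \<in> U)"

instance
proof
  fix x y z :: "'a ell2" and a b :: real
  show "x + y + z = x + (y + z)" "x + y = y + x" "0 + x = x" "- x + x = 0" "x - y = x + - y"
    "a *\<^sub>R (x + y) = a *\<^sub>R x + a *\<^sub>R y" "(a + b) *\<^sub>R x = a *\<^sub>R x + b *\<^sub>R x"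
    "a *\<^sub>R b *\<^sub>R x = (a * b) *\<^sub>R x" "1 *\<^sub>R x = x"
    by (transfer; simp add: algebra_simps)+
  show "norm (x + y) \<le> norm x + norm y"
    by transfer (rule square_summable_add)
  show "norm (a *\<^sub>R x) = \<bar>a\<bar> * norm x"
    by transfer (simp add: norm_mult power_mult_distrib infsum_cmult_right' real_sqrt_mult)
  show "(norm x = 0) = (x = 0)"
  proof transfer
    fix f :: "'a \<Rightarrow> complex" assume s: "(\<lambda>x. (cmod (f x))\<^sup>2) summable_on UNIV"
    show "(sqrt (\<Sum>\<^sub>\<infinity>x. (cmod (f x))\<^sup>2) = 0) = (f = (\<lambda>_. 0))"
    proof
      assume "sqrt (\<Sum>\<^sub>\<infinity>x. (cmod (f x))\<^sup>2) = 0"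
      then have "cmod (f x) \<le> 0" for x using L2_set_le_infsum[OF s, of "{x}"] by simp
      then show "f = (\<lambda>_. 0)" by auto
    qed simp
  qed
qed (rule dist_ell2_def sgn_ell2_def uniformity_ell2_def open_ell2_def)+

end

instantiation ell2 :: (type) complex_normed_vector
begin

lift_definition scaleC_ell2 :: "complex \<Rightarrow> 'a ell2 \<Rightarrow> 'a ell2" is "\<lambda>c f x. c * f x"
  by (rule square_summable_cmult)

instance
proof
  fix a b :: complex and x y :: "'a ell2" and r :: real
  show "a *\<^sub>C (x + y) = a *\<^sub>C x + a *\<^sub>C y" "(a + b) *\<^sub>C x = a *\<^sub>C x + b *\<^sub>C x"
    "a *\<^sub>C b *\<^sub>C x = (a * b) *\<^sub>C x" "complex_of_real r *\<^sub>C x = r *\<^sub>R x"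
    by (transfer; simp add: algebra_simps)+
  show "norm (a *\<^sub>C x) = cmod a * norm x"
    by transfer (simp add: norm_mult power_mult_distrib infsum_cmult_right' real_sqrt_mult)
qed

end

lemma coord_simps [simp]:
  "coord (x + y) k = coord x k + coord y k" "coord (x - y) k = coord x k - coord y k"
  "coord (c *\<^sub>C x) k = c * coord x k" "coord 0 k = 0"
  by (simp_all add: plus_ell2.rep_eq minus_ell2.rep_eq scaleC_ell2.rep_eq zero_ell2.rep_eq)

lemma square_summable_coord: "(\<lambda>k. (cmod (coord x k))\<^sup>2) summable_on UNIV"
  using coord[of x] by simp

lemma L2_set_coord_le: "finite F \<Longrightarrow> L2_set (\<lambda>k. cmod (coord x k)) F \<le> norm x"
  by (simp add: norm_ell2.rep_eq L2_set_le_infsum square_summable_coord)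

lemma coord_le: "cmod (coord x k) \<le> norm x"
  using L2_set_coord_le[of "{k}" x] by simp

instance ell2 :: (type) complete_space
proof
  fix X :: "nat \<Rightarrow> 'a ell2" assume X: "Cauchy X"
  have cx: "Cauchy (\<lambda>n. coord (X n) k)" for k
  proof (rule metric_CauchyI)
    fix e :: real assume "0 < e"
    then obtain M where M: "\<And>m n. m \<ge> M \<Longrightarrow> n \<ge> M \<Longrightarrow> dist (X m) (X n) < e"
      using X metric_CauchyD by blast
    have "dist (coord (X m) k) (coord (X n) k) \<le> dist (X m) (X n)" for m n
      using coord_le[of "X m - X n" k] by (simp add: dist_norm)
    then show "\<exists>M. \<forall>m\<ge>M. \<forall>n\<ge>M. dist (coord (X m) k) (coord (X n) k) < e"
      using M by (meson le_less_trans)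
  qed
  define f where "f k = lim (\<lambda>n. coord (X n) k)" for k
  have f: "(\<lambda>n. coord (X n) k) \<longlonglongrightarrow> f k" for k
    using cx[of k] by (simp add: f_def Cauchy_convergent_iff convergent_LIMSEQ_iff)
  \<comment> \<open>The Cauchy estimate on a fixed finite \<open>F\<close> survives the limit
    \<open>m\<close> to infinity, with a threshold that does not depend on \<open>F\<close>.\<close>
  have tail: "\<exists>M. \<forall>n\<ge>M. \<forall>F. finite F \<longrightarrow> L2_set (\<lambda>k. cmod (f k - coord (X n) k)) F \<le> e" if "0 < e" for e
  proof -
    obtain M where M: "\<And>m n. m \<ge> M \<Longrightarrow> n \<ge> M \<Longrightarrow> dist (X m) (X n) < e"
      using X metric_CauchyD \<open>0 < e\<close> by blast
    have "L2_set (\<lambda>k. cmod (f k - coord (X n) k)) F \<le> e" if n: "n \<ge> M" and F: "finite F" for n F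
    proof (rule LIMSEQ_le_const2)
      show "(\<lambda>m. L2_set (\<lambda>k. cmod (coord (X m) k - coord (X n) k)) F)
        \<longlonglongrightarrow> L2_set (\<lambda>k. cmod (f k - coord (X n) k)) F"
        unfolding L2_set_def by (intro tendsto_intros f)
      have "L2_set (\<lambda>k. cmod (coord (X m) k - coord (X n) k)) F \<le> e" if "m \<ge> M" for m
        using L2_set_coord_le[OF F, of "X m - X n"] M[OF that n] by (simp add: dist_norm)
      then show "\<exists>N. \<forall>m\<ge>N. L2_set (\<lambda>k. cmod (coord (X m) k - coord (X n) k)) F \<le> e" by blast
    qed
    then show ?thesis by blast
  qed
  obtain N where N: "\<And>F. finite F \<Longrightarrow> L2_set (\<lambda>k. cmod (f k - coord (X N) k)) F \<le> 1"
    using tail[of 1] by auto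
  \<comment> \<open>\<open>f\<close> differs from the square-summable \<open>X N\<close> by a
    square-summable function.\<close>
  have "(\<lambda>k. (cmod (f k - coord (X N) k + coord (X N) k))\<^sup>2) summable_on UNIV"
    by (intro square_summable_add square_summable_if_bounded(1)[OF N] square_summable_coord)
  then have fs: "coord (Abs_ell2 f) = f" by (simp add: Abs_ell2_inverse)
  have "X \<longlonglongrightarrow> Abs_ell2 f"
  proof (rule metric_LIMSEQ_I)
    fix e :: real assume "0 < e"
    then obtain M where M: "\<And>n F. n \<ge> M \<Longrightarrow> finite F \<Longrightarrow> L2_set (\<lambda>k. cmod (f k - coord (X n) k)) F \<le> e / 2"
      using tail[of "e / 2"] by auto
    have "dist (X n) (Abs_ell2 f) < e" if "n \<ge> M" for n
    proof -
      have "norm (Abs_ell2 f - X n) \<le> e / 2"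
        using square_summable_if_bounded(2)[OF M[OF that]] by (simp add: norm_ell2.rep_eq fs)
      then show ?thesis using \<open>0 < e\<close> by (simp add: dist_norm norm_minus_commute)
    qed
    then show "\<exists>M. \<forall>n\<ge>M. dist (X n) (Abs_ell2 f) < e" by blast
  qed
  then show "convergent X" by (auto simp: convergent_def)
qed

instantiation ell2 :: (type) complex_hilbert_space
begin

lift_definition cinner_ell2 :: "'a ell2 \<Rightarrow> 'a ell2 \<Rightarrow> complex" is "\<lambda>f g. \<Sum>\<^sub>\<infinity>x. f x * cnj (g x)" .

instance
proof
  fix x y z :: "'a ell2" and a :: complex
  show "cinner x y = cnj (cinner y x)"
    by transfer (simp add: mult.commute flip: infsum_cnj)
  show "cinner (x + y) z = cinner x z + cinner y z"
    by transfer (simp add: distrib_right infsum_add square_summable_prod)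
  show "cinner (a *\<^sub>C x) y = a * cinner x y"
    by transfer (simp add: mult.assoc infsum_cmult_right')
  show "cinner x x = complex_of_real ((norm x)\<^sup>2)"
  proof transfer
    fix f :: "'a \<Rightarrow> complex" assume s: "(\<lambda>x. (cmod (f x))\<^sup>2) summable_on UNIV"
    have "(\<Sum>\<^sub>\<infinity>x. f x * cnj (f x)) = (\<Sum>\<^sub>\<infinity>x. complex_of_real ((cmod (f x))\<^sup>2))"
      by (simp only: complex_norm_square)
    also have "\<dots> = of_real (\<Sum>\<^sub>\<infinity>x. (cmod (f x))\<^sup>2)" 
      by (intro infsumI) (simp only: has_sum_of_real_iff has_sum_infsum[OF s])
    finally show "(\<Sum>\<^sub>\<infinity>x. f x * cnj (f x)) = complex_of_real ((sqrt (\<Sum>\<^sub>\<infinity>x. (cmod (f x))\<^sup>2))\<^sup>2)"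
      by (simp add: infsum_nonneg)
  qed
qed

end

lift_definition unit_vec :: "'a \<Rightarrow> 'a ell2" is "\<lambda>k x. if x = k then 1 else 0"
proof -
  fix k :: 'a
  have "(\<lambda>x. (cmod (if x = k then 1 else 0))\<^sup>2) summable_on {k}" by simp
  then show "(\<lambda>x. (cmod (if x = k then 1 else 0))\<^sup>2) summable_on UNIV"
    by (rule summable_on_cong_neutral[THEN iffD1, rotated -1]) auto
qed

lemma cinner_unit_vec: "cinner x (unit_vec k) = coord x k"
proof -
  have "cinner x (unit_vec k) = (\<Sum>\<^sub>\<infinity>j. if j = k then coord x k else 0)"
    unfolding cinner_ell2.rep_eq unit_vec.rep_eq by (intro infsum_cong) auto
  also have "\<dots> = (\<Sum>\<^sub>\<infinity>j\<in>{k}. coord x k)" by (rule infsum_cong_neutral) auto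
  finally show ?thesis by simp
qed

lemma cinner_unit_vec_unit_vec: "cinner (unit_vec j) (unit_vec k) = (if j = k then 1 else 0)"
  by (simp add: cinner_unit_vec unit_vec.rep_eq)

section \<open>Positive semi-definite kernels\<close>

lemma kernelI:
  assumes "\<And>X c. finite X \<Longrightarrow> (\<Sum>i\<in>X. \<Sum>j\<in>X. cnj (c i) * K i j * c j) \<in> \<real>"
    and "\<And>X c. finite X \<Longrightarrow> 0 \<le> Re (\<Sum>i\<in>X. \<Sum>j\<in>X. cnj (c i) * K i j * c j)"
  shows "kernel K"
  using assms unfolding kernel_def psd_on_def Let_def by blast

lemma kernelD:
  assumes "kernel K" "finite X"
  shows "(\<Sum>i\<in>X. \<Sum>j\<in>X. cnj (c i) * K i j * c j) \<in> \<real>"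
    and "0 \<le> Re (\<Sum>i\<in>X. \<Sum>j\<in>X. cnj (c i) * K i j * c j)"
  using assms unfolding kernel_def psd_on_def Let_def by blast+

text \<open>The vectors appear in reversed order because \<open>cinner\<close> is linear in its
  first argument while \<open>psd_on\<close> conjugates the row coefficient; all Gram kernels below
  follow this pattern.\<close>

lemma quadratic_form_gram:
  fixes v :: "'i \<Rightarrow> 'h::complex_hilbert_space"
  shows "(\<Sum>i\<in>X. \<Sum>j\<in>X. cnj (c i) * cinner (v j) (v i) * c j)
    = of_real ((norm (\<Sum>i\<in>X. c i *\<^sub>C v i))\<^sup>2)"
proof -
  have "of_real ((norm (\<Sum>i\<in>X. c i *\<^sub>C v i))\<^sup>2)
      = (\<Sum>j\<in>X. \<Sum>i\<in>X. c j * cnj (c i) * cinner (v j) (v i))"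
    by (simp only: cinner_self[symmetric] cinner_combination)
  also have "\<dots> = (\<Sum>i\<in>X. \<Sum>j\<in>X. c j * cnj (c i) * cinner (v j) (v i))"
    by (rule sum.swap)
  finally show ?thesis by (simp add: mult_ac)
qed

lemma kernel_gram:
  fixes v :: "'i \<Rightarrow> 'h::complex_hilbert_space"
  shows "kernel (\<lambda>x y. cinner (v y) (v x))"
  by (rule kernelI) (simp_all only: quadratic_form_gram Reals_of_real Re_complex_of_real zero_le_power2)

lemma kernel_gramI:
  fixes v :: "'i \<Rightarrow> 'h::complex_hilbert_space"
  assumes "\<And>x y. K x y = cinner (v y) (v x)"
  shows "kernel K"
proof -
  have "K = (\<lambda>x y. cinner (v y) (v x))" using assms by blast
  then show ?thesis using kernel_gram by metis
qed

text \<open>Polarization: the form is real at the coefficients \<open>(1, 1)\<close> and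
  \<open>(1, \<i>)\<close>, which settles the imaginary and the real part respectively.\<close>

lemma kernel_commute:
  assumes K: "kernel K"
  shows "K y x = cnj (K x y)"
proof -
  have diag: "K z z \<in> \<real>" for z
    using kernelD(1)[OF K, of "{z}" "\<lambda>_. 1"] by simp
  show ?thesis
  proof (cases "x = y")
    case True
    then show ?thesis using diag[of x] by (simp add: Reals_cnj_iff)
  next
    case False
    have "K x x + K x y + (K y x + K y y) \<in> \<real>"
      using kernelD(1)[OF K, of "{x, y}" "\<lambda>_. 1"] False by simp
    then have "Im (K x y + K y x) = 0"
      using diag[of x] diag[of y] by (simp add: complex_is_Real_iff)
    moreover have "K x x + K x y * \<i> + (cnj \<i> * K y x + cnj \<i> * K y y * \<i>) \<in> \<real>"
      using kernelD(1)[OF K, of "{x, y}" "\<lambda>z. if z = x then 1 else \<i>"] False by simp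
    then have "Re (K x y - K y x) = 0"
      using diag[of x] diag[of y] by (simp add: complex_is_Real_iff)
    ultimately show ?thesis by (simp add: complex_eq_iff)
  qed
qed

text \<open>The form stays nonnegative when a coefficient at \<open>i\<close> is added to
  \<open>c\<close>; optimising over it gives the inequality. This is the hypothesis of the moment
  problem solved at each stage of \<open>kernel_factorization\<close>.\<close>

lemma kernel_cauchy_schwarz:
  assumes K: "kernel K" and X: "finite X" "i \<notin> X"
  shows "(cmod (\<Sum>j\<in>X. c j * K i j))\<^sup>2
    \<le> Re (K i i) * Re (\<Sum>j\<in>X. \<Sum>k\<in>X. cnj (c j) * K j k * c k)"
proof -
  define S where "S = (\<Sum>j\<in>X. c j * K i j)"
  define Q where "Q = Re (\<Sum>j\<in>X. \<Sum>k\<in>X. cnj (c j) * K j k * c k)"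
  define k where "k = Re (K i i)"
  have Kii: "K i i = of_real k"
    using kernel_commute[OF K, of i i] by (auto simp: k_def complex_eq_iff)
  have SS: "S * cnj S = (complex_of_real (cmod S))\<^sup>2"
    using complex_norm_square[of S] by simp
  \<comment> \<open>The coefficient \<open>t\<close> carries the phase of \<open>S\<close>, so the
    cross terms are real. If \<open>k = 0\<close>, what remains is affine in \<open>s\<close> and
    can be nonnegative for all \<open>s\<close> only when \<open>S = 0\<close>.\<close>
  have quad: "0 \<le> k * (s\<^sup>2 * (cmod S)\<^sup>2) - 2 * s * (cmod S)\<^sup>2 + Q" for s :: real
  proof -
    define t where "t = - of_real s * S"
    define d where "d = c(i := t)"
    have d: "d i = t" "\<And>j. j \<in> X \<Longrightarrow> d j = c j" using X by (auto simp: d_def)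
    have "(\<Sum>j\<in>insert i X. \<Sum>k\<in>insert i X. cnj (d j) * K j k * d k)
      = cnj t * K i i * t + (\<Sum>k\<in>X. cnj t * K i k * c k)
        + (\<Sum>j\<in>X. cnj (c j) * K j i * t + (\<Sum>k\<in>X. cnj (c j) * K j k * c k))"
      using X by (simp add: d cong: sum.cong)
    also have "(\<Sum>k\<in>X. cnj t * K i k * c k) = cnj t * S"
      by (simp add: S_def sum_distrib_left mult_ac)
    also have "(\<Sum>j\<in>X. cnj (c j) * K j i * t + (\<Sum>k\<in>X. cnj (c j) * K j k * c k))
      = cnj (cnj t * S) + (\<Sum>j\<in>X. \<Sum>k\<in>X. cnj (c j) * K j k * c k)"
      by (simp add: S_def sum.distrib sum_distrib_left kernel_commute[OF K, of i] mult_ac)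
    finally have "Re (\<Sum>j\<in>insert i X. \<Sum>k\<in>insert i X. cnj (d j) * K j k * d k)
      = Re (cnj t * K i i * t) + 2 * Re (cnj t * S) + Q"
      by (simp add: Q_def)
    moreover have "cnj t * S = of_real (- s * (cmod S)\<^sup>2)"
      by (simp add: t_def SS[symmetric])
    moreover have "cnj t * K i i * t = of_real (k * (s\<^sup>2 * (cmod S)\<^sup>2))"
      by (simp add: t_def Kii SS[symmetric] power2_eq_square[of "of_real s"])
    ultimately show ?thesis
      using kernelD(2)[OF K, of "insert i X" d] X by simp
  qed
  have "0 \<le> k" using kernelD(2)[OF K, of "{i}" "\<lambda>_. 1"] by (simp add: k_def)
  then consider "k = 0" | "k > 0" by linarith
  then have "(cmod S)\<^sup>2 \<le> k * Q"
  proof cases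
    case 1
    have "(cmod S)\<^sup>2 = 0"
    proof (rule ccontr)
      assume nz: "(cmod S)\<^sup>2 \<noteq> 0"
      show False using quad[of "(Q + 1) / (2 * (cmod S)\<^sup>2)"] 1 nz by simp
    qed
    then show ?thesis using 1 by simp
  next
    case 2
    have "0 \<le> k * (k * ((1/k)\<^sup>2 * (cmod S)\<^sup>2) - 2 * (1/k) * (cmod S)\<^sup>2 + Q)"
      using quad[of "1/k"] 2 by simp
    also have "\<dots> = k * Q - (cmod S)\<^sup>2"
      using 2 by (simp add: power2_eq_square field_simps)
    finally show ?thesis by simp
  qed
  then show ?thesis by (simp add: S_def Q_def k_def)
qed

text \<open>A transfinite Cholesky decomposition: along a well-order of the index set, each new vector is
  its prescribed projection onto the span of its predecessors plus a multiple of its own unit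
  vector.\<close>

theorem kernel_factorization:
  fixes K :: "'i \<Rightarrow> 'i \<Rightarrow> complex"
  assumes K: "kernel K"
  shows "\<exists>v :: 'i \<Rightarrow> 'i ell2. \<forall>x y. K x y = cinner (v y) (v x)"
proof -
  obtain r :: "('i \<times> 'i) set" where r: "well_order_on UNIV r" using well_order_on by blast
  define R where "R = r - Id"
  have wfR: "wf R" using r by (simp add: R_def well_order_on_def)
  have lin: "linear_order_on UNIV r" using r by (simp add: well_order_on_def)
  have transR: "(i, k) \<in> R" if "(i, j) \<in> R" "(j, k) \<in> R" for i j k
    using that lin unfolding R_def linear_order_on_def partial_order_on_def preorder_on_def
    by (auto dest: transD antisymD)
  have totR: "i = j \<or> (i, j) \<in> R \<or> (j, i) \<in> R" for i j
    using lin unfolding R_def linear_order_on_def total_on_def by auto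
  have asymR: "(j, i) \<notin> R" if "(i, j) \<in> R" for i j
    using that wfR by (meson wf_not_sym)
  have irr: "(i, i) \<notin> R" for i by (simp add: R_def)
  \<comment> \<open>Triangular shape: the vector of \<open>i\<close> uses only the coordinates of
    \<open>i\<close> and its predecessors. Coordinate \<open>i\<close> is thus still free when stage
    \<open>i\<close> is reached.\<close>
  define P where "P f i v \<longleftrightarrow> (\<forall>k. k \<noteq> i \<longrightarrow> (k, i) \<notin> R \<longrightarrow> coord v k = 0)
    \<and> (\<forall>j. (j, i) \<in> R \<longrightarrow> cinner (f j) v = K i j) \<and> cinner v v = K i i"
    for f :: "'i \<Rightarrow> 'i ell2" and i and v :: "'i ell2"
  have gram: "cinner (f k) (f j) = K j k" if "P f j (f j)" "P f k (f k)" for f j k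
  proof -
    consider "j = k" | "(k, j) \<in> R" | "(j, k) \<in> R" using totR by blast
    then show ?thesis
    proof cases
      case 3
      then have "cinner (f j) (f k) = K k j" using that(2) by (simp add: P_def)
      then show ?thesis using kernel_commute[OF K, of k j] cinner_commute[of "f k" "f j"] by simp
    qed (use that in \<open>auto simp: P_def\<close>)
  qed
  have "\<exists>f. \<forall>i. P f i (f i)"
  proof (rule dependent_wf_choice[OF wfR])
    show "P f i v = P g i v" if "\<And>z. (z, i) \<in> R \<Longrightarrow> f z = g z" for f g i v
      using that by (auto simp: P_def)
  next
    fix i f assume IH: "\<And>j. (j, i) \<in> R \<Longrightarrow> P f j (f j)"
    \<comment> \<open>Zero outside the predecessors, so that a moment problem indexed by the whole
      type constrains only those.\<close>
    define g where "g j = (if (j, i) \<in> R then f j else 0)" for j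
    define a where "a j = (if (j, i) \<in> R then K i j else 0)" for j
    define \<kappa> where "\<kappa> = Re (K i i)"
    have Kii: "K i i = of_real \<kappa>"
      using kernel_commute[OF K, of i i] by (auto simp: \<kappa>_def complex_eq_iff)
    have \<kappa>: "0 \<le> \<kappa>" using kernelD(2)[OF K, of "{i}" "\<lambda>_. 1"] by (simp add: \<kappa>_def)
    obtain p where p: "p \<in> closure (combinations g)" "\<And>j. cinner (g j) p = a j" "norm p \<le> sqrt \<kappa>"
    proof (rule moment_problem[of a "sqrt \<kappa>" g])
      fix X :: "'i set" and c :: "'i \<Rightarrow> complex" assume X: "finite X"
      define Y where "Y = {j \<in> X. (j, i) \<in> R}"
      have Y: "finite Y" "i \<notin> Y" "Y \<subseteq> X" using X irr by (auto simp: Y_def)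
      have sa: "(\<Sum>j\<in>X. c j * a j) = (\<Sum>j\<in>Y. c j * K i j)"
        by (rule sum.mono_neutral_cong_right) (use X in \<open>auto simp: Y_def a_def\<close>)
      have sg: "(\<Sum>j\<in>X. c j *\<^sub>C g j) = (\<Sum>j\<in>Y. c j *\<^sub>C f j)"
        by (rule sum.mono_neutral_cong_right) (use X in \<open>auto simp: Y_def g_def\<close>)
      have "(\<Sum>j\<in>Y. \<Sum>k\<in>Y. cnj (c j) * K j k * c k)
          = (\<Sum>j\<in>Y. \<Sum>k\<in>Y. cnj (c j) * cinner (f k) (f j) * c k)"
        by (intro sum.cong refl) (simp add: gram IH Y_def)
      then have "(cmod (\<Sum>j\<in>Y. c j * K i j))\<^sup>2 \<le> \<kappa> * (norm (\<Sum>j\<in>Y. c j *\<^sub>C f j))\<^sup>2"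
        using kernel_cauchy_schwarz[OF K Y(1,2), of c] by (simp add: quadratic_form_gram \<kappa>_def)
      also have "\<dots> = (sqrt \<kappa> * norm (\<Sum>j\<in>Y. c j *\<^sub>C f j))\<^sup>2"
        using \<kappa> by (simp add: power_mult_distrib)
      finally show "norm (\<Sum>j\<in>X. c j * a j) \<le> sqrt \<kappa> * norm (\<Sum>j\<in>X. c j *\<^sub>C g j)"
        unfolding sa sg using \<kappa> by (auto intro: power2_le_imp_le)
    qed (use \<kappa> in auto)
    \<comment> \<open>By transitivity every predecessor's vector is supported on predecessors of
      \<open>i\<close>, and so is the limit \<open>p\<close>.\<close>
    have supp: "coord p k = 0" if "(k, i) \<notin> R" for k
    proof -
      have "cinner p (unit_vec k) = 0"
      proof (rule orthogonal_to_closed_span[OF p(1)])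
        fix j show "cinner (g j) (unit_vec k) = 0"
        proof (cases "(j, i) \<in> R")
          case True
          then have "k \<noteq> j" "(k, j) \<notin> R" using that transR by blast+
          then show ?thesis using IH[OF True] True by (simp add: g_def cinner_unit_vec P_def)
        qed (simp add: g_def)
      qed
      then show ?thesis by (simp add: cinner_unit_vec)
    qed
    \<comment> \<open>\<open>s\<close> supplies the norm missing from \<open>p\<close>. The new
      component is orthogonal to \<open>p\<close> and to all earlier vectors, so the prescribed
      inner products are unchanged.\<close>
    define s where "s = sqrt (\<kappa> - (norm p)\<^sup>2)"
    have s: "s\<^sup>2 = \<kappa> - (norm p)\<^sup>2"
      unfolding s_def using p(3) \<kappa> by (simp add: real_sqrt_ge_abs2 real_le_rsqrt sqrt_ge_absD)
    define v where "v = p + of_real s *\<^sub>C unit_vec i"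
    have "cinner (unit_vec i) p = 0"
      by (subst cinner_commute) (simp add: cinner_unit_vec supp irr)
    then have "cinner v v = of_real ((norm p)\<^sup>2) + of_real (s\<^sup>2)"
      by (simp add: v_def cinner_add_left cinner_add_right cinner_scaleC_left cinner_scaleC_right
          cinner_unit_vec supp irr cinner_self[of p] unit_vec.rep_eq power2_eq_square[of s])
    then have "cinner v v = K i i" by (simp add: s Kii)
    moreover have "cinner (f j) v = K i j" if "(j, i) \<in> R" for j
    proof -
      have "coord (f j) i = 0" using IH[OF that] asymR[OF that] irr[of i] that unfolding P_def by metis
      then show ?thesis
        using p(2)[of j] that
        by (simp add: v_def cinner_add_right cinner_scaleC_right cinner_unit_vec g_def a_def)
    qed
    moreover have "coord v k = 0" if "k \<noteq> i" "(k, i) \<notin> R" for k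
      using that supp by (simp add: v_def unit_vec.rep_eq)
    ultimately show "\<exists>v. P f i v" unfolding P_def by blast
  qed
  then obtain f where "\<And>i. P f i (f i)" by blast
  then show ?thesis using gram by metis
qed

section \<open>Sums, limits, products and pullbacks of kernels\<close>

lemma kernel_add:
  assumes "kernel A" "kernel B" shows "kernel (\<lambda>x y. A x y + B x y)"
  by (rule kernelI)
     (use kernelD[OF assms(1)] kernelD[OF assms(2)] in \<open>simp_all add: algebra_simps sum.distrib\<close>)

lemma kernel_limit:
  assumes K: "\<And>n. kernel (K n)" and lim: "\<And>x y. (\<lambda>n. K n x y) \<longlonglongrightarrow> L x y"
  shows "kernel L"
proof (rule kernelI)
  fix X :: "'a set" and c :: "'a \<Rightarrow> complex" assume X: "finite X"
  have *: "(\<lambda>n. \<Sum>i\<in>X. \<Sum>j\<in>X. cnj (c i) * K n i j * c j)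
      \<longlonglongrightarrow> (\<Sum>i\<in>X. \<Sum>j\<in>X. cnj (c i) * L i j * c j)"
    by (intro tendsto_intros lim)
  show "(\<Sum>i\<in>X. \<Sum>j\<in>X. cnj (c i) * L i j * c j) \<in> \<real>"
    by (rule Lim_in_closed_set[OF closed_complex_Reals _ _ *]) (use kernelD(1)[OF K X] in auto)
  show "0 \<le> Re (\<Sum>i\<in>X. \<Sum>j\<in>X. cnj (c i) * L i j * c j)"
    by (rule LIMSEQ_le_const[OF tendsto_Re[OF *]]) (use kernelD(2)[OF K X] in blast)
qed

lemma has_sum_sum:
  fixes f :: "'i \<Rightarrow> 'k \<Rightarrow> 'a::topological_comm_monoid_add"
  assumes "\<And>i. i \<in> X \<Longrightarrow> (f i has_sum s i) A"
  shows "((\<lambda>k. \<Sum>i\<in>X. f i k) has_sum (\<Sum>i\<in>X. s i)) A"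
  using assms by (induction X rule: infinite_finite_induct) (simp_all add: has_sum_add)

text \<open>Schur product theorem: in the coordinates of its Gram vectors, \<open>A\<close> is a sum
  of rank one kernels, and multiplication by a rank one kernel only rescales the coefficients in the
  form of \<open>B\<close>.\<close>

lemma kernel_mult:
  assumes A: "kernel A" and B: "kernel B"
  shows "kernel (\<lambda>x y. A x y * B x y)"
proof -
  obtain a :: "'a \<Rightarrow> 'a ell2" where a: "\<And>x y. A x y = cinner (a y) (a x)" using kernel_factorization[OF A] by blast
  have *: "((\<lambda>k. \<Sum>i\<in>X. \<Sum>j\<in>X. cnj (c i * coord (a i) k) * B i j * (c j * coord (a j) k))
      has_sum (\<Sum>i\<in>X. \<Sum>j\<in>X. cnj (c i) * (A i j * B i j) * c j)) UNIV" if "finite X" for X c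
  proof -
    have "((\<lambda>k. coord (a j) k * cnj (coord (a i) k)) has_sum A i j) UNIV" for i j
      unfolding a cinner_ell2.rep_eq
      by (intro has_sum_infsum square_summable_prod square_summable_coord)
    then have "((\<lambda>k. (cnj (c i) * B i j * c j) * (coord (a j) k * cnj (coord (a i) k)))
        has_sum (cnj (c i) * B i j * c j) * A i j) UNIV" for i j
      by (rule has_sum_cmult_right)
    then have "((\<lambda>k. cnj (c i * coord (a i) k) * B i j * (c j * coord (a j) k))
        has_sum cnj (c i) * (A i j * B i j) * c j) UNIV" for i j
      by (simp add: mult_ac)
    then show ?thesis by (intro has_sum_sum)
  qed
  show ?thesis
  proof (rule kernelI)
    fix X :: "'a set" and c :: "'a \<Rightarrow> complex" assume X: "finite X"
    note hs = *[OF X, of c] and B' = kernelD[OF B X]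
    show "0 \<le> Re (\<Sum>i\<in>X. \<Sum>j\<in>X. cnj (c i) * (A i j * B i j) * c j)"
      by (rule has_sum_nonneg[OF has_sum_bounded_linear[OF bounded_linear_Re hs, unfolded o_def]])
         (rule B')
    have Im0: "Im (\<Sum>i\<in>X. \<Sum>j\<in>X. cnj (c i * coord (a i) k) * B i j * (c j * coord (a j) k)) = 0" for k
      using B'(1)[of "\<lambda>i. c i * coord (a i) k"] unfolding complex_is_Real_iff .
    have "((\<lambda>k. 0) has_sum Im (\<Sum>i\<in>X. \<Sum>j\<in>X. cnj (c i) * (A i j * B i j) * c j)) (UNIV :: 'a set)"
      using has_sum_bounded_linear[OF bounded_linear_Im hs] unfolding Im0 .
    then show "(\<Sum>i\<in>X. \<Sum>j\<in>X. cnj (c i) * (A i j * B i j) * c j) \<in> \<real>"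
      using has_sum_unique[OF _ has_sum_0_simp] unfolding complex_is_Real_iff by blast
  qed
qed

lemma kernel_one: "kernel (\<lambda>x y. 1)"
  by (rule kernel_gramI[where v = "\<lambda>_. 1 :: complex"]) (simp add: cinner_complex_def)

lemma kernel_entry_le:
  assumes "kernel L"
  shows "(cmod (L x y))\<^sup>2 \<le> Re (L x x) * Re (L y y)"
proof -
  obtain a :: "'a \<Rightarrow> 'a ell2" where a: "\<And>x y. L x y = cinner (a y) (a x)" using kernel_factorization[OF assms] by blast
  have "(cmod (L x y))\<^sup>2 \<le> (norm (a y) * norm (a x))\<^sup>2"
    unfolding a by (intro power_mono norm_cinner_le) auto
  then show ?thesis by (simp add: a cinner_self power_mult_distrib mult.commute)
qed

lemma kernel_diagonal:
  assumes "kernel L"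
  shows "L x x = of_real (Re (L x x))" and "0 \<le> Re (L x x)"
  using kernel_commute[OF assms, of x x] kernelD(2)[OF assms, of "{x}" "\<lambda>_. 1"]
  by (auto simp: complex_eq_iff)

lemma norm_kernel_less_1:
  assumes "kernel L" and "\<And>x. Re (L x x) < 1"
  shows "cmod (L x y) < 1"
proof -
  have "Re (L x x) * Re (L y y) < 1"
    using assms(2)[of x] assms(2)[of y] kernel_diagonal(2)[OF assms(1), of x]
      mult_left_le[of "Re (L y y)" "Re (L x x)"] by linarith
  then have "(cmod (L x y))\<^sup>2 < 1\<^sup>2" using kernel_entry_le[OF assms(1), of x y] by simp
  then show ?thesis by (rule power_less_imp_less_base) simp
qed

text \<open>The powers of \<open>L\<close> are kernels by the Schur product theorem; Cauchy--Schwarz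
  carries the bound on the diagonal to all entries, so the geometric series converges.\<close>

lemma kernel_geometric:
  assumes L: "kernel L" and less: "\<And>x. Re (L x x) < 1"
  shows "kernel (\<lambda>x y. 1 / (1 - L x y))"
proof (rule kernel_limit)
  have pow: "kernel (\<lambda>x y. L x y ^ n)" for n
    by (induction n) (simp_all add: kernel_one kernel_mult[OF L])
  show "kernel (\<lambda>x y. \<Sum>k<n. L x y ^ k)" for n
  proof (induction n)
    case 0
    show ?case by (rule kernelI) simp_all
  next
    case (Suc n)
    then show ?case using kernel_add[OF Suc pow[of n]] by simp
  qed
  show "(\<lambda>n. \<Sum>k<n. L x y ^ k) \<longlonglongrightarrow> 1 / (1 - L x y)" for x y
    using geometric_sums[OF norm_kernel_less_1[OF L less]] by (simp add: sums_def)
qed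

text \<open>Since \<open>f\<close> may identify points, the quadratic forms do not simply reindex;
  Gram vectors compose without trouble.\<close>

lemma kernel_pullback:
  assumes "kernel K"
  shows "kernel (\<lambda>x y. K (f x) (f y))"
proof -
  obtain v :: "'a \<Rightarrow> 'a ell2" where "\<And>x y. K x y = cinner (v y) (v x)" using kernel_factorization[OF assms] by blast
  then show ?thesis by (intro kernel_gramI[where v = "\<lambda>x. v (f x)"])
qed

text \<open>This makes a finite Pick matrix accessible to
  \<open>kernel_factorization\<close>.\<close>

lemma psd_on_zero_extension:
  assumes I: "finite I" and A: "psd_on I A"
  shows "kernel (\<lambda>i j. if i \<in> I \<and> j \<in> I then A i j else 0)"
proof -
  have eq: "(\<Sum>i\<in>X. \<Sum>j\<in>X. cnj (c i) * (if i \<in> I \<and> j \<in> I then A i j else 0) * c j)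
    = (\<Sum>i\<in>I. \<Sum>j\<in>I. cnj (if i \<in> X then c i else 0) * A i j * (if j \<in> X then c j else 0))"
    if "finite X" for X c
  proof -
    have "(\<Sum>i\<in>X. \<Sum>j\<in>X. cnj (c i) * (if i \<in> I \<and> j \<in> I then A i j else 0) * c j)
      = (\<Sum>i\<in>X \<inter> I. \<Sum>j\<in>X \<inter> I. cnj (c i) * A i j * c j)"
      using that by (intro sum.mono_neutral_cong_right) (auto intro!: sum.neutral sum.mono_neutral_cong_right)
    also have "\<dots> = (\<Sum>i\<in>I. \<Sum>j\<in>I. cnj (if i \<in> X then c i else 0) * A i j * (if j \<in> X then c j else 0))"
      using I by (intro sum.mono_neutral_cong_left) (auto intro!: sum.neutral sum.mono_neutral_cong_left)
    finally show ?thesis .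
  qed
  show ?thesis
    by (rule kernelI) (use A in \<open>auto simp only: eq psd_on_def Let_def\<close>)
qed

section \<open>Reproducing kernel Hilbert spaces\<close>

lemma combinations_self: "v i \<in> combinations (v :: 'i \<Rightarrow> 'h::complex_normed_vector)"
  using combinationsI[of "{i}" "\<lambda>_. 1" v] by simp

lemma closed_span_self: "v i \<in> closure (combinations (v :: 'i \<Rightarrow> 'h::complex_normed_vector))"
  by (rule subsetD[OF closure_subset combinations_self])

text \<open>\<open>p\<close> is the orthogonal projection of \<open>h\<close>: it represents the
  same function with the least norm.\<close>

lemma closed_span_representative:
  fixes v :: "'x \<Rightarrow> 'h::complex_hilbert_space"
  obtains p where "p \<in> closure (combinations v)" "\<And>x. cinner p (v x) = cinner h (v x)" "norm p \<le> norm h"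
proof (rule moment_problem[of "\<lambda>x. cinner (v x) h" "norm h" v])
  fix X and c :: "'x \<Rightarrow> complex"
  show "cmod (\<Sum>x\<in>X. c x * cinner (v x) h) \<le> norm h * norm (\<Sum>x\<in>X. c x *\<^sub>C v x)"
    using norm_cinner_le[of "\<Sum>x\<in>X. c x *\<^sub>C v x" h]
    by (simp add: cinner.sum_left cinner_scaleC_left mult.commute)
next
  fix p assume p: "p \<in> closure (combinations v)" "\<And>x. cinner (v x) p = cinner (v x) h" "norm p \<le> norm h"
  have "cinner p (v x) = cinner h (v x)" for x
    by (subst cinner_commute) (simp add: p(2) flip: cinner_commute)
  then show thesis using that p(1,3) by blast
qed simp

text \<open>On the closed span of \<open>v\<close> the map from \<open>h\<close> to the function
  \<open>\<lambda>x. cinner h (v x)\<close> is injective, so inner product and completeness carry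
  over. Existence ensures that the choice made by \<open>rkhs\<close> has the defining
  properties.\<close>

lemma moore_aronszajn:
  fixes v :: "'x \<Rightarrow> 'h::complex_hilbert_space"
  assumes K: "\<And>x y. K x y = cinner (v y) (v x)"
  shows "\<exists>H ip. is_rkhs K H ip"
proof -
  define M where "M = closure (combinations v)"
  define \<iota> where "\<iota> h = (\<lambda>x. cinner h (v x))" for h
  define H where "H = \<iota> ` M"
  have uniq: "p = q" if "p \<in> M" "q \<in> M" "\<iota> p = \<iota> q" for p q
  proof (rule closed_span_eqI[of p v q])
    show "cinner (v i) p = cinner (v i) q" for i
      using fun_cong[OF that(3), of i] by (simp add: \<iota>_def) (metis cinner_commute)
  qed (use that in \<open>simp_all add: M_def\<close>)
  define rep where "rep f = (THE p. p \<in> M \<and> \<iota> p = f)" for f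
  have rep_\<iota>: "rep (\<iota> p) = p" if "p \<in> M" for p
    unfolding rep_def using that uniq by blast
  define ip where "ip f g = cinner (rep f) (rep g)" for f g
  have Madd: "p + q \<in> M" if "p \<in> M" "q \<in> M" for p q
    using that unfolding M_def by (rule closed_span_add)
  have Mscale: "c *\<^sub>C p \<in> M" if "p \<in> M" for c p
    using that unfolding M_def by (rule closed_span_scaleC)
  have Mzero: "0 \<in> M" using Mscale[of "v undefined" 0] closed_span_self[of v] by (simp add: M_def)
  have Mdiff: "p - q \<in> M" if "p \<in> M" "q \<in> M" for p q
    using Madd[OF that(1) Mscale[OF that(2), of "- 1"]] by simp
  have \<iota>add: "(\<lambda>x. \<iota> p x + \<iota> q x) = \<iota> (p + q)" for p q by (simp add: \<iota>_def cinner_add_left)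
  have \<iota>diff: "(\<lambda>x. \<iota> p x - \<iota> q x) = \<iota> (p - q)" for p q by (simp add: \<iota>_def cinner_diff_left)
  have \<iota>scale: "(\<lambda>x. c * \<iota> p x) = \<iota> (c *\<^sub>C p)" for p c by (simp add: \<iota>_def cinner_scaleC_left)
  have \<iota>zero: "(\<lambda>x. 0) = \<iota> 0" by (simp add: \<iota>_def)
  have space: "fun_ip_space H ip"
    unfolding fun_ip_space_def
  proof (intro conjI ballI allI impI)
    show "(\<lambda>x. 0) \<in> H" unfolding \<iota>zero H_def using Mzero by blast
    fix f g h c assume "f \<in> H"
    then obtain p where p: "p \<in> M" "f = \<iota> p" by (auto simp: H_def)
    show "(\<lambda>x. c * f x) \<in> H" unfolding p \<iota>scale H_def using Mscale p by blast
    show "0 \<le> Re (ip f f)" by (simp add: ip_def cinner_self)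
    show "f = (\<lambda>x. 0)" if "ip f f = 0"
      using that p by (simp add: ip_def rep_\<iota> cinner_self \<iota>zero)
    assume "g \<in> H"
    then obtain q where q: "q \<in> M" "g = \<iota> q" by (auto simp: H_def)
    show "(\<lambda>x. f x + g x) \<in> H" unfolding p q \<iota>add H_def using Madd p q by blast
    show "ip (\<lambda>x. c * f x) g = c * ip f g"
      unfolding ip_def p q \<iota>scale by (simp add: rep_\<iota> p q Mscale cinner_scaleC_left)
    show "ip f g = cnj (ip g f)" unfolding ip_def by (rule cinner_commute)
    show "ip (\<lambda>x. f x + g x) h = ip f h + ip g h"
      unfolding ip_def p q \<iota>add by (simp add: rep_\<iota> p q Madd cinner_add_left)
  qed
  have nrm: "ip_norm ip (\<iota> p) = norm p" if "p \<in> M" for p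
    using that by (simp add: ip_norm_def ip_def rep_\<iota> cinner_self)
  have "fun_hilbert_space H ip"
    unfolding fun_hilbert_space_def
  proof (intro conjI allI impI space)
    fix s :: "nat \<Rightarrow> 'x \<Rightarrow> complex"
    assume s: "(\<forall>n. s n \<in> H) \<and>
        (\<forall>e>0. \<exists>N. \<forall>m\<ge>N. \<forall>n\<ge>N. ip_norm ip (\<lambda>x. s m x - s n x) < e)"
    then obtain p where p: "\<And>n. p n \<in> M" "\<And>n. s n = \<iota> (p n)" unfolding H_def image_iff by metis
    have "ip_norm ip (\<lambda>x. s m x - s n x) = dist (p m) (p n)" for m n
      by (simp add: p \<iota>diff nrm Mdiff dist_norm)
    then have "Cauchy p" using s by (auto intro!: metric_CauchyI)
    then obtain l where l: "p \<longlonglongrightarrow> l" using Cauchy_convergent convergent_def by blast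
    then have lM: "l \<in> M" using p(1) unfolding M_def by (meson closed_closure closed_sequentially)
    have "(\<lambda>n. norm (p n - l)) \<longlonglongrightarrow> 0" using l by (simp add: LIM_zero tendsto_norm_zero)
    moreover have "ip_norm ip (\<lambda>x. s n x - \<iota> l x) = norm (p n - l)" for n
      by (simp add: p \<iota>diff nrm Mdiff lM)
    ultimately show "\<exists>f\<in>H. (\<lambda>n. ip_norm ip (\<lambda>x. s n x - f x)) \<longlonglongrightarrow> 0"
      using lM by (intro bexI[of _ "\<iota> l"]) (auto simp: H_def)
  qed
  moreover have Ky: "(\<lambda>x. K x y) = \<iota> (v y)" for y by (simp add: \<iota>_def K)
  have vM: "v y \<in> M" for y by (simp add: M_def closed_span_self)
  have "ip f (\<lambda>x. K x y) = f y" if "f \<in> H" for f y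
    using that vM unfolding Ky by (auto simp: H_def ip_def rep_\<iota>) (simp add: \<iota>_def)
  moreover have "(\<lambda>x. K x y) \<in> H" for y unfolding Ky H_def using vM by blast
  ultimately show ?thesis unfolding is_rkhs_def by blast
qed

text \<open>Factoring the Gram kernel of the function space itself turns its elements into vectors of an
  honest Hilbert space, which is how the chosen space \<open>rkhs K\<close> is accessed from here on.\<close>

theorem rkhs_model:
  fixes K :: "'x \<Rightarrow> 'x \<Rightarrow> complex"
  assumes K: "kernel K"
  obtains v :: "'x \<Rightarrow> ('x \<Rightarrow> complex) ell2" where
    "\<And>x y. K x y = cinner (v y) (v x)"
    "\<And>f. f \<in> rkhs_set K \<longleftrightarrow> (\<exists>h. \<forall>x. f x = cinner h (v x))"
    "\<And>h. h \<in> closure (combinations v) \<Longrightarrow> rkhs_norm K (\<lambda>x. cinner h (v x)) = norm h"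
proof -
  define H where "H = fst (rkhs K)"
  define ip where "ip = snd (rkhs K)"
  have "is_rkhs K H ip"
  proof -
    obtain u :: "'x \<Rightarrow> 'x ell2" where u: "\<And>x y. K x y = cinner (u y) (u x)" using kernel_factorization[OF K] by blast
    obtain H' ip' where "is_rkhs K H' ip'" using moore_aronszajn[of K u] u by blast
    then have "\<exists>p. case p of (H, ip) \<Rightarrow> is_rkhs K H ip" by (intro exI[of _ "(H', ip')"]) simp
    then have "case rkhs K of (H, ip) \<Rightarrow> is_rkhs K H ip" unfolding rkhs_def by (rule someI_ex)
    then show ?thesis by (simp add: H_def ip_def case_prod_beta)
  qed
  then have hilb: "fun_hilbert_space H ip" and KH: "\<And>y. (\<lambda>x. K x y) \<in> H"
    and reproducing: "\<And>f y. f \<in> H \<Longrightarrow> ip f (\<lambda>x. K x y) = f y"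
    by (auto simp: is_rkhs_def)
  have sp: "fun_ip_space H ip" using hilb by (simp add: fun_hilbert_space_def)
  have Hzero: "(\<lambda>x. 0) \<in> H" and Hadd: "\<And>f g. f \<in> H \<Longrightarrow> g \<in> H \<Longrightarrow> (\<lambda>x. f x + g x) \<in> H"
    and Hscale: "\<And>c f. f \<in> H \<Longrightarrow> (\<lambda>x. c * f x) \<in> H"
    and ip_add: "\<And>f g h. f \<in> H \<Longrightarrow> g \<in> H \<Longrightarrow> h \<in> H \<Longrightarrow> ip (\<lambda>x. f x + g x) h = ip f h + ip g h"
    and ip_scale: "\<And>c f g. f \<in> H \<Longrightarrow> g \<in> H \<Longrightarrow> ip (\<lambda>x. c * f x) g = c * ip f g"
    and ip_commute: "\<And>f g. f \<in> H \<Longrightarrow> g \<in> H \<Longrightarrow> ip f g = cnj (ip g f)"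
    and ip_pos: "\<And>f. f \<in> H \<Longrightarrow> 0 \<le> Re (ip f f)"
    using sp unfolding fun_ip_space_def by blast+
  have ip_zero: "ip (\<lambda>x. 0) g = 0" if "g \<in> H" for g
    using ip_scale[OF Hzero that, of 0] by simp
  have comb: "(\<lambda>x. \<Sum>i\<in>X. c i * F i x) \<in> H \<and> (\<forall>g\<in>H. ip (\<lambda>x. \<Sum>i\<in>X. c i * F i x) g = (\<Sum>i\<in>X. c i * ip (F i) g))"
    if "finite X" "\<And>i. i \<in> X \<Longrightarrow> F i \<in> H" for X :: "'b set" and c F
    using that
  proof (induction X)
    case empty
    show ?case by (simp add: Hzero ip_zero)
  next
    case (insert i X)
    then have IH: "(\<lambda>x. \<Sum>i\<in>X. c i * F i x) \<in> H"
      "\<And>g. g \<in> H \<Longrightarrow> ip (\<lambda>x. \<Sum>i\<in>X. c i * F i x) g = (\<Sum>i\<in>X. c i * ip (F i) g)" by auto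
    have Fi: "F i \<in> H" using insert by simp
    have eq: "(\<lambda>x. \<Sum>i\<in>insert i X. c i * F i x) = (\<lambda>x. c i * F i x + (\<Sum>i\<in>X. c i * F i x))"
      using insert by simp
    show ?case
      unfolding eq using insert(1,2) Hadd[OF Hscale[OF Fi] IH(1)]
      by (simp add: ip_add[OF Hscale[OF Fi] IH(1)] ip_scale[OF Fi] IH(2))
  qed
  \<comment> \<open>Cut off outside \<open>H\<close>, where \<open>ip\<close> is
    unconstrained.\<close>
  define G where "G f g = (if f \<in> H \<and> g \<in> H then ip g f else 0)" for f g
  have "kernel G"
  proof -
    have eq: "(\<Sum>f\<in>X. \<Sum>g\<in>X. cnj (c f) * G f g * c g) = ip (\<lambda>x. \<Sum>f\<in>X \<inter> H. c f * f x) (\<lambda>x. \<Sum>f\<in>X \<inter> H. c f * f x)"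
      if X: "finite X" for X c
    proof -
      let ?F = "\<lambda>x. \<Sum>f\<in>X \<inter> H. c f * f x"
      have F: "?F \<in> H" "\<And>g. g \<in> H \<Longrightarrow> ip ?F g = (\<Sum>f\<in>X \<inter> H. c f * ip f g)"
        using comb[of "X \<inter> H" "\<lambda>f. f" c] X by auto
      have "(\<Sum>f\<in>X. \<Sum>g\<in>X. cnj (c f) * G f g * c g) = (\<Sum>f\<in>X \<inter> H. \<Sum>g\<in>X \<inter> H. cnj (c f) * ip g f * c g)"
        using X by (intro sum.mono_neutral_cong_right)
          (auto simp: G_def intro!: sum.neutral sum.mono_neutral_cong_right)
      also have "\<dots> = (\<Sum>f\<in>X \<inter> H. cnj (c f) * ip ?F f)"
        by (intro sum.cong refl) (subst F(2), simp, simp add: sum_distrib_left mult_ac)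
      also have "\<dots> = (\<Sum>f\<in>X \<inter> H. cnj (c f * ip f ?F))"
        by (intro sum.cong refl) (simp add: ip_commute[OF F(1), symmetric])
      also have "\<dots> = cnj (\<Sum>f\<in>X \<inter> H. c f * ip f ?F)" by simp
      also have "\<dots> = cnj (ip ?F ?F)" by (simp only: F(2)[OF F(1)])
      also have "\<dots> = ip ?F ?F" by (rule ip_commute[OF F(1) F(1), symmetric])
      finally show ?thesis .
    qed
    show ?thesis
    proof (rule kernelI)
      fix X :: "('x \<Rightarrow> complex) set" and c assume X: "finite X"
      have F: "(\<lambda>x. \<Sum>f\<in>X \<inter> H. c f * f x) \<in> H" using comb[of "X \<inter> H" "\<lambda>f. f" c] X by auto
      show "(\<Sum>f\<in>X. \<Sum>g\<in>X. cnj (c f) * G f g * c g) \<in> \<real>"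
        unfolding eq[OF X] using ip_commute[OF F F] by (simp add: Reals_cnj_iff)
      show "0 \<le> Re (\<Sum>f\<in>X. \<Sum>g\<in>X. cnj (c f) * G f g * c g)"
        unfolding eq[OF X] by (rule ip_pos[OF F])
    qed
  qed
  then obtain vec :: "('x \<Rightarrow> complex) \<Rightarrow> ('x \<Rightarrow> complex) ell2" where vec: "\<And>f g. G f g = cinner (vec g) (vec f)" using kernel_factorization by blast
  have ip_vec: "ip f g = cinner (vec f) (vec g)" if "f \<in> H" "g \<in> H" for f g
    using vec[of g f] that by (simp add: G_def)
  \<comment> \<open>\<open>vec\<close> comes from a factorization and is not linear by construction;
    its value is identified by computing that \<open>vec f - p\<close> has norm zero.\<close>
  have vec_eqI: "vec f = p" if f: "f \<in> H" and "cinner p p = ip f f" "cinner p (vec f) = ip f f" for f p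
  proof -
    have "cinner (vec f) p = ip f f"
      using that(3) ip_commute[OF f f] cinner_commute[of "vec f" p] by simp
    then have "cinner (vec f - p) (vec f - p) = 0"
      using that by (simp add: cinner_diff_left cinner_diff_right flip: ip_vec[OF f f])
    then show ?thesis by (simp add: cinner_self)
  qed
  define v where "v y = vec (\<lambda>x. K x y)" for y
  have eval: "f x = cinner (vec f) (v x)" if "f \<in> H" for f x
    using reproducing[OF that, of x] ip_vec[OF that KH] by (simp add: v_def)
  have Kv: "K x y = cinner (v y) (v x)" for x y
    using eval[OF KH[of y], of x] by (simp add: v_def)
  have vec_comb: "(\<lambda>x. \<Sum>y\<in>X. c y * K x y) \<in> H \<and> vec (\<lambda>x. \<Sum>y\<in>X. c y * K x y) = (\<Sum>y\<in>X. c y *\<^sub>C v y)"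
    if X: "finite X" for X c
  proof
    let ?F = "\<lambda>x. \<Sum>y\<in>X. c y * K x y"
    show F: "?F \<in> H" using comb[of X "\<lambda>y x. K x y" c] X KH by auto
    have ipF: "ip ?F g = (\<Sum>y\<in>X. c y * ip (\<lambda>x. K x y) g)" if "g \<in> H" for g
      using comb[of X "\<lambda>y x. K x y" c] X KH that by auto
    have ipKF: "ip (\<lambda>x. K x y) ?F = (\<Sum>z\<in>X. cnj (c z) * cinner (v y) (v z))" for y
    proof -
      have "ip (\<lambda>x. K x y) ?F = cnj (\<Sum>z\<in>X. c z * K y z)"
        by (subst ip_commute[OF KH F]) (simp only: reproducing[OF F])
      then show ?thesis by (simp add: Kv flip: cinner_commute)
    qed
    show "vec ?F = (\<Sum>y\<in>X. c y *\<^sub>C v y)"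
    proof (rule vec_eqI[OF F])
      show "cinner (\<Sum>y\<in>X. c y *\<^sub>C v y) (\<Sum>y\<in>X. c y *\<^sub>C v y) = ip ?F ?F"
        by (simp add: cinner_combination ipF[OF F] ipKF sum_distrib_left mult_ac)
      show "cinner (\<Sum>y\<in>X. c y *\<^sub>C v y) (vec ?F) = ip ?F ?F"
        by (simp add: cinner.sum_left cinner_scaleC_left ipF[OF F] v_def flip: ip_vec[OF KH F])
    qed
  qed
  \<comment> \<open>Here completeness of \<open>H\<close> enters: functions mapped by
    \<open>vec\<close> to combinations converging to \<open>h\<close> form a Cauchy sequence in
    \<open>H\<close>, and the vector of their limit is \<open>h\<close>.\<close>
  have represent: "(\<lambda>x. cinner h (v x)) \<in> H \<and> vec (\<lambda>x. cinner h (v x)) = h"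
    if h: "h \<in> closure (combinations v)" for h
  proof -
    obtain t where t: "\<And>n. t n \<in> combinations v" "t \<longlonglongrightarrow> h" using h unfolding closure_sequential by blast
    have "\<exists>f. f \<in> H \<and> vec f = t n" for n
      using t(1)[of n] vec_comb unfolding combinations_def by force
    then obtain s where s: "\<And>n. s n \<in> H" "\<And>n. vec (s n) = t n" by metis
    have diff: "(\<lambda>x. f x - g x) \<in> H" "ip_norm ip (\<lambda>x. f x - g x) = norm (vec f - vec g)"
      if f: "f \<in> H" and g: "g \<in> H" for f g
    proof -
      have eq: "(\<lambda>x. f x - g x) = (\<lambda>x. f x + (-1) * g x)" by simp
      show fg: "(\<lambda>x. f x - g x) \<in> H" unfolding eq by (intro Hadd Hscale f g)
      have ipl: "ip (\<lambda>x. f x - g x) h = ip f h - ip g h" if "h \<in> H" for h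
        unfolding eq using that by (simp only: ip_add[OF f Hscale[OF g]] ip_scale[OF g]) simp
      have "ip (\<lambda>x. f x - g x) (\<lambda>x. f x - g x) = cinner (vec f - vec g) (vec f - vec g)"
        by (simp add: ipl[OF fg] ip_commute[OF _ fg] f g ipl cinner_diff_left cinner_diff_right ip_vec
            flip: cinner_commute)
      then show "ip_norm ip (\<lambda>x. f x - g x) = norm (vec f - vec g)"
        by (simp add: ip_norm_def cinner_self)
    qed
    have "\<exists>g\<in>H. (\<lambda>n. ip_norm ip (\<lambda>x. s n x - g x)) \<longlonglongrightarrow> 0"
    proof -
      have "\<exists>N. \<forall>m\<ge>N. \<forall>n\<ge>N. ip_norm ip (\<lambda>x. s m x - s n x) < e" if "0 < e" for e
        using metric_CauchyD[OF LIMSEQ_imp_Cauchy[OF t(2)] that] by (simp add: diff s dist_norm)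
      then show ?thesis using hilb s(1) unfolding fun_hilbert_space_def by blast
    qed
    then obtain g where g: "g \<in> H" "(\<lambda>n. ip_norm ip (\<lambda>x. s n x - g x)) \<longlonglongrightarrow> 0" by blast
    have "(\<lambda>n. norm (t n - vec g)) \<longlonglongrightarrow> 0" using g(2) by (simp add: diff s g(1))
    then have "t \<longlonglongrightarrow> vec g" by (simp add: LIM_zero_iff tendsto_norm_zero_iff)
    then have "vec g = h" using t(2) LIMSEQ_unique by blast
    moreover have "(\<lambda>x. cinner h (v x)) = g" using eval[OF g(1)] \<open>vec g = h\<close> by auto
    ultimately show ?thesis using g(1) by simp
  qed
  show ?thesis
  proof
    show "K x y = cinner (v y) (v x)" for x y by (rule Kv)
    show "f \<in> rkhs_set K \<longleftrightarrow> (\<exists>h. \<forall>x. f x = cinner h (v x))" for f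
    proof
      assume "f \<in> rkhs_set K"
      then show "\<exists>h. \<forall>x. f x = cinner h (v x)" using eval by (auto simp: rkhs_set_def H_def)
    next
      assume "\<exists>h. \<forall>x. f x = cinner h (v x)"
      then obtain h where h: "\<And>x. f x = cinner h (v x)" by blast
      obtain p where p: "p \<in> closure (combinations v)" "\<And>x. cinner p (v x) = cinner h (v x)"
        using closed_span_representative by blast
      have "f = (\<lambda>x. cinner p (v x))" using h p(2) by auto
      then show "f \<in> rkhs_set K" using represent[OF p(1)] by (simp add: rkhs_set_def H_def)
    qed
    show "rkhs_norm K (\<lambda>x. cinner h (v x)) = norm h" if "h \<in> closure (combinations v)" for h
      using represent[OF that] ip_vec[of "\<lambda>x. cinner h (v x)" "\<lambda>x. cinner h (v x)"]
      by (simp add: rkhs_norm_def ip_norm_def cinner_self flip: ip_def)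
  qed
qed

section \<open>Contractive multipliers\<close>

text \<open>Each rank one weight is absorbed into the coefficients. The lemma serves both the
  identity part and the product part of a Pick matrix.\<close>

lemma quadratic_form_weighted_gram:
  fixes w :: "'i \<Rightarrow> 'h::complex_hilbert_space"
  shows "(\<Sum>p\<in>Y. \<Sum>q\<in>Y. cnj (d p) * ((\<Sum>j<n. \<alpha> p j * cnj (\<alpha> q j)) * cinner (w q) (w p)) * d q)
    = of_real (\<Sum>j<n. (norm (\<Sum>p\<in>Y. (d p * cnj (\<alpha> p j)) *\<^sub>C w p))\<^sup>2)"
proof -
  have "(\<Sum>p\<in>Y. \<Sum>q\<in>Y. cnj (d p) * ((\<Sum>j<n. \<alpha> p j * cnj (\<alpha> q j)) * cinner (w q) (w p)) * d q)
    = (\<Sum>p\<in>Y. \<Sum>q\<in>Y. \<Sum>j<n. cnj (d p * cnj (\<alpha> p j)) * cinner (w q) (w p) * (d q * cnj (\<alpha> q j)))"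
    by (simp add: sum_distrib_left sum_distrib_right mult_ac)
  also have "\<dots> = (\<Sum>p\<in>Y. \<Sum>j<n. \<Sum>q\<in>Y. cnj (d p * cnj (\<alpha> p j)) * cinner (w q) (w p) * (d q * cnj (\<alpha> q j)))"
    by (intro sum.cong refl sum.swap)
  also have "\<dots> = (\<Sum>j<n. \<Sum>p\<in>Y. \<Sum>q\<in>Y. cnj (d p * cnj (\<alpha> p j)) * cinner (w q) (w p) * (d q * cnj (\<alpha> q j)))"
    by (rule sum.swap)
  also have "\<dots> = (\<Sum>j<n. of_real ((norm (\<Sum>p\<in>Y. (d p * cnj (\<alpha> p j)) *\<^sub>C w p))\<^sup>2))"
    by (simp only: quadratic_form_gram)
  finally show ?thesis by simp
qed

text \<open>The last step whenever a vector is tested against itself, including the case of norm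
  zero.\<close>

lemma sqrt_le_if_le_sqrt_mult:
  assumes "sqrt s * sqrt s \<le> sqrt s * c" "0 \<le> s" "0 \<le> c"
  shows "sqrt s \<le> c"
proof (cases "s = 0")
  case False
  then have "0 < sqrt s" using assms(2) by simp
  then show ?thesis using assms(1) mult_le_cancel_left_pos by blast
qed (use assms in simp)

text \<open>The adjoint of a row multiplier maps the kernel vector at \<open>y\<close> to the tuple of kernel vectors
  with the conjugated coefficients \<open>\<Phi> y\<close>.\<close>

lemma row_multiplier_imp_kernel:
  assumes K: "kernel K" and \<Phi>: "contractive_matrix_multiplier K 1 n \<Phi>"
  shows "kernel (\<lambda>x y. (1 - (\<Sum>j<n. \<Phi> x 0 j * cnj (\<Phi> y 0 j))) * K x y)"
proof -
  obtain v :: "'a \<Rightarrow> ('a \<Rightarrow> complex) ell2" where v: "\<And>x y. K x y = cinner (v y) (v x)"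
    and mem: "\<And>f. f \<in> rkhs_set K \<longleftrightarrow> (\<exists>h. \<forall>x. f x = cinner h (v x))"
    and nrm: "\<And>h. h \<in> closure (combinations v) \<Longrightarrow> rkhs_norm K (\<lambda>x. cinner h (v x)) = norm h"
    using rkhs_model[OF K] by blast
  have eq: "(\<Sum>x\<in>X. \<Sum>y\<in>X. cnj (c x) * ((1 - (\<Sum>j<n. \<Phi> x 0 j * cnj (\<Phi> y 0 j))) * K x y) * c y)
    = of_real ((norm (\<Sum>x\<in>X. c x *\<^sub>C v x))\<^sup>2 - (\<Sum>j<n. (norm (\<Sum>x\<in>X. (c x * cnj (\<Phi> x 0 j)) *\<^sub>C v x))\<^sup>2))"
    for X c
  proof -
    have "(\<Sum>x\<in>X. \<Sum>y\<in>X. cnj (c x) * ((1 - (\<Sum>j<n. \<Phi> x 0 j * cnj (\<Phi> y 0 j))) * K x y) * c y)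
      = (\<Sum>x\<in>X. \<Sum>y\<in>X. cnj (c x) * cinner (v y) (v x) * c y)
        - (\<Sum>x\<in>X. \<Sum>y\<in>X. cnj (c x) * ((\<Sum>j<n. \<Phi> x 0 j * cnj (\<Phi> y 0 j)) * cinner (v y) (v x)) * c y)"
      unfolding sum_subtractf[symmetric] v by (intro sum.cong refl) (simp add: algebra_simps)
    then show ?thesis by (simp only: quadratic_form_gram quadratic_form_weighted_gram of_real_diff)
  qed
  have le: "(\<Sum>j<n. (norm (\<Sum>x\<in>X. (c x * cnj (\<Phi> x 0 j)) *\<^sub>C v x))\<^sup>2) \<le> (norm (\<Sum>x\<in>X. c x *\<^sub>C v x))\<^sup>2"
    if X: "finite X" for X c
  proof -
    \<comment> \<open>\<open>h\<close> is the adjoint of the multiplier applied to \<open>f\<close>,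
      and \<open>G\<close> the multiplier applied to \<open>h\<close>. Comparing the inner product
      of \<open>G\<close> and \<open>f\<close> with the squared norm \<open>s\<close> of
      \<open>h\<close> transfers contractivity to the adjoint.\<close>
    define h where "h j = (\<Sum>x\<in>X. (c x * cnj (\<Phi> x 0 j)) *\<^sub>C v x)" for j
    define f where "f = (\<Sum>x\<in>X. c x *\<^sub>C v x)"
    define s where "s = (\<Sum>j<n. (norm (h j))\<^sup>2)"
    define F where "F j = (\<lambda>x. cinner (h j) (v x))" for j
    define G where "G = matrix_mult_op n \<Phi> F 0"
    have hcl: "h j \<in> closure (combinations v)" for j
      unfolding h_def by (intro subsetD[OF closure_subset] combinationsI X)
    have "F \<in> tuple_set K n" unfolding tuple_set_def F_def using mem by auto
    then have G1: "G \<in> rkhs_set K" "rkhs_norm K G \<le> tuple_norm K n F"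
    proof -
      have "matrix_mult_op n \<Phi> F \<in> tuple_set K 1" "tuple_norm K 1 (matrix_mult_op n \<Phi> F) \<le> tuple_norm K n F"
        using \<Phi> \<open>F \<in> tuple_set K n\<close> unfolding contractive_matrix_multiplier_def by blast+
      then show "G \<in> rkhs_set K" "rkhs_norm K G \<le> tuple_norm K n F"
        by (simp_all add: tuple_set_def tuple_norm_def[of K "Suc 0"] G_def)
    qed
    have tn: "tuple_norm K n F = sqrt s"
      unfolding tuple_norm_def F_def s_def by (simp add: nrm hcl)
    obtain g0 where g0: "\<And>x. G x = cinner g0 (v x)" using G1(1) mem by blast
    obtain g where g: "g \<in> closure (combinations v)" "\<And>x. cinner g (v x) = cinner g0 (v x)"
      using closed_span_representative by blast
    have Gg: "G = (\<lambda>x. cinner g (v x))" using g0 g(2) by auto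
    have ng: "norm g \<le> sqrt s" using G1(2) nrm[OF g(1)] by (simp add: Gg tn)
    have "cinner g f = (\<Sum>x\<in>X. cnj (c x) * G x)"
      by (simp add: f_def cinner.sum_right cinner_scaleC_right Gg)
    also have "\<dots> = (\<Sum>x\<in>X. \<Sum>j<n. cnj (c x) * (\<Phi> x 0 j * cinner (h j) (v x)))"
      by (simp add: G_def matrix_mult_op_def F_def sum_distrib_left)
    also have "\<dots> = (\<Sum>j<n. \<Sum>x\<in>X. cnj (c x) * (\<Phi> x 0 j * cinner (h j) (v x)))"
      by (rule sum.swap)
    also have "\<dots> = (\<Sum>j<n. cinner (h j) (h j))"
    proof (intro sum.cong refl)
      fix j
      have "cinner y (h j) = (\<Sum>x\<in>X. cnj (c x) * (\<Phi> x 0 j * cinner y (v x)))" for y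
        by (simp add: h_def cinner.sum_right cinner_scaleC_right mult_ac)
      then show "(\<Sum>x\<in>X. cnj (c x) * (\<Phi> x 0 j * cinner (h j) (v x))) = cinner (h j) (h j)" by simp
    qed
    also have "\<dots> = of_real s" by (simp add: s_def cinner_self)
    finally have gf: "cinner g f = of_real s" .
    have s0: "0 \<le> s" by (simp add: s_def sum_nonneg)
    have "s \<le> norm g * norm f" using norm_cinner_le[of g f] s0 by (simp add: gf)
    also have "\<dots> \<le> sqrt s * norm f" by (intro mult_right_mono ng) simp
    finally have "sqrt s * sqrt s \<le> sqrt s * norm f" using s0 by simp
    then have "sqrt s \<le> norm f" by (rule sqrt_le_if_le_sqrt_mult[OF _ s0 norm_ge_zero])
    then have "s \<le> (norm f)\<^sup>2" using s0 real_sqrt_le_iff sqrt_le_D by blast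
    then show ?thesis by (simp add: s_def h_def f_def)
  qed
  show ?thesis
    by (rule kernelI) (simp_all only: eq Reals_of_real Re_complex_of_real diff_ge_0_iff_ge le)
qed

text \<open>Positivity of the Pick matrix over all points says that the prospective adjoint
  \<open>R\<close> contracts tuples of combinations of kernel vectors. Moment problems then produce
  the image functions.\<close>

lemma kernel_imp_matrix_multiplier:
  assumes K: "kernel K" and P: "kernel (pick_matrix K n \<Phi>)"
  shows "contractive_matrix_multiplier K m n \<Phi>"
proof -
  obtain v :: "'a \<Rightarrow> ('a \<Rightarrow> complex) ell2" where v: "\<And>x y. K x y = cinner (v y) (v x)"
    and mem: "\<And>f. f \<in> rkhs_set K \<longleftrightarrow> (\<exists>h. \<forall>x. f x = cinner h (v x))"
    and nrm: "\<And>h. h \<in> closure (combinations v) \<Longrightarrow> rkhs_norm K (\<lambda>x. cinner h (v x)) = norm h"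
    using rkhs_model[OF K] by blast
  define R where "R X c j = (\<Sum>a<m. \<Sum>x\<in>X. (c a x * cnj (\<Phi> x a j)) *\<^sub>C v x)"
    for X :: "'a set" and c :: "nat \<Rightarrow> 'a \<Rightarrow> complex" and j
  have R_le: "(\<Sum>j<n. (norm (R X c j))\<^sup>2) \<le> (\<Sum>a<m. (norm (\<Sum>x\<in>X. c a x *\<^sub>C v x))\<^sup>2)"
    if X: "finite X" for X c
  proof -
    define Y where "Y = X \<times> {..<m}"
    define d where "d = (\<lambda>(x, a). c a x)"
    define w where "w p = v (fst p)" for p :: "'a \<times> nat"
    \<comment> \<open>Writes the identity block as a sum of rank one weights, so that both parts of
      the Pick matrix have the form of \<open>quadratic_form_weighted_gram\<close>.\<close>
    define \<delta> where "\<delta> p k = (if snd p = k then 1 else 0 :: complex)" for p :: "'a \<times> nat" and k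
    define \<alpha> where "\<alpha> p j = \<Phi> (fst p) (snd p) j" for p j
    have \<delta>: "(\<Sum>k<m. \<delta> p k * cnj (\<delta> q k)) = (if snd p = snd q then 1 else 0)" if "p \<in> Y" for p q
    proof -
      have "(\<Sum>k<m. \<delta> p k * cnj (\<delta> q k)) = (\<Sum>k<m. if k = snd p then (if snd p = snd q then 1 else 0) else 0)"
        by (intro sum.cong) (auto simp: \<delta>_def)
      then show ?thesis using that by (auto simp: Y_def)
    qed
    have "0 \<le> Re (\<Sum>p\<in>Y. \<Sum>q\<in>Y. cnj (d p) * pick_matrix K n \<Phi> p q * d q)"
      using kernelD(2)[OF P, of Y d] X by (simp add: Y_def)
    also have "(\<Sum>p\<in>Y. \<Sum>q\<in>Y. cnj (d p) * pick_matrix K n \<Phi> p q * d q)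
      = (\<Sum>p\<in>Y. \<Sum>q\<in>Y. cnj (d p) * ((\<Sum>k<m. \<delta> p k * cnj (\<delta> q k)) * cinner (w q) (w p)) * d q)
      - (\<Sum>p\<in>Y. \<Sum>q\<in>Y. cnj (d p) * ((\<Sum>j<n. \<alpha> p j * cnj (\<alpha> q j)) * cinner (w q) (w p)) * d q)"
      unfolding sum_subtractf[symmetric]
    proof (intro sum.cong refl)
      fix p q assume "p \<in> Y" "q \<in> Y"
      show "cnj (d p) * pick_matrix K n \<Phi> p q * d q
        = cnj (d p) * ((\<Sum>k<m. \<delta> p k * cnj (\<delta> q k)) * cinner (w q) (w p)) * d q
          - cnj (d p) * ((\<Sum>j<n. \<alpha> p j * cnj (\<alpha> q j)) * cinner (w q) (w p)) * d q"
        unfolding \<delta>[OF \<open>p \<in> Y\<close>]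
        by (simp add: pick_matrix_def case_prod_beta v w_def \<alpha>_def algebra_simps)
    qed
    also have "\<dots> = of_real ((\<Sum>k<m. (norm (\<Sum>p\<in>Y. (d p * cnj (\<delta> p k)) *\<^sub>C w p))\<^sup>2)
        - (\<Sum>j<n. (norm (\<Sum>p\<in>Y. (d p * cnj (\<alpha> p j)) *\<^sub>C w p))\<^sup>2))"
      by (simp only: quadratic_form_weighted_gram of_real_diff)
    finally have le: "(\<Sum>j<n. (norm (\<Sum>p\<in>Y. (d p * cnj (\<alpha> p j)) *\<^sub>C w p))\<^sup>2)
        \<le> (\<Sum>k<m. (norm (\<Sum>p\<in>Y. (d p * cnj (\<delta> p k)) *\<^sub>C w p))\<^sup>2)" by simp
    have "(\<Sum>p\<in>Y. (d p * cnj (\<alpha> p j)) *\<^sub>C w p) = R X c j" for j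
    proof -
      have "(\<Sum>p\<in>Y. (d p * cnj (\<alpha> p j)) *\<^sub>C w p) = (\<Sum>x\<in>X. \<Sum>a<m. (c a x * cnj (\<Phi> x a j)) *\<^sub>C v x)"
        by (simp add: Y_def sum.cartesian_product d_def \<alpha>_def w_def case_prod_beta)
      also have "\<dots> = R X c j" unfolding R_def by (rule sum.swap)
      finally show ?thesis .
    qed
    moreover have "(\<Sum>p\<in>Y. (d p * cnj (\<delta> p k)) *\<^sub>C w p) = (\<Sum>x\<in>X. c k x *\<^sub>C v x)" if "k < m" for k
    proof -
      have "(\<Sum>p\<in>Y. (d p * cnj (\<delta> p k)) *\<^sub>C w p) = (\<Sum>x\<in>X. \<Sum>a<m. if a = k then c k x *\<^sub>C v x else 0)"
        unfolding Y_def sum.cartesian_product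
        by (intro sum.cong refl) (auto simp: d_def \<delta>_def w_def)
      then show ?thesis using that by simp
    qed
    ultimately show ?thesis using le by simp
  qed
  show ?thesis
    unfolding contractive_matrix_multiplier_def
  proof (intro ballI)
    fix F assume F: "F \<in> tuple_set K n"
    have "\<exists>h. h \<in> closure (combinations v) \<and> F j = (\<lambda>x. cinner h (v x))" if "j < n" for j
    proof -
      obtain h0 where h0: "\<And>x. F j x = cinner h0 (v x)" using F \<open>j < n\<close> mem unfolding tuple_set_def by blast
      obtain h where "h \<in> closure (combinations v)" "\<And>x. cinner h (v x) = cinner h0 (v x)"
        using closed_span_representative by blast
      then show ?thesis using h0 by (intro exI[of _ h]) auto
    qed
    then obtain h where h: "\<And>j. j < n \<Longrightarrow> h j \<in> closure (combinations v)"
      "\<And>j. j < n \<Longrightarrow> F j = (\<lambda>x. cinner (h j) (v x))" by metis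
    define C where "C = sqrt (\<Sum>j<n. (norm (h j))\<^sup>2)"
    have C: "tuple_norm K n F = C" by (simp add: tuple_norm_def C_def h nrm)
    have C0: "0 \<le> C" by (simp add: C_def sum_nonneg)
    define G where "G = matrix_mult_op n \<Phi> F"
    have Gx: "G a x = (\<Sum>j<n. \<Phi> x a j * cinner (h j) (v x))" for a x
      unfolding G_def matrix_mult_op_def by (simp add: h)
    have bound: "cmod (\<Sum>a<m. \<Sum>x\<in>X. c a x * cnj (G a x))
        \<le> sqrt (\<Sum>a<m. (norm (\<Sum>x\<in>X. c a x *\<^sub>C v x))\<^sup>2) * C" if X: "finite X" for X c
    proof -
      have "(\<Sum>a<m. \<Sum>x\<in>X. c a x * cnj (G a x))
        = (\<Sum>a<m. \<Sum>x\<in>X. \<Sum>j<n. cinner ((c a x * cnj (\<Phi> x a j)) *\<^sub>C v x) (h j))"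
        by (simp add: Gx sum_distrib_left cinner_scaleC_left mult.assoc flip: cinner_commute)
      also have "\<dots> = (\<Sum>a<m. \<Sum>j<n. \<Sum>x\<in>X. cinner ((c a x * cnj (\<Phi> x a j)) *\<^sub>C v x) (h j))"
        by (intro sum.cong refl sum.swap)
      also have "\<dots> = (\<Sum>j<n. \<Sum>a<m. \<Sum>x\<in>X. cinner ((c a x * cnj (\<Phi> x a j)) *\<^sub>C v x) (h j))"
        by (rule sum.swap)
      also have "\<dots> = (\<Sum>j<n. cinner (R X c j) (h j))"
        by (simp add: R_def cinner.sum_left)
      finally have "cmod (\<Sum>a<m. \<Sum>x\<in>X. c a x * cnj (G a x)) = cmod (\<Sum>j<n. cinner (R X c j) (h j))" by simp
      also have "\<dots> \<le> (\<Sum>j<n. norm (R X c j) * norm (h j))"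
        by (intro sum_norm_le norm_cinner_le)
      also have "\<dots> \<le> L2_set (\<lambda>j. norm (R X c j)) {..<n} * L2_set (\<lambda>j. norm (h j)) {..<n}"
        using L2_set_mult_ineq[of "\<lambda>j. norm (R X c j)" "\<lambda>j. norm (h j)" "{..<n}"] by simp
      also have "\<dots> \<le> sqrt (\<Sum>a<m. (norm (\<Sum>x\<in>X. c a x *\<^sub>C v x))\<^sup>2) * C"
        unfolding L2_set_def C_def
        by (intro mult_right_mono real_sqrt_le_mono R_le X) (simp add: sum_nonneg)
      finally show ?thesis .
    qed
    \<comment> \<open>Coefficients supported in component \<open>a\<close> give membership of that
      component; the norm estimate for the whole tuple has to be obtained jointly
      afterwards.\<close>
    have "\<exists>g. g \<in> closure (combinations v) \<and> (\<forall>x. cinner g (v x) = G a x)" if a: "a < m" for a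
    proof -
      obtain g where g: "g \<in> closure (combinations v)" "\<And>x. cinner (v x) g = cnj (G a x)"
      proof (rule moment_problem[of "\<lambda>x. cnj (G a x)" C v])
        fix X :: "'a set" and c :: "'a \<Rightarrow> complex" assume X: "finite X"
        define c' where "c' b x = (if b = a then c x else 0)" for b x
        have "(\<Sum>b<m. \<Sum>x\<in>X. c' b x * cnj (G b x)) = (\<Sum>b<m. if b = a then \<Sum>x\<in>X. c x * cnj (G a x) else 0)"
          by (intro sum.cong refl) (auto simp: c'_def)
        moreover have "(\<Sum>b<m. (norm (\<Sum>x\<in>X. c' b x *\<^sub>C v x))\<^sup>2)
            = (\<Sum>b<m. if b = a then (norm (\<Sum>x\<in>X. c x *\<^sub>C v x))\<^sup>2 else 0)"
          by (intro sum.cong refl) (auto simp: c'_def)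
        ultimately show "cmod (\<Sum>x\<in>X. c x * cnj (G a x)) \<le> C * norm (\<Sum>x\<in>X. c x *\<^sub>C v x)"
          using bound[OF X, of c'] a by (simp add: mult.commute)
      qed (use C0 in auto)
      then show ?thesis using cinner_commute complex_cnj_cnj by metis
    qed
    then obtain g where g: "\<And>a. a < m \<Longrightarrow> g a \<in> closure (combinations v)"
      "\<And>a x. a < m \<Longrightarrow> cinner (g a) (v x) = G a x" by metis
    have Ga: "G a = (\<lambda>x. cinner (g a) (v x))" if "a < m" for a using g(2)[OF that] by auto
    define S where "S = (\<Sum>a<m. (norm (g a))\<^sup>2)"
    have "\<exists>t. (\<forall>k. t k \<in> combinations v) \<and> t \<longlonglongrightarrow> g a" if "a < m" for a
      using g(1)[OF that] unfolding closure_sequential .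
    then obtain t where t: "\<And>a k. a < m \<Longrightarrow> t a k \<in> combinations v" "\<And>a. a < m \<Longrightarrow> t a \<longlonglongrightarrow> g a"
      by metis
    \<comment> \<open>\<open>bound\<close> speaks of combinations over one finite set, so the
      approximants of all components of \<open>g\<close> are first moved to the common set
      \<open>Z\<close>.\<close>
    have approx: "cmod (\<Sum>a<m. cinner (t a k) (g a)) \<le> sqrt (\<Sum>a<m. (norm (t a k))\<^sup>2) * C" for k
    proof -
      have "\<exists>X c. finite X \<and> t a k = (\<Sum>x\<in>X. c x *\<^sub>C v x)" if "a < m" for a
        using t(1)[OF that, of k] unfolding combinations_def by blast
      then obtain X c where X: "\<And>a. a < m \<Longrightarrow> finite (X a)"
        "\<And>a. a < m \<Longrightarrow> t a k = (\<Sum>x\<in>X a. c a x *\<^sub>C v x)" by metis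
      define Z where "Z = (\<Union>a<m. X a)"
      define c' where "c' a x = (if x \<in> X a then c a x else 0)" for a x
      have Z: "finite Z" using X by (simp add: Z_def)
      have tZ: "t a k = (\<Sum>x\<in>Z. c' a x *\<^sub>C v x)" if "a < m" for a
        unfolding X(2)[OF that] using that Z
        by (intro sum.mono_neutral_cong_left) (auto simp: Z_def c'_def)
      have "cinner (t a k) (g a) = (\<Sum>x\<in>Z. c' a x * cnj (G a x))" if "a < m" for a
        by (simp add: tZ[OF that] cinner.sum_left cinner_scaleC_left Ga[OF that] flip: cinner_commute)
      then have "(\<Sum>a<m. cinner (t a k) (g a)) = (\<Sum>a<m. \<Sum>x\<in>Z. c' a x * cnj (G a x))" by simp
      then show ?thesis using bound[OF Z, of c'] tZ by simp
    qed
    have "cmod (\<Sum>a<m. cinner (g a) (g a)) \<le> sqrt (\<Sum>a<m. (norm (g a))\<^sup>2) * C"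
    proof (rule LIMSEQ_le)
      show "(\<lambda>k. cmod (\<Sum>a<m. cinner (t a k) (g a))) \<longlonglongrightarrow> cmod (\<Sum>a<m. cinner (g a) (g a))"
        by (intro tendsto_norm tendsto_sum cinner.tendsto tendsto_const t(2)) auto
      show "(\<lambda>k. sqrt (\<Sum>a<m. (norm (t a k))\<^sup>2) * C) \<longlonglongrightarrow> sqrt (\<Sum>a<m. (norm (g a))\<^sup>2) * C"
        by (intro tendsto_mult tendsto_real_sqrt tendsto_sum tendsto_power tendsto_norm tendsto_const t(2)) auto
    qed (use approx in blast)
    moreover have "(\<Sum>a<m. cinner (g a) (g a)) = of_real S" by (simp add: S_def cinner_self)
    moreover have S0: "0 \<le> S" by (simp add: S_def sum_nonneg)
    ultimately have "sqrt S * sqrt S \<le> sqrt S * C" by (simp flip: S_def)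
    then have "sqrt S \<le> C" by (rule sqrt_le_if_le_sqrt_mult[OF _ S0 C0])
    moreover have "tuple_norm K m G = sqrt S"
      by (simp add: tuple_norm_def S_def Ga nrm g(1))
    moreover have "G \<in> tuple_set K m" using g(2) mem unfolding tuple_set_def by (auto simp flip: g(2))
    ultimately show "matrix_mult_op n \<Phi> F \<in> tuple_set K m \<and>
        tuple_norm K m (matrix_mult_op n \<Phi> F) \<le> tuple_norm K n F"
      by (simp add: G_def C)
  qed
qed

section \<open>Complete Nevanlinna--Pick kernels\<close>

text \<open>A Gram representation \<open>\<alpha>\<close> of \<open>1 - 1/K\<close> on a finite set is a solvable Pick problem whose Pick
  matrix is identically \<open>1\<close>; extending its solution to one more point cannot change the off-diagonal
  entries, and can only decrease the diagonal one.\<close>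

theorem cnp_kernel_imp_kernel:
  fixes K :: "'x \<Rightarrow> 'x \<Rightarrow> complex"
  assumes cnp: "cnp_kernel K" and w: "\<And>x. K x w = 1" and nz: "\<And>x y. K x y \<noteq> 0"
  shows "kernel (\<lambda>x y. 1 - 1 / K x y)"
proof -
  have K: "kernel K" using cnp by (simp add: cnp_kernel_def)
  have w': "K w x = 1" for x using kernel_commute[OF K, of w x] w[of x] by simp
  \<comment> \<open>Points are added one at a time, each at the cost of one column. \<open>w\<close>
    always belongs to the set, as the point where the vectors vanish.\<close>
  have gram: "\<exists>n\<ge>(1::nat). \<exists>\<alpha>. \<forall>x\<in>insert w X. \<forall>y\<in>insert w X. 1 - 1 / K x y = (\<Sum>j<n. \<alpha> x j * cnj (\<alpha> y j))"
    if "finite X" for X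
    using that
  proof (induction X)
    case empty
    show ?case by (rule exI[of _ 1]) (auto intro!: exI[of _ "\<lambda>_ _. 0"] simp: w)
  next
    case (insert z X)
    obtain n :: nat and \<alpha> :: "'x \<Rightarrow> nat \<Rightarrow> complex" where n: "n \<ge> 1"
      and \<alpha>: "\<And>x y. x \<in> insert w X \<Longrightarrow> y \<in> insert w X \<Longrightarrow> 1 - 1 / K x y = (\<Sum>j<n. \<alpha> x j * cnj (\<alpha> y j))"
      using insert.IH by blast
    show ?case
    proof (cases "z = w")
      case True
      then show ?thesis using n \<alpha> by auto
    next
      case False
      define W where "W x a j = \<alpha> x j" for x and a :: nat and j
      have one: "(1 - (\<Sum>j<n. \<alpha> x j * cnj (\<alpha> y j))) * K x y = 1" if "x \<in> insert w X" "y \<in> insert w X" for x y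
        unfolding \<alpha>[OF that, symmetric] using nz by simp
      have "psd_on (insert w X \<times> {..<1}) (pick_matrix K n W)"
      proof -
        have "(\<Sum>p\<in>insert w X \<times> {..<1}. \<Sum>q\<in>insert w X \<times> {..<1}. cnj (c p) * pick_matrix K n W p q * c q)
          = (\<Sum>p\<in>insert w X \<times> {..<1}. \<Sum>q\<in>insert w X \<times> {..<1}. cnj (c p) * 1 * c q)" for c
          by (intro sum.cong refl) (use one in \<open>auto simp: pick_matrix_def W_def\<close>)
        then show ?thesis
          using kernelD[OF kernel_one, of "insert w X \<times> {..<1::nat}"] insert.hyps(1)
          unfolding psd_on_def Let_def by simp
      qed
      then obtain \<Phi> where \<Phi>: "contractive_matrix_multiplier K 1 n \<Phi>"
        and \<Phi>W: "\<And>x j. x \<in> insert w X \<Longrightarrow> j < n \<Longrightarrow> \<Phi> x 0 j = \<alpha> x j"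
        using cnp[unfolded cnp_kernel_def, THEN conjunct2, rule_format, of 1 n "insert w X" W]
          n insert.hyps(1) by (auto simp: W_def)
      define P where "P x y = (1 - (\<Sum>j<n. \<Phi> x 0 j * cnj (\<Phi> y 0 j))) * K x y" for x y
      have "kernel P" unfolding P_def by (rule row_multiplier_imp_kernel[OF K \<Phi>])
      then obtain p :: "'x \<Rightarrow> 'x ell2" where p: "\<And>x y. P x y = cinner (p y) (p x)"
        using kernel_factorization by blast
      have P1: "P x y = 1" if "x \<in> insert w X" "y \<in> insert w X" for x y
        using one[OF that] \<Phi>W that by (simp add: P_def)
      \<comment> \<open>A Gram matrix with all entries 1 comes from a single unit vector.\<close>
      have pw: "p x = p w" if "x \<in> insert w X" for x
      proof -
        have "cinner (p x - p w) (p x - p w) = 0"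
          using P1 that by (simp add: cinner_diff_left cinner_diff_right flip: p)
        then show ?thesis by (simp add: cinner_self)
      qed
      \<comment> \<open>The row of \<open>w\<close> vanishes, so normalization of \<open>K\<close>
        forces \<open>P w z = 1\<close>; \<open>pw\<close> spreads this to the other old
        points.\<close>
      have "(\<Sum>j<n. \<alpha> w j * cnj (\<alpha> w j)) = 0" using \<alpha>[of w w] w by simp
      then have "complex_of_real (\<Sum>j<n. (cmod (\<alpha> w j))\<^sup>2) = 0"
        by (simp only: of_real_sum complex_norm_square)
      then have \<alpha>w: "\<alpha> w j = 0" if "j < n" for j
        using that by (simp add: sum_nonneg_eq_0_iff del: of_real_sum of_real_power)
      have Pwz: "P w z = 1" using \<Phi>W \<alpha>w by (simp add: P_def w')
      have Pxz: "P x z = 1" if "x \<in> insert w X" for x using Pwz pw[OF that] by (simp add: p)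
      have Pzx: "P z x = 1" if "x \<in> insert w X" for x
        using kernel_commute[OF \<open>kernel P\<close>, of z x] Pxz[OF that] by simp
      \<comment> \<open>The only freedom left is the excess of \<open>P\<close> over 1 at
        \<open>z\<close>; it is nonnegative by Cauchy--Schwarz against the unit vector
        \<open>p w\<close>.\<close>
      define d where "d = Re (P z z) - 1"
      have d: "0 \<le> d"
      proof -
        have "1 \<le> norm (p z) * norm (p w)" using norm_cinner_le[of "p z" "p w"] Pwz by (simp add: p)
        moreover have "norm (p w) = 1" using P1[of w w] by (simp add: p cinner_self power2_eq_1_iff)
          (metis abs_norm_cancel of_real_eq_1_iff of_real_power power2_eq_1_iff abs_1 abs_minus)
        ultimately have "1\<^sup>2 \<le> (norm (p z))\<^sup>2" by (intro power_mono) auto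
        then show ?thesis by (simp add: d_def p cinner_self)
      qed
      have Pzz: "P z z = of_real (1 + d)" using kernel_diagonal(1)[OF \<open>kernel P\<close>, of z] by (simp add: d_def)
      define s where "s = (\<Sum>j<n. \<Phi> z 0 j * cnj (\<Phi> z 0 j))"
      obtain \<kappa> where \<kappa>: "K z z = of_real \<kappa>" "0 < \<kappa>"
        using kernel_diagonal[OF K, of z] nz[of z z] by (metis less_eq_real_def of_real_0)
      define e where "e = d / \<kappa>"
      have e: "0 \<le> e" using d \<kappa> by (simp add: e_def)
      have zz: "1 - 1 / K z z = s + of_real e"
      proof -
        have "(1 - s) * K z z = 1 + of_real d" using Pzz by (simp add: P_def s_def)
        then have "1 - s = (1 + of_real d) / K z z" using nz[of z z] by (simp add: eq_divide_eq)
        then have "1 - s = 1 / K z z + of_real e" by (simp add: add_divide_distrib e_def \<kappa>)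
        then show ?thesis by (simp add: algebra_simps)
      qed
      \<comment> \<open>The extra column repairs the diagonal entry at \<open>z\<close>: dividing
        the excess \<open>d\<close> by \<open>K z z\<close> gives \<open>e\<close>, and a column
        supported at \<open>z\<close> alone leaves all other entries untouched.\<close>
      define \<beta> where "\<beta> x j = (if j < n then \<Phi> x 0 j else if x = z then of_real (sqrt e) else 0)" for x j
      have zX: "z \<notin> insert w X" using insert.hyps(2) False by simp
      have off: "1 - 1 / K x y = (\<Sum>j<n. \<Phi> x 0 j * cnj (\<Phi> y 0 j))" if "P x y = 1" for x y
        using that nz[of x y] unfolding P_def by (simp add: field_simps)
      have "1 - 1 / K x y = (\<Sum>j<Suc n. \<beta> x j * cnj (\<beta> y j))"
        if "x \<in> insert w (insert z X)" "y \<in> insert w (insert z X)" for x y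
      proof -
        have "(\<Sum>j<Suc n. \<beta> x j * cnj (\<beta> y j))
            = (\<Sum>j<n. \<Phi> x 0 j * cnj (\<Phi> y 0 j)) + (if x = z \<and> y = z then of_real e else 0)"
          using e by (auto simp: \<beta>_def simp flip: of_real_mult)
        moreover have "1 - 1 / K x y = (\<Sum>j<n. \<Phi> x 0 j * cnj (\<Phi> y 0 j)) + (if x = z \<and> y = z then of_real e else 0)"
        proof (cases "x = z \<and> y = z")
          case True
          then show ?thesis using zz by (simp add: s_def)
        next
          case False
          then have "P x y = 1" using that P1 Pxz Pzx by auto
          then show ?thesis using off[of x y] False by auto
        qed
        ultimately show ?thesis by simp
      qed
      then show ?thesis by (intro exI[of _ "Suc n"] conjI exI[of _ \<beta>]) auto
    qed
  qed
  show ?thesis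
  proof (rule kernelI)
    fix X :: "'x set" and c :: "'x \<Rightarrow> complex" assume X: "finite X"
    obtain n :: nat and \<alpha> :: "'x \<Rightarrow> nat \<Rightarrow> complex" where \<alpha>: "\<And>x y. x \<in> X \<Longrightarrow> y \<in> X \<Longrightarrow> 1 - 1 / K x y = (\<Sum>j<n. \<alpha> x j * cnj (\<alpha> y j))"
      using gram[OF X] by (metis insertCI)
    have "(\<Sum>x\<in>X. \<Sum>y\<in>X. cnj (c x) * (1 - 1 / K x y) * c y)
      = (\<Sum>x\<in>X. \<Sum>y\<in>X. cnj (c x) * ((\<Sum>j<n. \<alpha> x j * cnj (\<alpha> y j)) * cinner (1::complex) 1) * c y)"
      by (intro sum.cong refl) (simp add: \<alpha> cinner_complex_def)
    then have *: "(\<Sum>x\<in>X. \<Sum>y\<in>X. cnj (c x) * (1 - 1 / K x y) * c y)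
      = of_real (\<Sum>j<n. (norm (\<Sum>x\<in>X. (c x * cnj (\<alpha> x j)) *\<^sub>C (1::complex)))\<^sup>2)"
      by (simp only: quadratic_form_weighted_gram)
    show "(\<Sum>x\<in>X. \<Sum>y\<in>X. cnj (c x) * (1 - 1 / K x y) * c y) \<in> \<real>"
      unfolding * by (rule Reals_of_real)
    show "0 \<le> Re (\<Sum>x\<in>X. \<Sum>y\<in>X. cnj (c x) * (1 - 1 / K x y) * c y)"
      unfolding * Re_complex_of_real by (intro sum_nonneg) simp
  qed
qed

text \<open>An operator extended from a span is only known to be contractive off it; its defect will
  enter the Pick kernel as a positive summand.\<close>

lemma kernel_contraction_defect:
  fixes s :: "'i \<Rightarrow> 'h::complex_hilbert_space" and V :: "'h \<Rightarrow>\<^sub>L 'k::complex_hilbert_space"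
  assumes V: "V \<in> bounded_ops" "norm V \<le> 1"
  shows "kernel (\<lambda>p q. cinner (s q) (s p) - cinner (blinfun_apply V (s q)) (blinfun_apply V (s p)))"
proof -
  have eq: "(\<Sum>p\<in>X. \<Sum>q\<in>X. cnj (c p) * (cinner (s q) (s p)
        - cinner (blinfun_apply V (s q)) (blinfun_apply V (s p))) * c q)
    = of_real ((norm (\<Sum>p\<in>X. c p *\<^sub>C s p))\<^sup>2 - (norm (blinfun_apply V (\<Sum>p\<in>X. c p *\<^sub>C s p)))\<^sup>2)" for X c
  proof -
    have "blinfun_apply V (\<Sum>p\<in>X. c p *\<^sub>C s p) = (\<Sum>p\<in>X. c p *\<^sub>C blinfun_apply V (s p))"
      by (simp add: blinfun.sum_right bounded_ops_scaleC[OF V(1)])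
    then show ?thesis
      by (simp only: of_real_diff flip: quadratic_form_gram)
         (simp add: algebra_simps sum_subtractf)
  qed
  have "norm (blinfun_apply V x) \<le> norm x" for x
    using norm_blinfun[of V x] mult_right_mono[OF V(2), of "norm x"] by simp
  then have "(norm (blinfun_apply V x))\<^sup>2 \<le> (norm x)\<^sup>2" for x by (intro power_mono) auto
  then show ?thesis
    by (intro kernelI) (simp_all only: eq Reals_of_real Re_complex_of_real diff_ge_0_iff_ge)
qed

text \<open>\<open>t z h\<close> plays the elementary tensor of the Gram vector of \<open>z\<close>
  with \<open>h\<close>. Inner products determine all that matters, and the distance formula
  provides the contraction constant of a fixed point argument.\<close>

lemma tensor_product:
  fixes L :: "'x \<Rightarrow> 'x \<Rightarrow> complex"
  assumes L: "kernel L"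
  obtains t :: "'x \<Rightarrow> 'g::complex_hilbert_space \<Rightarrow> ('x \<times> 'g) ell2"
  where "\<And>z h z' h'. cinner (t z' h') (t z h) = L z z' * cinner h' h"
    "\<And>z h h'. norm (t z h - t z h') = sqrt (Re (L z z)) * norm (h - h')"
proof -
  have "kernel (\<lambda>(p :: 'x \<times> 'g) q. L (fst p) (fst q) * cinner (snd q) (snd p))"
    by (intro kernel_mult kernel_pullback[OF L] kernel_gram)
  then obtain f :: "'x \<times> 'g \<Rightarrow> ('x \<times> 'g) ell2"
    where f: "\<And>p q. L (fst p) (fst q) * cinner (snd q) (snd p) = cinner (f q) (f p)"
    using kernel_factorization by blast
  define t where "t z h = f (z, h)" for z h
  have t: "cinner (t z' h') (t z h) = L z z' * cinner h' h" for z h z' h'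
    using f[of "(z, h)" "(z', h')"] by (simp add: t_def)
  have "norm (t z h - t z h') = sqrt (Re (L z z)) * norm (h - h')" for z h h'
  proof -
    have "complex_of_real ((norm (t z h - t z h'))\<^sup>2) = L z z * of_real ((norm (h - h'))\<^sup>2)"
      unfolding cinner_self[symmetric]
      by (simp add: cinner_diff_left cinner_diff_right t algebra_simps)
    from arg_cong[OF this, of Re]
    have "(norm (t z h - t z h'))\<^sup>2 = Re (L z z) * (norm (h - h'))\<^sup>2"
      by (simp del: of_real_power)
    also have "\<dots> = (sqrt (Re (L z z)) * norm (h - h'))\<^sup>2"
      using kernel_diagonal(2)[OF L] by (simp add: power_mult_distrib)
    finally have "(norm (t z h - t z h'))\<^sup>2 = (sqrt (Re (L z z)) * norm (h - h'))\<^sup>2" .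
    then show ?thesis
      by (rule power2_eq_imp_eq) (simp_all add: kernel_diagonal(2)[OF L])
  qed
  then show ?thesis using that t by blast
qed

text \<open>Equal Gram matrices mean that matching the vectors is isometric: the source of every
  lurking isometry below.\<close>

lemma norm_combination_eqI:
  fixes v :: "'i \<Rightarrow> 'h::complex_hilbert_space" and w :: "'i \<Rightarrow> 'k::complex_hilbert_space"
  assumes "\<And>i j. cinner (v j) (v i) = cinner (w j) (w i)"
  shows "norm (\<Sum>i\<in>X. c i *\<^sub>C v i) = norm (\<Sum>i\<in>X. c i *\<^sub>C w i)"
proof -
  have "complex_of_real ((norm (\<Sum>i\<in>X. c i *\<^sub>C v i))\<^sup>2) = of_real ((norm (\<Sum>i\<in>X. c i *\<^sub>C w i))\<^sup>2)"
    by (simp only: assms flip: quadratic_form_gram)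
  then show ?thesis by (simp only: of_real_eq_iff) simp
qed

text \<open>The realization formula: the values of the interpolant solve the fixed point equation
  \<open>h = snd (V (e\<^sub>a, t z h))\<close>, where the lurking isometry \<open>V\<close> is read off the Pick matrix.\<close>

theorem cnp_kernel_geometric:
  fixes L :: "'x \<Rightarrow> 'x \<Rightarrow> complex"
  assumes L: "kernel L" and less: "\<And>x. Re (L x x) < 1"
  shows "cnp_kernel (\<lambda>x y. 1 / (1 - L x y))"
proof -
  define K where "K = (\<lambda>x y. 1 / (1 - L x y))"
  have K: "kernel K" unfolding K_def by (rule kernel_geometric[OF L less])
  have L1: "1 - L x y \<noteq> 0" for x y using norm_kernel_less_1[OF L less, of x y] by auto
  have "\<exists>\<Phi>. contractive_matrix_multiplier K m n \<Phi> \<and> (\<forall>x\<in>X. \<forall>a<m. \<forall>j<n. \<Phi> x a j = W x a j)"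
    if X: "finite X" and psd: "psd_on (X \<times> {..<m}) (pick_matrix K n W)" for m n X W
  proof -
    define I where "I = X \<times> {..<m}"
    have "kernel (\<lambda>p q. if p \<in> I \<and> q \<in> I then pick_matrix K n W p q else 0)"
      using psd X unfolding I_def by (intro psd_on_zero_extension) auto
    then obtain g :: "'x \<times> nat \<Rightarrow> ('x \<times> nat) ell2"
      where g: "\<And>p q. (if p \<in> I \<and> q \<in> I then pick_matrix K n W p q else 0) = cinner (g q) (g p)"
      using kernel_factorization by blast
    obtain t :: "'x \<Rightarrow> ('x \<times> nat) ell2 \<Rightarrow> ('x \<times> ('x \<times> nat) ell2) ell2"
      where t: "\<And>z h z' h'. cinner (t z' h') (t z h) = L z z' * cinner h' h"
        and dist_t: "\<And>z h h'. norm (t z h - t z h') = sqrt (Re (L z z)) * norm (h - h')"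
      using tensor_product[OF L] by blast
    define \<beta> where "\<beta> p = (\<Sum>j<n. cnj (W (fst p) (snd p) j) *\<^sub>C unit_vec j)" for p
    \<comment> \<open>Zero outside \<open>I\<close>, so that the Gram matrices agree for all pairs
      of indices.\<close>
    define s where "s p = (if p \<in> I then (unit_vec (snd p), t (fst p) (g p)) else 0)" for p
    define r where "r p = (if p \<in> I then (\<beta> p, g p) else 0)" for p
    have \<beta>: "cinner (\<beta> q) (\<beta> p) = (\<Sum>j<n. W (fst p) (snd p) j * cnj (W (fst q) (snd q) j))" for p q
      by (simp add: \<beta>_def cinner_combination cinner_unit_vec_unit_vec mult_ac if_distrib cong: if_cong)
    \<comment> \<open>Multiply the Pick matrix by \<open>1 - L\<close>, the reciprocal of
      \<open>K\<close>, and move the negative terms to the other side.\<close>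
    have lurking: "cinner (s q) (s p) = cinner (r q) (r p)" for p q
    proof (cases "p \<in> I \<and> q \<in> I")
      case True
      define S where "S = (\<Sum>j<n. W (fst p) (snd p) j * cnj (W (fst q) (snd q) j))"
      define \<delta> where "\<delta> = (if snd p = snd q then 1 else 0 :: complex)"
      have "cinner (g q) (g p) = (\<delta> - S) * (1 / (1 - L (fst p) (fst q)))"
        using True g[of p q] by (simp add: pick_matrix_def case_prod_beta K_def \<delta>_def S_def)
      then have "cinner (g q) (g p) * (1 - L (fst p) (fst q)) = \<delta> - S"
        using L1[of "fst p" "fst q"] by simp
      moreover have "cinner (s q) (s p) = \<delta> + L (fst p) (fst q) * cinner (g q) (g p)"
        using True by (simp add: s_def t cinner_unit_vec_unit_vec \<delta>_def)
      moreover have "cinner (r q) (r p) = S + cinner (g q) (g p)"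
        using True by (simp add: r_def \<beta> S_def)
      ultimately show ?thesis by (simp add: algebra_simps)
    qed (auto simp: s_def r_def)
    obtain V :: "(nat ell2 \<times> ('x \<times> ('x \<times> nat) ell2) ell2) \<Rightarrow>\<^sub>L (nat ell2 \<times> ('x \<times> nat) ell2)"
      where V: "V \<in> bounded_ops" "norm V \<le> 1" and Vs: "\<And>p. blinfun_apply V (s p) = r p"
      by (rule operator_of_family[of r 1 s]) (simp_all add: norm_combination_eqI[OF lurking])
    have V_le: "norm (blinfun_apply V x) \<le> norm x" for x
      using norm_blinfun[of V x] mult_right_mono[OF V(2), of "norm x"] by simp
    define f where "f p h = snd (blinfun_apply V (unit_vec (snd p), t (fst p) h))" for p h
    \<comment> \<open>\<open>V\<close> does not increase norms, so the contraction constant comes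
      from \<open>t\<close> and is below 1 by the hypothesis on the diagonal of
      \<open>L\<close>.\<close>
    have fix_unique: "\<exists>!h. f p h = h" for p
    proof -
      show ?thesis
      proof (rule banach_fix_type[of "sqrt (Re (L (fst p) (fst p)))"])
        show "\<forall>h h'. dist (f p h) (f p h') \<le> sqrt (Re (L (fst p) (fst p))) * dist h h'"
        proof (intro allI)
          fix h h'
          have "f p h - f p h' = snd (blinfun_apply V (0, t (fst p) h - t (fst p) h'))"
            unfolding f_def snd_diff[symmetric] blinfun.diff_right[symmetric] by simp
          also have "norm \<dots> \<le> norm (blinfun_apply V (0, t (fst p) h - t (fst p) h'))"
            by (metis norm_snd_le prod.collapse)
          also have "\<dots> \<le> norm (t (fst p) h - t (fst p) h')"
            using V_le[of "(0, t (fst p) h - t (fst p) h')"] by (simp add: norm_prod_def)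
          finally show "dist (f p h) (f p h') \<le> sqrt (Re (L (fst p) (fst p))) * dist h h'"
            by (simp add: dist_norm dist_t)
        qed
      qed (use less kernel_diagonal(2)[OF L] in auto)
    qed
    define h where "h p = (THE h. f p h = h)" for p
    have fh: "f p (h p) = h p" for p unfolding h_def by (rule theI'[OF fix_unique])
    define b where "b p = fst (blinfun_apply V (unit_vec (snd p), t (fst p) (h p)))" for p
    have Vp: "blinfun_apply V (unit_vec (snd p), t (fst p) (h p)) = (b p, h p)" for p
      using fh[of p] by (simp add: b_def f_def prod_eq_iff)
    \<comment> \<open>At a node, \<open>g p\<close> solves the same fixed point equation, so
      uniqueness recovers the prescribed row.\<close>
    have b_I: "b p = \<beta> p" if "p \<in> I" for p
    proof -
      have Vg: "blinfun_apply V (unit_vec (snd p), t (fst p) (g p)) = (\<beta> p, g p)"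
        using Vs[of p] that by (simp add: s_def r_def)
      have "f p (g p) = g p" by (simp add: f_def Vg)
      then have "g p = h p" using fix_unique[of p] fh[of p] by blast
      then show ?thesis using Vg by (simp add: b_def)
    qed
    \<comment> \<open>\<open>b\<close> carries conjugated rows; the second slot of
      \<open>cinner\<close> undoes this.\<close>
    define \<Phi> where "\<Phi> z a j = cinner (unit_vec j) (b (z, a))" for z a j
    have interp: "\<Phi> x a j = W x a j" if "x \<in> X" "a < m" "j < n" for x a j
      using that b_I[of "(x, a)"]
      by (simp add: \<Phi>_def I_def \<beta>_def cinner.sum_right cinner_scaleC_right cinner_unit_vec_unit_vec
          if_distrib cong: if_cong)
    \<comment> \<open>Away from the nodes \<open>V\<close> may produce coordinates beyond the first
      \<open>n\<close>. \<open>Q\<close> projects onto these; discarding them adds a positive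
      term.\<close>
    define Q where "Q x = x - (\<Sum>j<n. cinner x (unit_vec j) *\<^sub>C unit_vec j)" for x :: "nat ell2"
    have Q: "cinner (Q x) (Q y) = cinner x y - (\<Sum>j<n. cinner x (unit_vec j) * cinner (unit_vec j) y)" for x y
    proof -
      have 1: "cinner x (\<Sum>j<n. cinner y (unit_vec j) *\<^sub>C unit_vec j) = (\<Sum>j<n. cinner x (unit_vec j) * cinner (unit_vec j) y)" for x y
        by (simp add: cinner.sum_right cinner_scaleC_right mult.commute flip: cinner_commute)
      have "cinner (\<Sum>j<n. cinner x (unit_vec j) *\<^sub>C unit_vec j) (unit_vec k) = cinner x (unit_vec k)" if "k < n" for x k
        using that by (simp add: cinner.sum_left cinner_scaleC_left cinner_unit_vec_unit_vec if_distrib cong: if_cong)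
      then have 2: "cinner (Q x) (unit_vec k) = 0" if "k < n" for x k
        using that by (simp add: Q_def cinner_diff_left)
      have "cinner (Q x) (Q y) = cinner (Q x) y"
        unfolding Q_def[of y] cinner_diff_right 1 using 2 by simp
      also have "\<dots> = cinner x y - (\<Sum>j<n. cinner x (unit_vec j) * cinner (unit_vec j) y)"
        by (simp add: Q_def cinner_diff_left cinner.sum_left cinner_scaleC_left)
      finally show ?thesis .
    qed
    define s' where "s' p = (unit_vec (snd p) :: nat ell2, t (fst p) (h p))" for p
    define D where "D p q = cinner (s' q) (s' p) - cinner (blinfun_apply V (s' q)) (blinfun_apply V (s' p))" for p q
    have D: "kernel D" unfolding D_def by (rule kernel_contraction_defect[OF V])
    have K2: "kernel (\<lambda>p q :: 'x \<times> nat. K (fst p) (fst q))" by (rule kernel_pullback[OF K])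
    \<comment> \<open>The three summands are the defect of \<open>V\<close>, the Gram kernel of the
      fixed points with \<open>(1 - L) * K = 1\<close> already used, and the discarded
      coordinates.\<close>
    have "kernel (\<lambda>p q. D p q * K (fst p) (fst q) + cinner (h q) (h p) + cinner (Q (b q)) (Q (b p)) * K (fst p) (fst q))"
      by (intro kernel_add kernel_mult D K2 kernel_gram)
    also have "(\<lambda>p q. D p q * K (fst p) (fst q) + cinner (h q) (h p) + cinner (Q (b q)) (Q (b p)) * K (fst p) (fst q))
      = pick_matrix K n \<Phi>"
    proof (intro ext)
      fix p q :: "'x \<times> nat"
      define S where "S = (\<Sum>j<n. \<Phi> (fst p) (snd p) j * cnj (\<Phi> (fst q) (snd q) j))"
      define \<delta> where "\<delta> = (if snd p = snd q then 1 else 0 :: complex)"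
      have S: "S = (\<Sum>j<n. cinner (b q) (unit_vec j) * cinner (unit_vec j) (b p))"
        unfolding S_def by (simp add: \<Phi>_def mult.commute flip: cinner_commute)
      have "D p q = \<delta> + L (fst p) (fst q) * cinner (h q) (h p) - cinner (b q) (b p) - cinner (h q) (h p)"
        by (simp add: D_def s'_def Vp t cinner_unit_vec_unit_vec \<delta>_def)
      then have "D p q + (1 - L (fst p) (fst q)) * cinner (h q) (h p) + cinner (Q (b q)) (Q (b p)) = \<delta> - S"
        by (simp add: Q S algebra_simps)
      then have "(D p q + (1 - L (fst p) (fst q)) * cinner (h q) (h p) + cinner (Q (b q)) (Q (b p))) * K (fst p) (fst q)
        = (\<delta> - S) * K (fst p) (fst q)" by simp
      moreover have "(1 - L (fst p) (fst q)) * K (fst p) (fst q) = 1" using L1 by (simp add: K_def)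
      then have "(1 - L (fst p) (fst q)) * cinner (h q) (h p) * K (fst p) (fst q) = cinner (h q) (h p)"
        by (metis (no_types, opaque_lifting) mult.assoc mult.commute mult_1)
      ultimately show "D p q * K (fst p) (fst q) + cinner (h q) (h p) + cinner (Q (b q)) (Q (b p)) * K (fst p) (fst q)
        = pick_matrix K n \<Phi> p q"
        by (simp add: pick_matrix_def case_prod_beta S_def \<delta>_def distrib_right)
    qed
    finally show ?thesis
      using interp kernel_imp_matrix_multiplier[OF K] by blast
  qed
  then show ?thesis using K unfolding cnp_kernel_def K_def[symmetric] by blast
qed

section \<open>From a Schur function to a positive kernel\<close>

text \<open>On the unit circle \<open>cnj (1 / (1 - cnj z * \<zeta>)) = \<zeta> / (\<zeta> - z)\<close>, so this is Cauchy's formula.\<close>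

lemma szego_reproducing:
  assumes h: "h holomorphic_on cball 0 1" and z: "cmod z < 1"
  shows "((\<lambda>t. h (circlepath 0 1 t) * cnj (1 / (1 - cnj z * circlepath 0 1 t))) has_integral h z) {0..1}"
proof -
  define \<gamma> where "\<gamma> = circlepath 0 1"
  have \<gamma>: "\<gamma> t = exp (2 * pi * \<i> * t)" for t by (simp add: \<gamma>_def circlepath)
  have norm_\<gamma>: "cmod (\<gamma> t) = 1" for t by (simp add: \<gamma>)
  have inv: "\<gamma> t * cnj (\<gamma> t) = 1" for t
    using complex_norm_square[of "\<gamma> t"] by (simp add: norm_\<gamma>)
  have szego: "cnj (1 / (1 - cnj z * \<gamma> t)) = \<gamma> t / (\<gamma> t - z)" for t
  proof -
    have "\<gamma> t - z \<noteq> 0" using norm_\<gamma>[of t] z by auto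
    moreover have "1 - z * cnj (\<gamma> t) = cnj (\<gamma> t) * (\<gamma> t - z)"
      using inv[of t] by (simp add: algebra_simps)
    moreover have "cnj (\<gamma> t) \<noteq> 0" using norm_\<gamma>[of t] by auto
    ultimately have "1 / (1 - z * cnj (\<gamma> t)) = \<gamma> t / (\<gamma> t - z)"
      by (simp add: frac_eq_eq mult.assoc[symmetric] inv)
    then show ?thesis by simp
  qed
  define c where "c = 2 * complex_of_real pi * \<i>"
  have "c \<noteq> 0" by (simp add: c_def)
  have "((\<lambda>u. h u / (u - z)) has_contour_integral c * h z) \<gamma>"
    unfolding \<gamma>_def c_def by (rule Cauchy_integral_circlepath_simple[OF h]) (use z in auto)
  then have int: "((\<lambda>t. h (\<gamma> t) / (\<gamma> t - z) * vector_derivative \<gamma> (at t within {0..1}))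
      has_integral c * h z) {0..1}"
    unfolding has_contour_integral_def .
  have deriv: "vector_derivative \<gamma> (at t within {0..1}) = c * \<gamma> t" if "t \<in> {0..1}" for t
    using vector_derivative_circlepath01[of t 0 1] that by (simp add: c_def \<gamma>) (simp add: \<gamma>_def)
  have "((\<lambda>t. h (\<gamma> t) / (\<gamma> t - z) * (c * \<gamma> t)) has_integral c * h z) {0..1}"
    by (rule has_integral_eq[OF _ int]) (simp add: deriv)
  from has_integral_mult_right[OF this, of "1 / c"]
  have "((\<lambda>t. h (\<gamma> t) * (\<gamma> t / (\<gamma> t - z))) has_integral h z) {0..1}"
    using \<open>c \<noteq> 0\<close> by simp
  then show ?thesis unfolding szego[symmetric] by (simp only: \<gamma>_def)
qed

lemma hermitian_quadratic_form_real:
  assumes "\<And>x y. M y x = cnj (M x y)"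
  shows "(\<Sum>x\<in>X. \<Sum>y\<in>X. cnj (c x) * M x y * c y) \<in> \<real>"
proof -
  have "cnj (\<Sum>x\<in>X. \<Sum>y\<in>X. cnj (c x) * M x y * c y) = (\<Sum>x\<in>X. \<Sum>y\<in>X. cnj (c y) * M y x * c x)"
    by (simp add: mult_ac flip: assms)
  also have "\<dots> = (\<Sum>x\<in>X. \<Sum>y\<in>X. cnj (c x) * M x y * c y)" by (rule sum.swap)
  finally show ?thesis by (simp add: Reals_cnj_iff)
qed

lemma norm_product_less_1: "cmod a < 1 \<Longrightarrow> cmod b < 1 \<Longrightarrow> cmod (a * cnj b) < 1"
  using mult_left_le[of "cmod b" "cmod a"] by (simp add: norm_mult)

text \<open>Averaging \<open>\<parallel>F - g \<psi>\<parallel>\<^sup>2 \<ge> 0\<close> over the circle, where \<open>F\<close> is a combination of Szego kernels with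
  coefficients in the Hilbert space and \<open>g\<close> is its image under the adjoint of multiplication by \<open>\<psi>\<close>.\<close>

lemma schur_kernel_closed_disc:
  fixes \<psi> :: "complex \<Rightarrow> 'h::complex_hilbert_space" and e :: "'x \<Rightarrow> 'h"
  assumes hol: "\<And>v. (\<lambda>z. cinner (\<psi> z) v) holomorphic_on cball 0 1"
    and le: "\<And>z. cmod z \<le> 1 \<Longrightarrow> norm (\<psi> z) \<le> 1"
    and z: "\<And>x. cmod (z x) < 1"
  shows "kernel (\<lambda>x y. (cinner (e y) (e x) - cinner (\<psi> (z x)) (e x) * cnj (cinner (\<psi> (z y)) (e y)))
    / (1 - z x * cnj (z y)))"
proof (rule kernelI)
  define \<beta> where "\<beta> x = cinner (\<psi> (z x)) (e x)" for x
  define M where "M x y = (cinner (e y) (e x) - \<beta> x * cnj (\<beta> y)) / (1 - z x * cnj (z y))" for x y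
  fix X :: "'x set" and c :: "'x \<Rightarrow> complex" assume X: "finite X"
  have "(\<Sum>x\<in>X. \<Sum>y\<in>X. cnj (c x) * M x y * c y) \<in> \<real>"
    by (rule hermitian_quadratic_form_real) (simp add: M_def mult_ac flip: cinner_commute)
  then show "(\<Sum>x\<in>X. \<Sum>y\<in>X. cnj (c x) * ((cinner (e y) (e x) - cinner (\<psi> (z x)) (e x) * cnj (cinner (\<psi> (z y)) (e y)))
    / (1 - z x * cnj (z y))) * c y) \<in> \<real>" by (simp add: M_def \<beta>_def)
  define k where "k y \<zeta> = 1 / (1 - cnj (z y) * \<zeta>)" for y \<zeta>
  define \<gamma> where "\<gamma> = circlepath 0 1"
  have nz: "1 - cnj (z y) * \<zeta> \<noteq> 0" if "cmod \<zeta> \<le> 1" for y \<zeta>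
  proof
    assume "1 - cnj (z y) * \<zeta> = 0"
    then have "cmod (z y) * cmod \<zeta> = 1" by (metis eq_iff_diff_eq_0 complex_mod_cnj norm_mult norm_one)
    moreover have "cmod (z y) * cmod \<zeta> \<le> cmod (z y)" using that by (simp add: mult_left_le)
    ultimately show False using z[of y] by simp
  qed
  have hol_k: "k y holomorphic_on cball 0 1" for y
    unfolding k_def by (intro holomorphic_intros) (use nz in auto)
  have szego: "((\<lambda>t. h (\<gamma> t) * cnj (k x (\<gamma> t))) has_integral h (z x)) {0..1}"
    if "h holomorphic_on cball 0 1" for h x
    unfolding k_def \<gamma>_def by (rule szego_reproducing[OF that z])
  define F where "F \<zeta> = (\<Sum>y\<in>X. (c y * k y \<zeta>) *\<^sub>C e y)" for \<zeta>
  define g where "g \<zeta> = (\<Sum>y\<in>X. c y * cnj (\<beta> y) * k y \<zeta>)" for \<zeta>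
  have hol_g: "g holomorphic_on cball 0 1"
    unfolding g_def by (intro holomorphic_intros hol_k)
  \<comment> \<open>\<open>A\<close> is the mean of the squared norm of \<open>F\<close>. Both the
    mixed term and the squared modulus of \<open>g\<close> have mean \<open>B\<close>, so the
    average leaves \<open>A - B\<close>, the quadratic form in question.\<close>
  define A where "A = (\<Sum>x\<in>X. cnj (c x) * (\<Sum>y\<in>X. c y * k y (z x) * cinner (e y) (e x)))"
  define B where "B = (\<Sum>x\<in>X. cnj (c x) * (g (z x) * \<beta> x))"
  have intF: "((\<lambda>t. cinner (F (\<gamma> t)) (F (\<gamma> t))) has_integral A) {0..1}"
  proof -
    have "((\<lambda>t. \<Sum>x\<in>X. cnj (c x) * ((\<Sum>y\<in>X. c y * k y (\<gamma> t) * cinner (e y) (e x)) * cnj (k x (\<gamma> t))))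
        has_integral A) {0..1}"
      unfolding A_def
      by (intro has_integral_sum X has_integral_mult_right
          szego[of "\<lambda>\<zeta>. \<Sum>y\<in>X. c y * k y \<zeta> * cinner (e y) (e x)" for x] holomorphic_intros hol_k)
    moreover have "(\<Sum>x\<in>X. cnj (c x) * ((\<Sum>y\<in>X. c y * k y \<zeta> * cinner (e y) (e x)) * cnj (k x \<zeta>)))
        = cinner (F \<zeta>) (F \<zeta>)" for \<zeta>
    proof -
      have "cinner (F \<zeta>) (F \<zeta>) = (\<Sum>x\<in>X. cinner (F \<zeta>) ((c x * k x \<zeta>) *\<^sub>C e x))"
        by (subst (2) F_def) (rule cinner.sum_right)
      then show ?thesis
        by (simp add: F_def cinner.sum_left cinner_scaleC_left cinner_scaleC_right sum_distrib_left mult_ac)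
    qed
    ultimately show ?thesis by simp
  qed
  have intB: "((\<lambda>t. g (\<gamma> t) * cinner (\<psi> (\<gamma> t)) (F (\<gamma> t))) has_integral B) {0..1}"
  proof -
    have "((\<lambda>t. \<Sum>x\<in>X. cnj (c x) * ((g (\<gamma> t) * cinner (\<psi> (\<gamma> t)) (e x)) * cnj (k x (\<gamma> t))))
        has_integral B) {0..1}"
      unfolding B_def \<beta>_def
      by (intro has_integral_sum X has_integral_mult_right
          szego[of "\<lambda>\<zeta>. g \<zeta> * cinner (\<psi> \<zeta>) (e x)" for x] holomorphic_intros hol_g hol)
    moreover have "(\<Sum>x\<in>X. cnj (c x) * ((g \<zeta> * cinner (\<psi> \<zeta>) (e x)) * cnj (k x \<zeta>)))
        = g \<zeta> * cinner (\<psi> \<zeta>) (F \<zeta>)" for \<zeta>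
      by (simp add: F_def cinner.sum_right cinner_scaleC_right sum_distrib_left mult_ac)
    ultimately show ?thesis by simp
  qed
  have intg: "((\<lambda>t. g (\<gamma> t) * cnj (g (\<gamma> t))) has_integral B) {0..1}"
  proof -
    have "((\<lambda>t. \<Sum>x\<in>X. (cnj (c x) * \<beta> x) * (g (\<gamma> t) * cnj (k x (\<gamma> t))))
        has_integral (\<Sum>x\<in>X. (cnj (c x) * \<beta> x) * g (z x))) {0..1}"
      by (intro has_integral_sum X has_integral_mult_right szego hol_g)
    moreover have "(\<Sum>x\<in>X. (cnj (c x) * \<beta> x) * g (z x)) = B" by (simp add: B_def mult_ac)
    moreover have "(\<Sum>x\<in>X. (cnj (c x) * \<beta> x) * (g \<zeta> * cnj (k x \<zeta>))) = g \<zeta> * cnj (g \<zeta>)" for \<zeta>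
      by (subst (3) g_def) (simp add: sum_distrib_left mult_ac)
    ultimately show ?thesis by simp
  qed
  have "((\<lambda>t. Re (cinner (F (\<gamma> t)) (F (\<gamma> t))) - 2 * Re (g (\<gamma> t) * cinner (\<psi> (\<gamma> t)) (F (\<gamma> t)))
      + Re (g (\<gamma> t) * cnj (g (\<gamma> t)))) has_integral Re A - 2 * Re B + Re B) {0..1}"
    using intF intB intg
    by (intro has_integral_add has_integral_diff has_integral_mult_right)
       (auto dest: has_integral_linear[OF _ bounded_linear_Re] simp: o_def)
  then have "0 \<le> Re A - 2 * Re B + Re B"
  proof (rule has_integral_nonneg)
    fix t :: real
    define \<zeta> where "\<zeta> = \<gamma> t"
    have "cmod \<zeta> = 1" by (simp add: \<zeta>_def \<gamma>_def circlepath)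
    have "0 \<le> (norm (F \<zeta> - g \<zeta> *\<^sub>C \<psi> \<zeta>))\<^sup>2" by simp
    also have "\<dots> = (norm (F \<zeta>))\<^sup>2 - 2 * Re (cinner (g \<zeta> *\<^sub>C \<psi> \<zeta>) (F \<zeta>)) + (cmod (g \<zeta>))\<^sup>2 * (norm (\<psi> \<zeta>))\<^sup>2"
      by (simp only: norm_diff_sq Re_cinner_commute[of "F \<zeta>"] norm_scaleC power_mult_distrib)
    also have "(cmod (g \<zeta>))\<^sup>2 * (norm (\<psi> \<zeta>))\<^sup>2 \<le> (cmod (g \<zeta>))\<^sup>2"
      using le[of \<zeta>] \<open>cmod \<zeta> = 1\<close> by (intro mult_left_le) (auto simp: power_le_one_iff)
    also have "(cmod (g \<zeta>))\<^sup>2 = Re (g \<zeta> * cnj (g \<zeta>))"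
      by (metis Re_complex_of_real complex_norm_square)
    finally show "0 \<le> Re (cinner (F (\<gamma> t)) (F (\<gamma> t))) - 2 * Re (g (\<gamma> t) * cinner (\<psi> (\<gamma> t)) (F (\<gamma> t)))
      + Re (g (\<gamma> t) * cnj (g (\<gamma> t)))"
      by (simp add: \<zeta>_def norm_sq_eq_cinner cinner_scaleC_left)
  qed
  moreover have "A - B = (\<Sum>x\<in>X. \<Sum>y\<in>X. cnj (c x) * M x y * c y)"
    unfolding A_def B_def g_def M_def k_def sum_subtractf[symmetric] sum_distrib_left sum_distrib_right
    by (intro sum.cong refl) (simp add: diff_divide_distrib algebra_simps)
  ultimately show "0 \<le> Re (\<Sum>x\<in>X. \<Sum>y\<in>X. cnj (c x) * ((cinner (e y) (e x)
      - cinner (\<psi> (z x)) (e x) * cnj (cinner (\<psi> (z y)) (e y))) / (1 - z x * cnj (z y))) * c y)"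
    unfolding M_def \<beta>_def by (metis (no_types, lifting) diff_add_cancel diff_diff_eq2 mult_2 minus_complex.sel(1) add_diff_eq add.commute)
qed

text \<open>Dilating only \<open>\<psi>\<close>, by radii \<open>r n\<close> below 1, makes it
  holomorphic on the closed disc; positivity passes to the limit.\<close>

lemma schur_kernel:
  fixes \<psi> :: "complex \<Rightarrow> 'h::complex_hilbert_space" and e :: "'x \<Rightarrow> 'h"
  assumes hol: "\<And>v. (\<lambda>z. cinner (\<psi> z) v) holomorphic_on ball 0 1"
    and le: "\<And>z. cmod z < 1 \<Longrightarrow> norm (\<psi> z) \<le> 1"
    and z: "\<And>x. cmod (z x) < 1"
  shows "kernel (\<lambda>x y. (cinner (e y) (e x) - cinner (\<psi> (z x)) (e x) * cnj (cinner (\<psi> (z y)) (e y)))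
    / (1 - z x * cnj (z y)))"
proof (rule kernel_limit)
  define r where "r n = 1 - 1 / real (Suc (Suc n))" for n
  have r: "0 \<le> r n" "r n < 1" for n by (auto simp: r_def divide_le_eq)
  have rz: "cmod (of_real (r n) * \<zeta>) < 1" if "cmod \<zeta> \<le> 1" for n \<zeta>
    using r[of n] that mult_left_le[of "cmod \<zeta>" "r n"] by (simp add: norm_mult)
  show "kernel (\<lambda>x y. (cinner (e y) (e x) - cinner (\<psi> (of_real (r n) * z x)) (e x)
      * cnj (cinner (\<psi> (of_real (r n) * z y)) (e y))) / (1 - z x * cnj (z y)))" for n
  proof (rule schur_kernel_closed_disc[where \<psi> = "\<lambda>\<zeta>. \<psi> (of_real (r n) * \<zeta>)", OF _ _ z])
    show "(\<lambda>\<zeta>. cinner (\<psi> (of_real (r n) * \<zeta>)) v) holomorphic_on cball 0 1" for v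
      using rz by (intro holomorphic_on_compose_gen[OF _ hol, unfolded o_def] holomorphic_intros) auto
  qed (use le rz in auto)
  fix x y
  have "(\<lambda>n. 1 - 1 / real (Suc (Suc n))) \<longlonglongrightarrow> 1 - 0"
    by (intro tendsto_intros LIMSEQ_Suc[OF LIMSEQ_inverse_real_of_nat, unfolded inverse_eq_divide])
  then have "r \<longlonglongrightarrow> 1" by (simp add: r_def[abs_def])
  then have rlim: "(\<lambda>n. of_real (r n) * z x) \<longlonglongrightarrow> of_real 1 * z x" for x
    by (intro tendsto_intros)
  have "(\<lambda>n. cinner (\<psi> (of_real (r n) * z x)) (e x)) \<longlonglongrightarrow> cinner (\<psi> (of_real 1 * z x)) (e x)" for x
    by (rule continuous_on_tendsto_compose[OF holomorphic_on_imp_continuous_on[OF hol, of "e x"] rlim])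
       (simp_all add: z rz less_imp_le[OF z])
  then show "(\<lambda>n. (cinner (e y) (e x) - cinner (\<psi> (of_real (r n) * z x)) (e x)
      * cnj (cinner (\<psi> (of_real (r n) * z y)) (e y))) / (1 - z x * cnj (z y)))
    \<longlonglongrightarrow> (cinner (e y) (e x) - cinner (\<psi> (z x)) (e x) * cnj (cinner (\<psi> (z y)) (e y)))
    / (1 - z x * cnj (z y))"
    using norm_product_less_1[OF z z, of x y] by (intro tendsto_intros) auto
qed

section \<open>From a positive kernel to a Schur function\<close>

lemma resolvent_solution:
  fixes D :: "'h::complex_hilbert_space \<Rightarrow>\<^sub>L 'h"
  assumes D: "norm D \<le> 1" and z: "cmod z < 1"
  shows "\<exists>!x. y + z *\<^sub>C blinfun_apply D x = x"
proof (rule banach_fix_type[OF _ z])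
  have Dle: "norm (blinfun_apply D x) \<le> norm x" for x
    using norm_blinfun[of D x] mult_right_mono[OF D, of "norm x"] by simp
  show "\<forall>u v. dist (y + z *\<^sub>C blinfun_apply D u) (y + z *\<^sub>C blinfun_apply D v) \<le> cmod z * dist u v"
    using Dle by (auto simp: dist_norm norm_scaleC mult_left_mono simp flip: scaleC_diff_right blinfun.diff_right)
qed simp

text \<open>Differentiating the equation of \<open>h\<close> formally yields one for
  \<open>d\<close>, again solvable. The remainder satisfies such an equation too, with a right-hand
  side of second order in \<open>z - z0\<close>.\<close>

lemma resolvent_has_derivative:
  fixes D :: "'h::complex_hilbert_space \<Rightarrow>\<^sub>L 'h"
  assumes D: "D \<in> bounded_ops" "norm D \<le> 1" and z0: "cmod z0 < 1"
    and h: "\<And>z. cmod z < 1 \<Longrightarrow> b + z *\<^sub>C blinfun_apply D (h z) = h z"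
  shows "\<exists>d. (h has_derivative (\<lambda>k. k *\<^sub>C d)) (at z0)"
proof -
  have Dle: "norm (blinfun_apply D x) \<le> norm x" for x
    using norm_blinfun[of D x] mult_right_mono[OF D(2), of "norm x"] by simp
  have bound: "norm x * (1 - cmod z) \<le> norm y" if x: "x = y + z *\<^sub>C blinfun_apply D x" and "cmod z < 1" for x y z
  proof -
    have "norm x \<le> norm y + norm (z *\<^sub>C blinfun_apply D x)"
      by (subst x) (rule norm_triangle_ineq)
    also have "\<dots> \<le> norm y + cmod z * norm x" by (simp add: norm_scaleC Dle mult_left_mono)
    finally show ?thesis by (simp add: algebra_simps)
  qed
  obtain d where d: "blinfun_apply D (h z0) + z0 *\<^sub>C blinfun_apply D d = d"
    using resolvent_solution[OF D(2) z0] by blast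
  have diff: "norm (h z - h z0) * (1 - cmod z) \<le> cmod (z - z0) * norm (h z0)" if z: "cmod z < 1" for z
  proof -
    have "h z - h z0 = (z - z0) *\<^sub>C blinfun_apply D (h z0) + z *\<^sub>C blinfun_apply D (h z - h z0)"
      by (subst (1) h[OF z, symmetric], subst (1) h[OF z0, symmetric])
         (simp add: blinfun.diff_right scaleC_diff_left scaleC_diff_right)
    from bound[OF this z] show ?thesis
      using Dle[of "h z0"] by (simp add: norm_scaleC) (meson mult_left_mono norm_ge_zero order_trans)
  qed
  have err: "norm (h z - h z0 - (z - z0) *\<^sub>C d) * (1 - cmod z0) \<le> cmod (z - z0) * norm (h z - h z0)"
    if z: "cmod z < 1" for z
  proof -
    define q where "q = h z - h z0 - (z - z0) *\<^sub>C d"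
    have "q = (z *\<^sub>C blinfun_apply D (h z) - z0 *\<^sub>C blinfun_apply D (h z0))
        - (z - z0) *\<^sub>C (blinfun_apply D (h z0) + z0 *\<^sub>C blinfun_apply D d)"
      unfolding q_def d by (subst (1) h[OF z, symmetric], subst (1) h[OF z0, symmetric]) simp
    also have "\<dots> = (z - z0) *\<^sub>C blinfun_apply D (h z - h z0) + z0 *\<^sub>C blinfun_apply D q"
      by (simp add: q_def blinfun.diff_right blinfun.add_right bounded_ops_scaleC[OF D(1)] scaleC_diff_left scaleC_diff_right
          scaleC_add_right scaleC_scaleC algebra_simps)
    finally have "norm q * (1 - cmod z0) \<le> norm ((z - z0) *\<^sub>C blinfun_apply D (h z - h z0))"
      by (rule bound[OF _ z0])
    also have "\<dots> \<le> cmod (z - z0) * norm (h z - h z0)"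
      by (simp add: norm_scaleC Dle mult_left_mono)
    finally show ?thesis by (simp add: q_def)
  qed
  define w where "w z = cmod (z - z0) * norm (h z0) / ((1 - cmod z) * (1 - cmod z0))" for z
  have "w \<midarrow>z0\<rightarrow> cmod (z0 - z0) * norm (h z0) / ((1 - cmod z0) * (1 - cmod z0))"
    unfolding w_def using z0 by (intro tendsto_intros) auto
  then have w0: "w \<midarrow>z0\<rightarrow> 0" by simp
  have "(h has_derivative (\<lambda>k. k *\<^sub>C d)) (at z0)"
    unfolding has_derivative_iff_norm
  proof
    show "bounded_linear (\<lambda>k. k *\<^sub>C d)" by (rule scaleC.bounded_linear_left)
    show "((\<lambda>y. norm (h y - h z0 - (y - z0) *\<^sub>C d) / norm (y - z0)) \<longlongrightarrow> 0) (at z0)"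
    proof (rule tendsto_sandwich[OF _ _ tendsto_const w0])
      have "eventually (\<lambda>y. y \<in> ball 0 1 - {z0}) (at z0)"
        using z0 eventually_at_in_open[of "ball 0 1" z0] by simp
      then show "\<forall>\<^sub>F y in at z0. norm (h y - h z0 - (y - z0) *\<^sub>C d) / norm (y - z0) \<le> w y"
      proof (rule eventually_mono)
        fix y assume "y \<in> ball 0 1 - {z0}"
        then have y: "cmod y < 1" "0 < cmod (y - z0)" by auto
        have "norm (h y - h z0 - (y - z0) *\<^sub>C d) / cmod (y - z0) \<le> norm (h y - h z0) / (1 - cmod z0)"
          using err[OF y(1)] y z0 by (simp add: divide_simps mult.commute)
        also have "\<dots> \<le> (cmod (y - z0) * norm (h z0) / (1 - cmod y)) / (1 - cmod z0)"
          using diff[OF y(1)] y z0 by (intro divide_right_mono) (auto simp: pos_le_divide_eq)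
        finally show "norm (h y - h z0 - (y - z0) *\<^sub>C d) / norm (y - z0) \<le> w y"
          by (simp add: w_def)
      qed
    qed simp
  qed
  then show ?thesis by blast
qed

text \<open>\<open>\<psi>\<close> is the transfer function of \<open>S\<close>: a contraction, with
  the state \<open>h z\<close> fed back through multiplication by \<open>z\<close>.\<close>

theorem schur_interpolation:
  fixes e :: "'x \<Rightarrow> 'h::complex_hilbert_space" and L :: "'x \<Rightarrow> 'x \<Rightarrow> complex"
  assumes L: "kernel L" and \<phi>: "\<And>x. cmod (\<phi> x) < 1"
    and eq: "\<And>x y. L x y * (1 - \<phi> x * cnj (\<phi> y)) = cinner (e y) (e x) - \<phi> x * cnj (\<phi> y)"
  obtains \<psi> :: "complex \<Rightarrow> 'h" where "\<And>z. cmod z < 1 \<Longrightarrow> norm (\<psi> z) \<le> 1"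
    "\<And>z. cmod z < 1 \<Longrightarrow> \<exists>d. (\<psi> has_derivative (\<lambda>k. k *\<^sub>C d)) (at z)"
    "\<And>x. cinner (\<psi> (\<phi> x)) (e x) = \<phi> x"
proof -
  obtain l :: "'x \<Rightarrow> 'x ell2" where l: "\<And>x y. L x y = cinner (l y) (l x)"
    using kernel_factorization[OF L] by blast
  define v where "v y = (e y, cnj (\<phi> y) *\<^sub>C l y)" for y
  define w where "w y = (cnj (\<phi> y), l y)" for y
  have lurking: "cinner (w j) (w i) = cinner (v j) (v i)" for i j
    using eq[of i j] by (simp add: v_def w_def cinner_complex_def cinner_scaleC_left cinner_scaleC_right l algebra_simps)
  obtain S :: "(complex \<times> 'x ell2) \<Rightarrow>\<^sub>L ('h \<times> 'x ell2)" where S: "S \<in> bounded_ops" "norm S \<le> 1"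
    and Sv: "\<And>y q. cinner (v y) (blinfun_apply S q) = cinner (w y) q"
    by (rule adjoint_of_family[of w 1 v]) (simp_all add: norm_combination_eqI[OF lurking])
  have S_le: "norm (blinfun_apply S x) \<le> norm x" for x
    using norm_blinfun[of S x] mult_right_mono[OF S(2), of "norm x"] by simp
  have S_zero_scale: "blinfun_apply S (0, c *\<^sub>C x) = c *\<^sub>C blinfun_apply S (0, x)" for c x
    using bounded_ops_scaleC[OF S(1), of c "(0, x)"] by simp
  have S_split: "blinfun_apply S (1, x) = blinfun_apply S (1, 0) + blinfun_apply S (0, x)" for x
    by (simp flip: blinfun.add_right)
  \<comment> \<open>The block of \<open>S\<close> from states to states.\<close>
  obtain D where D: "D \<in> bounded_ops" "norm D \<le> 1" and Dx: "\<And>x. blinfun_apply D x = snd (blinfun_apply S (0, x))"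
  proof (rule bounded_opsE[of "\<lambda>x. snd (blinfun_apply S (0, x))" 1])
    show "snd (blinfun_apply S (0, x + y)) = snd (blinfun_apply S (0, x)) + snd (blinfun_apply S (0, y))" for x y
      by (simp flip: snd_add blinfun.add_right)
    show "norm (snd (blinfun_apply S (0, x))) \<le> 1 * norm x" for x
      using order_trans[OF norm_snd_le[of "snd (blinfun_apply S (0, x))" "fst (blinfun_apply S (0, x))"]]
        S_le[of "(0, x)"] by (simp add: norm_prod_def[of "(0, x)"])
  qed (simp_all add: S_zero_scale scaleC_prod_def)
  define b where "b = snd (blinfun_apply S (1, 0))"
  define h where "h z = (THE x. b + z *\<^sub>C blinfun_apply D x = x)" for z
  have h: "b + z *\<^sub>C blinfun_apply D (h z) = h z" if "cmod z < 1" for z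
    unfolding h_def by (rule theI'[OF resolvent_solution[OF D(2) that]])
  define \<psi> where "\<psi> z = fst (blinfun_apply S (1, z *\<^sub>C h z))" for z
  have S\<psi>: "blinfun_apply S (1, z *\<^sub>C h z) = (\<psi> z, h z)" if "cmod z < 1" for z
  proof -
    have "snd (blinfun_apply S (1, z *\<^sub>C h z)) = b + z *\<^sub>C blinfun_apply D (h z)"
      by (subst S_split) (simp add: b_def S_zero_scale Dx scaleC_prod_def)
    then show ?thesis by (simp add: \<psi>_def h[OF that] prod_eq_iff)
  qed
  show ?thesis
  proof
    \<comment> \<open>Energy balance for the contraction \<open>S\<close>: the state leaves with at
      least the norm with which it entered, as \<open>cmod z < 1\<close>.\<close>
    show "norm (\<psi> z) \<le> 1" if z: "cmod z < 1" for z
    proof -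
      have "(norm (blinfun_apply S (1, z *\<^sub>C h z)))\<^sup>2 \<le> (norm (1 :: complex, z *\<^sub>C h z))\<^sup>2"
        by (intro power_mono S_le) simp
      then have "(norm (\<psi> z))\<^sup>2 + (norm (h z))\<^sup>2 \<le> 1 + (cmod z)\<^sup>2 * (norm (h z))\<^sup>2"
        by (simp add: S\<psi>[OF z] norm_Pair_sq norm_scaleC power_mult_distrib)
      moreover have "(cmod z)\<^sup>2 * (norm (h z))\<^sup>2 \<le> (norm (h z))\<^sup>2"
        using z by (intro mult_left_le_one_le) (auto simp: power_le_one_iff)
      ultimately have "(norm (\<psi> z))\<^sup>2 \<le> 1\<^sup>2" by simp
      then show ?thesis by (rule power2_le_imp_le) simp
    qed
    show "\<exists>d. (\<psi> has_derivative (\<lambda>k. k *\<^sub>C d)) (at z)" if z: "cmod z < 1" for z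
    proof -
      obtain d where d: "(h has_derivative (\<lambda>k. k *\<^sub>C d)) (at z)"
        using resolvent_has_derivative[OF D z h] by blast
      have "((\<lambda>z. z *\<^sub>C h z) has_derivative (\<lambda>k. z *\<^sub>C (k *\<^sub>C d) + k *\<^sub>C h z)) (at z)"
        by (rule scaleC.FDERIV[OF has_derivative_ident d])
      then have "((\<lambda>z. (1, z *\<^sub>C h z)) has_derivative (\<lambda>k. (0, z *\<^sub>C (k *\<^sub>C d) + k *\<^sub>C h z))) (at z)"
        by (intro has_derivative_Pair has_derivative_const)
      then have "(\<psi> has_derivative (\<lambda>k. fst (blinfun_apply S (0, z *\<^sub>C (k *\<^sub>C d) + k *\<^sub>C h z)))) (at z)"
        unfolding \<psi>_def
        by (rule bounded_linear.has_derivative[OF bounded_linear_compose[OF bounded_linear_fst blinfun.bounded_linear_right]])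
      moreover have "fst (blinfun_apply S (0, z *\<^sub>C (k *\<^sub>C d) + k *\<^sub>C h z))
          = k *\<^sub>C fst (blinfun_apply S (0, z *\<^sub>C d + h z))" for k
      proof -
        have "z *\<^sub>C (k *\<^sub>C d) + k *\<^sub>C h z = k *\<^sub>C (z *\<^sub>C d + h z)"
          by (simp add: scaleC_add_right scaleC_scaleC mult.commute)
        then show ?thesis by (simp only: S_zero_scale) (simp add: scaleC_prod_def)
      qed
      ultimately show ?thesis by auto
    qed
    \<comment> \<open>Pairing \<open>S (1, \<phi> x *\<^sub>C h (\<phi> x))\<close> with
      \<open>v x\<close> yields the same state term on both sides of the adjoint relation; what
      remains is the interpolation condition.\<close>
    show "cinner (\<psi> (\<phi> x)) (e x) = \<phi> x" for x
    proof -
      have "cinner (e x) (\<psi> (\<phi> x)) = cnj (\<phi> x)"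
        using Sv[of x "(1, \<phi> x *\<^sub>C h (\<phi> x))"] S\<psi>[OF \<phi>, of x]
        by (simp add: v_def w_def cinner_complex_def cinner_scaleC_left cinner_scaleC_right)
      then show ?thesis by (subst cinner_commute) simp
    qed
  qed
qed

section \<open>The characterization\<close>

theorem theorem3p2:
  fixes K :: "'x \<Rightarrow> 'x \<Rightarrow> complex"
    and w :: 'x
    and u :: "'x \<Rightarrow> ('e::complex_hilbert_space \<Rightarrow>\<^sub>L complex)"
    and \<phi> :: "'x \<Rightarrow> complex"
  assumes "cnp_kernel K"
    and "normalized_at K w"
    and "\<forall>x. u x \<in> open_unit_ball_ops"
    and "u w = 0"
    and "K = kernel_of u"
    and "\<forall>x. \<phi> x \<in> ball 0 1"
    and "\<not> \<phi> constant_on UNIV"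
    and "\<phi> \<in> contractive_multipliers (kernel_of u)"
    and "\<phi> w = 0"
  shows "cnp_kernel (dbr_kernel (kernel_of u) \<phi>) \<longleftrightarrow>
    (\<exists>\<Psi> :: complex \<Rightarrow> (complex \<Rightarrow>\<^sub>L 'e). \<Psi> \<in> Hinf1 \<and>
      (\<forall>x. \<phi> x = op_complex (u x o\<^sub>L \<Psi> (\<phi> x))))"
proof -
  \<comment> \<open>The Riesz vector of the functional \<open>u x\<close>.\<close>
  define e where "e x = blinfun_apply (hilbert_adjoint (u x)) 1" for x
  have u: "u x \<in> bounded_ops" "norm (u x) < 1" for x
    using assms(3) by (auto simp: open_unit_ball_ops_def)
  have u_apply: "blinfun_apply (u x) v = cinner v (e x)" for x v
    using hilbert_adjoint_props(1)[OF u(1), of x v 1] by (simp add: cinner_complex_def e_def)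
  have norm_e: "norm (e x) < 1" for x
    using norm_blinfun[of "hilbert_adjoint (u x)" 1] hilbert_adjoint_props(3)[OF u(1), of x] u(2)[of x]
    by (simp add: e_def)
  have Ku: "kernel_of u x y = 1 / (1 - cinner (e y) (e x))" for x y
    by (simp add: kernel_of_def op_complex_def u_apply flip: e_def)
  have \<phi>: "cmod (\<phi> x) < 1" for x using assms(6) by (simp add: dist_norm)
  have nz\<phi>: "1 - \<phi> x * cnj (\<phi> y) \<noteq> 0" for x y using norm_product_less_1[OF \<phi> \<phi>, of x y] by auto
  have nze: "1 - cinner (e y) (e x) \<noteq> 0" for x y
    using norm_kernel_less_1[OF kernel_gram[of e], of y x] norm_e
    by (auto simp: power_less_one_iff cinner_self simp flip: norm_sq_eq_cinner)
  define L where "L x y = (cinner (e y) (e x) - \<phi> x * cnj (\<phi> y)) / (1 - \<phi> x * cnj (\<phi> y))" for x y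
  have dbr: "dbr_kernel (kernel_of u) \<phi> x y = (1 - \<phi> x * cnj (\<phi> y)) / (1 - cinner (e y) (e x))" for x y
    by (simp add: dbr_kernel_def Ku)
  have L1: "1 - L x y = (1 - cinner (e y) (e x)) / (1 - \<phi> x * cnj (\<phi> y))" for x y
    using nz\<phi>[of x y] by (simp add: L_def field_simps)
  have "cnp_kernel (dbr_kernel (kernel_of u) \<phi>) \<longleftrightarrow> kernel L"
  proof
    assume cnp: "cnp_kernel (dbr_kernel (kernel_of u) \<phi>)"
    \<comment> \<open>Together with \<open>\<phi> w = 0\<close> this normalizes the de
      Branges--Rovnyak kernel at \<open>w\<close>.\<close>
    have "e w = 0" using u_apply[of w "e w"] assms(4) by (simp add: cinner_self)
    then have "kernel (\<lambda>x y. 1 - 1 / dbr_kernel (kernel_of u) \<phi> x y)"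
      using nz\<phi> nze assms(9) by (intro cnp_kernel_imp_kernel[OF cnp, of w]) (auto simp: dbr)
    moreover have "1 - 1 / dbr_kernel (kernel_of u) \<phi> x y = L x y" for x y
      using L1[of x y] by (simp add: dbr algebra_simps)
    ultimately show "kernel L" by simp
  next
    assume L: "kernel L"
    have "Re (L x x) < 1" for x
    proof -
      have "1 - L x x = of_real ((1 - (norm (e x))\<^sup>2) / (1 - (cmod (\<phi> x))\<^sup>2))"
        unfolding L1 by (simp add: cinner_self complex_norm_square[symmetric])
      then have "1 - Re (L x x) = (1 - (norm (e x))\<^sup>2) / (1 - (cmod (\<phi> x))\<^sup>2)"
        by (metis Re_complex_of_real minus_complex.sel(1) one_complex.sel(1))
      moreover have "(1 - (norm (e x))\<^sup>2) / (1 - (cmod (\<phi> x))\<^sup>2) > 0"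
        using norm_e[of x] \<phi>[of x] by (intro divide_pos_pos) (auto simp: power_less_one_iff)
      ultimately show ?thesis by simp
    qed
    from cnp_kernel_geometric[OF L this]
    have "cnp_kernel (\<lambda>x y. 1 / (1 - L x y))" .
    then show "cnp_kernel (dbr_kernel (kernel_of u) \<phi>)"
      unfolding L1 by (simp add: dbr[abs_def])
  qed
  also have "\<dots> \<longleftrightarrow> (\<exists>\<Psi> :: complex \<Rightarrow> (complex \<Rightarrow>\<^sub>L 'e). \<Psi> \<in> Hinf1 \<and>
      (\<forall>x. \<phi> x = op_complex (u x o\<^sub>L \<Psi> (\<phi> x))))"
  proof
    assume L: "kernel L"
    obtain \<psi> :: "complex \<Rightarrow> 'e" where \<psi>: "\<And>z. cmod z < 1 \<Longrightarrow> norm (\<psi> z) \<le> 1"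
      and d\<psi>: "\<And>z. cmod z < 1 \<Longrightarrow> \<exists>d. (\<psi> has_derivative (\<lambda>k. k *\<^sub>C d)) (at z)"
      and interp: "\<And>x. cinner (\<psi> (\<phi> x)) (e x) = \<phi> x"
      by (rule schur_interpolation[where e = e and \<phi> = \<phi>, OF L \<phi>]) (use nz\<phi> in \<open>auto simp: L_def\<close>)
    \<comment> \<open>Identifies a vector with the operator on the scalars that sends 1 to
      it.\<close>
    define J where "J v = Blinfun (\<lambda>c. c *\<^sub>C v)" for v :: 'e
    have J: "blinfun_apply (J v) c = c *\<^sub>C v" for v c
      unfolding J_def by (simp add: bounded_linear_Blinfun_apply[OF scaleC.bounded_linear_left])
    have Jle: "norm (J v) \<le> norm v" for v
      by (rule norm_blinfun_bound) (simp_all add: J norm_scaleC mult.commute)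
    have Jscale: "J (c *\<^sub>C v) = c *\<^sub>C J v" for c v
      by (rule blinfun_eqI) (simp add: J scaleC_blinfun.rep_eq scaleC_scaleC mult.commute)
    have Jlin: "bounded_linear J"
    proof (rule bounded_linear_intro[where K = 1])
      show "J (r *\<^sub>R v) = r *\<^sub>R J v" for r v
        by (rule blinfun_eqI) (simp add: J blinfun.scaleR_left scaleC_scaleR)
    qed (simp_all add: Jle blinfun_eqI J blinfun.add_left scaleC_add_right)
    have "(\<lambda>z. J (\<psi> z)) \<in> Hinf1"
      unfolding Hinf1_def
    proof (intro CollectI conjI ballI)
      show "vholomorphic_on (\<lambda>z. J (\<psi> z)) (ball 0 1)"
        unfolding vholomorphic_on_def
      proof
        fix z :: complex assume "z \<in> ball 0 1"
        then obtain d where "(\<psi> has_derivative (\<lambda>k. k *\<^sub>C d)) (at z)" using d\<psi> by auto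
        then have "((\<lambda>z. J (\<psi> z)) has_derivative (\<lambda>k. J (k *\<^sub>C d))) (at z)"
          by (rule bounded_linear.has_derivative[OF Jlin])
        then show "\<exists>d. ((\<lambda>z. J (\<psi> z)) has_derivative (\<lambda>k. k *\<^sub>C d)) (at z within ball 0 1)"
          unfolding Jscale using has_derivative_at_withinI by blast
      qed
      show "J (\<psi> z) \<in> bounded_ops" for z
        by (simp add: bounded_ops_def J scaleC_scaleC scaleC_complex_def)
      show "norm (J (\<psi> z)) \<le> 1" if "z \<in> ball 0 1" for z
        using order_trans[OF Jle \<psi>] that by simp
    qed
    moreover have "\<phi> x = op_complex (u x o\<^sub>L J (\<psi> (\<phi> x)))" for x
      by (simp add: op_complex_def J u_apply interp)
    ultimately show "\<exists>\<Psi> :: complex \<Rightarrow> (complex \<Rightarrow>\<^sub>L 'e). \<Psi> \<in> Hinf1 \<and> (\<forall>x. \<phi> x = op_complex (u x o\<^sub>L \<Psi> (\<phi> x)))"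
      by blast
  next
    assume "\<exists>\<Psi> :: complex \<Rightarrow> (complex \<Rightarrow>\<^sub>L 'e). \<Psi> \<in> Hinf1 \<and> (\<forall>x. \<phi> x = op_complex (u x o\<^sub>L \<Psi> (\<phi> x)))"
    then obtain \<Psi> :: "complex \<Rightarrow> (complex \<Rightarrow>\<^sub>L 'e)" where \<Psi>: "\<Psi> \<in> Hinf1"
      and "\<And>x. \<phi> x = op_complex (u x o\<^sub>L \<Psi> (\<phi> x))" by blast
    then have interp: "\<phi> x = cinner (blinfun_apply (\<Psi> (\<phi> x)) 1) (e x)" for x
      by (simp add: op_complex_def u_apply)
    have "kernel (\<lambda>x y. (cinner (e y) (e x) - cinner (blinfun_apply (\<Psi> (\<phi> x)) 1) (e x)
        * cnj (cinner (blinfun_apply (\<Psi> (\<phi> y)) 1) (e y))) / (1 - \<phi> x * cnj (\<phi> y)))"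
    proof (rule schur_kernel[where z = \<phi>, OF _ _ \<phi>])
      show "norm (blinfun_apply (\<Psi> z) 1) \<le> 1" if "cmod z < 1" for z
        using norm_blinfun[of "\<Psi> z" 1] \<Psi> that by (auto simp: Hinf1_def intro: order_trans)
      show "(\<lambda>z. cinner (blinfun_apply (\<Psi> z) 1) v) holomorphic_on ball 0 1" for v
        unfolding holomorphic_on_def
      proof
        fix z :: complex assume "z \<in> ball 0 1"
        then obtain d where d: "(\<Psi> has_derivative (\<lambda>k. k *\<^sub>C d)) (at z within ball 0 1)"
          using \<Psi> unfolding Hinf1_def vholomorphic_on_def by blast
        have "bounded_linear (\<lambda>T :: complex \<Rightarrow>\<^sub>L 'e. cinner (blinfun_apply T 1) v)"
          by (rule bounded_linear_compose[OF cinner.bounded_linear_left blinfun.bounded_linear_left])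
        from bounded_linear.has_derivative[OF this d]
        have "((\<lambda>z. cinner (blinfun_apply (\<Psi> z) 1) v) has_derivative
            (\<lambda>k. cinner (blinfun_apply d 1) v * k)) (at z within ball 0 1)"
          by (simp add: scaleC_blinfun.rep_eq cinner_scaleC_left mult.commute)
        then show "(\<lambda>z. cinner (blinfun_apply (\<Psi> z) 1) v) field_differentiable at z within ball 0 1"
          unfolding field_differentiable_def has_field_derivative_def by blast
      qed
    qed
    \<comment> \<open>The interpolation condition turns the Schur kernel of \<open>\<Psi>\<close>,
      pulled back along \<open>\<phi>\<close>, into \<open>L\<close>.\<close>
    then show "kernel L" unfolding L_def[abs_def] by (simp flip: interp)
  qed
  finally show ?thesis .
qed

end
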